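(* There is an absolute constant $C>0$ such that the following holds. Let $d\ge1$ and let $\Sigma=\Sigma_{1,2d}\subset\mathbb R^{2d+1}$ be the cone of coefficient vectors (in the monomial basis) of univariate sum-of-squares polynomials of degree at most $2d$. Let $\mathbf t\in\Sigma^\circ$ be an integer vector and $\tau=\log(\|\mathbf t\|_\infty)$. Then there exists an integer dual certificate $\overline{\mathbf y}\in(\Sigma^* )^\circ\cap\mathbb Z^{2d+1}$ of $\mathbf t$ with $$\log(\|\overline{\mathbf y}\|_\infty)\le C\,(1+\tau d+d\log d).$$
   Context: Univariate polynomials of degree at most $2d$ are identified with their coefficient vectors in $\mathbb R^{2d+1}$ in the monomial basis, indexed $0,\dots,2d$. $\Sigma^*=\{\mathbf y\in\mathbb R^{2d+1}:\mathbf x^{\mathrm T}\mathbf y\ge0\ \forall\mathbf x\in\Sigma\}$. $\Lambda:\mathbb R^{2d+1}\to\mathbb S^{d+1}$ is the linear map sending $\mathbf x$ to its Hankel matrix $(x_{i+j})_{0\le i,j\le d}$. Then $\Sigma^*=\{\mathbf x:\Lambda(\mathbf x)\succcurlyeq0\}$ and $(\Sigma^* )^\circ=\{\mathbf x:\Lambda(\mathbf x)\succ0\}$; $^\circ$ denotes interior. Let $f(\mathbf x)=-\ln\det\Lambda(\mathbf x)$ on $(\Sigma^* )^\circ$, with (positive definite) Hessian $H$. A vector $\mathbf x\in(\Sigma^* )^\circ$ is a dual certificate of $\mathbf s\in\Sigma$ if $H(\mathbf x)^{-1}\mathbf s\in\Sigma^*$. Logarithms are base 2. *)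

theory Defs
  imports
    "HOL-Analysis.Analysis"
    "HOL-Computational_Algebra.Polynomial"
    "Jordan_Normal_Form.Determinant"
    "Jordan_Normal_Form.Gauss_Jordan_Elimination"
begin

text \<open>
  Vectors of \<open>\<real>\<^sup>n\<close> are functions \<open>nat \<Rightarrow> real\<close> that vanish from index \<open>n\<close> on, i.e. the points of
  the library's topological space \<open>Euclidean_space n\<close>; vectors and polynomials are thereby
  identified through \<open>coeff\<close>. Matrices are those of \<open>Jordan_Normal_Form\<close>.
\<close>

definition inner_prod :: "nat \<Rightarrow> (nat \<Rightarrow> real) \<Rightarrow> (nat \<Rightarrow> real) \<Rightarrow> real" where
  "inner_prod n x y = (\<Sum>i<n. x i * y i)"

definition max_norm :: "nat \<Rightarrow> (nat \<Rightarrow> real) \<Rightarrow> real" where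
  "max_norm n x = Max ((\<lambda>i. \<bar>x i\<bar>) ` {..<n})"

definition integer_vector :: "nat \<Rightarrow> (nat \<Rightarrow> real) \<Rightarrow> bool" where
  "integer_vector n x \<longleftrightarrow> x \<in> topspace (Euclidean_space n) \<and> (\<forall>i<n. x i \<in> \<int>)"

definition mat_apply :: "nat \<Rightarrow> real mat \<Rightarrow> (nat \<Rightarrow> real) \<Rightarrow> (nat \<Rightarrow> real)" where
  "mat_apply n A x = (\<lambda>i. if i < n then vec_index (A *\<^sub>v Matrix.vec n x) i else 0)"

definition is_sos :: "real poly \<Rightarrow> bool" where
  "is_sos p \<longleftrightarrow> (\<exists>qs. p = (\<Sum>q\<leftarrow>qs. q\<^sup>2))"

definition sos_cone :: "nat \<Rightarrow> (nat \<Rightarrow> real) set" where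
  "sos_cone d = {coeff p | p. degree p \<le> 2 * d \<and> is_sos p}"

definition dual_cone :: "nat \<Rightarrow> (nat \<Rightarrow> real) set \<Rightarrow> (nat \<Rightarrow> real) set" where
  "dual_cone n K = {y \<in> topspace (Euclidean_space n). \<forall>x\<in>K. inner_prod n x y \<ge> 0}"

abbreviation sos_dual :: "nat \<Rightarrow> (nat \<Rightarrow> real) set" where
  "sos_dual d \<equiv> dual_cone (2 * d + 1) (sos_cone d)"

abbreviation interior_in :: "nat \<Rightarrow> (nat \<Rightarrow> real) set \<Rightarrow> (nat \<Rightarrow> real) set" where
  "interior_in n S \<equiv> Euclidean_space n interior_of S"

definition hankel :: "nat \<Rightarrow> (nat \<Rightarrow> real) \<Rightarrow> real mat" where
  "hankel d x = Matrix.mat (d + 1) (d + 1) (\<lambda>(i, j). x (i + j))"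

text \<open>The barrier is only meaningful on the interior of the dual cone; outside it the values are arbitrary.\<close>

definition barrier :: "nat \<Rightarrow> (nat \<Rightarrow> real) \<Rightarrow> real" where
  "barrier d x = - ln (Determinant.det (hankel d x))"

definition partial_deriv :: "nat \<Rightarrow> ((nat \<Rightarrow> real) \<Rightarrow> real) \<Rightarrow> (nat \<Rightarrow> real) \<Rightarrow> real" where
  "partial_deriv i f x = deriv (\<lambda>u. f (x(i := u))) (x i)"

definition hessian :: "nat \<Rightarrow> ((nat \<Rightarrow> real) \<Rightarrow> real) \<Rightarrow> (nat \<Rightarrow> real) \<Rightarrow> real mat" where
  "hessian n f x = Matrix.mat n n (\<lambda>(i, j). partial_deriv i (partial_deriv j f) x)"

text \<open>
  \<open>\<exists>Hinv. mat_inverse H = Some Hinv\<close> says that \<open>H\<close> is invertible with inverse \<open>Hinv\<close>.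
\<close>

definition dual_certificate :: "nat \<Rightarrow> (nat \<Rightarrow> real) \<Rightarrow> (nat \<Rightarrow> real) \<Rightarrow> bool" where
  "dual_certificate d x s \<longleftrightarrow>
     x \<in> interior_in (2 * d + 1) (sos_dual d) \<and> s \<in> sos_cone d \<and>
     (\<exists>Hinv. mat_inverse (hessian (2 * d + 1) (barrier d) x) = Some Hinv \<and>
             mat_apply (2 * d + 1) Hinv s \<in> sos_dual d)"

end

theory Submission
  imports
    Defs
    "HOL-Computational_Algebra.Fundamental_Theorem_Algebra"
    "HOL-Computational_Algebra.Field_as_Ring"
    "Subresultants.Subresultant_Gcd"
begin

text \<open>
  Write \<open>\<Lambda> = hankel d\<close> and \<open>n = d + 1\<close>. A maximizer \<open>x\<close> of \<open>det \<Lambda>\<close> on the compact slice \<open>t\<^sup>T x = n\<close> of the dual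
  cone is a certificate with \<open>t = \<Lambda>\<^sup>*(\<Lambda>(x)\<inverse>)\<close>, where \<open>\<Lambda>\<^sup>*\<close> is the adjoint of \<open>\<Lambda>\<close>; the integer certificate
  is \<open>N x\<close> rounded to the nearest integers. Since every vector close to \<open>N x\<close> in the norm of the
  Hessian at \<open>N x\<close> is again a certificate, \<open>N\<close> only has to exceed a multiple of \<open>n tr \<Lambda>(x)\<inverse>\<close>. The
  polynomial \<open>t\<close> has the Gram matrix \<open>\<Lambda>(x)\<inverse>\<close>, so this trace is bounded by the values of \<open>t\<close> at
  \<open>0, \<dots>, d\<close>.

  The size of \<open>x\<close> is controlled by the inequality \<open>\<bar>z\<bar>\<^sup>k \<le> H t(z)\<close>, which makes
  \<open>H t \<plusminus> z\<^sup>k\<close> a sum of squares. It rests on a lower bound for the critical values of \<open>t\<close>: these are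
  roots of the resultant of \<open>t'\<close> and \<open>t - \<lambda>\<close>, a nonzero integer polynomial in \<open>\<lambda>\<close>, and a nonzero
  root of an integer polynomial cannot be much smaller than the inverse of its coefficients. Taking
  the lowest nonzero coefficient here covers the case in which \<open>t\<close> has multiple complex roots.
\<close>

section \<open>Sums of squares\<close>

text \<open>The Hessian at \<open>x\<close> maps \<open>u\<close> to the adjoint of \<Lambda> at
  \<open>\<Lambda>(x)\<inverse> \<Lambda>(u) \<Lambda>(x)\<inverse>\<close>. For
  \<open>u = x\<close> this is \<open>t\<close>, so the inverse Hessian maps \<open>t\<close> back
  to \<open>x\<close>, an interior point of the dual cone. Scaling then makes room for rounding: the
  rounding error stays at most 1/2 per coordinate, while the local norm of a fixed vector at
  \<open>N x\<close> shrinks like \<open>1 / N\<close>. The price is the size of \<open>N x\<close>,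
  which calls for two opposite bounds on \<open>t\<close>: an upper bound on its values at small
  integers for \<open>N\<close>, and a lower bound on its values everywhere for \<open>x\<close>.
  The second is the delicate one, since a positive integer polynomial can have a tiny minimum at a
  non-integer point. The resultant, a determinant of size \<open>4 d - 1\<close> with entries of
  order \<open>d T\<close>, where \<open>T\<close> bounds the coefficients, limits how tiny. Both
  bounds are \<open>d T\<close> to a power of order \<open>d\<close>, whose logarithm has the order
  \<open>\<tau> d + d log d\<close>.\<close>

interpretation of_real_poly_hom: map_poly_inj_idom_hom "of_real :: real \<Rightarrow> complex" ..

lemma is_sos_add:
  assumes "is_sos p" "is_sos q"
  shows "is_sos (p + q)"
proof -
  obtain ps qs where "p = (\<Sum>q\<leftarrow>ps. q\<^sup>2)" "q = (\<Sum>q\<leftarrow>qs. q\<^sup>2)"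
    using assms unfolding is_sos_def by blast
  then have "p + q = (\<Sum>q\<leftarrow>ps @ qs. q\<^sup>2)" by simp
  then show ?thesis unfolding is_sos_def by blast
qed

lemma is_sos_power2: "is_sos (q\<^sup>2)"
  unfolding is_sos_def by (rule exI[of _ "[q]"]) simp

lemma is_sos_power2_mult:
  assumes "is_sos p"
  shows "is_sos (q\<^sup>2 * p)"
proof -
  obtain ps where "p = (\<Sum>r\<leftarrow>ps. r\<^sup>2)"
    using assms unfolding is_sos_def by blast
  then have "q\<^sup>2 * p = (\<Sum>r\<leftarrow>map ((*) q) ps. r\<^sup>2)"
    by (simp add: sum_list_const_mult[symmetric] o_def power_mult_distrib)
  then show ?thesis unfolding is_sos_def by blast
qed

lemma poly_nonneg_punctured:
  fixes r :: "real poly"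
  assumes "\<And>x. x \<noteq> a \<Longrightarrow> 0 \<le> poly r x"
  shows "0 \<le> poly r x"
proof (cases "x = a")
  case True
  have "0 \<le> poly r a"
  proof (rule ccontr)
    assume "\<not> 0 \<le> poly r a"
    moreover have "(poly r \<longlongrightarrow> poly r a) (at a)"
      using poly_isCont isCont_def by blast
    ultimately have "eventually (\<lambda>x. poly r x < 0) (at a)"
      by (intro order_tendstoD) auto
    moreover have "eventually (\<lambda>x. x \<noteq> a) (at a)"
      by (simp add: eventually_at_filter)
    ultimately have "eventually (\<lambda>x. False) (at a)"
      by eventually_elim (use assms in force)
    then show False by simp
  qed
  then show ?thesis using True by simp
qed (use assms in auto)

text \<open>The remainder modulo this quadratic is a real polynomial of degree at most 1 that
  vanishes at the nonreal \<open>z\<close>, hence it is zero.\<close>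

lemma quadratic_dvd_of_complex_root:
  fixes p :: "real poly"
  assumes z: "poly (map_poly complex_of_real p) z = 0" "Im z \<noteq> 0"
  shows "[:-Re z, 1:]\<^sup>2 + [:Im z:]\<^sup>2 dvd p"
proof -
  define w where "w = [:-Re z, 1:]\<^sup>2 + [:Im z:]\<^sup>2"
  have w: "w = [:(Re z)\<^sup>2 + (Im z)\<^sup>2, - 2 * Re z, 1:]"
    by (simp add: w_def power2_eq_square)
  have wz: "poly (map_poly complex_of_real w) z = 0"
    by (simp add: w complex_eq_iff power2_eq_square algebra_simps map_poly_pCons)
  define r where "r = p mod w"
  have "degree w = 2" by (simp add: w)
  then have "degree r < 2 \<or> r = 0"
    unfolding r_def by (metis degree_mod_less degree_0 zero_neq_numeral)
  then have "degree r \<le> 1" by auto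
  then obtain c0 c1 where r: "r = [:c0, c1:]"
    by (metis degree_0 degree_pCons_eq_if degree_eq_zeroE le_0_eq not_less_eq_eq One_nat_def pCons_cases)
  have "p = w * (p div w) + r" by (simp add: r_def)
  then have "map_poly complex_of_real p
      = map_poly complex_of_real w * map_poly complex_of_real (p div w) + map_poly complex_of_real r"
    by (metis of_real_poly_hom.hom_add of_real_poly_hom.hom_mult)
  then have "poly (map_poly complex_of_real r) z = 0"
    using z wz by simp
  moreover have "map_poly complex_of_real r = [:of_real c0, of_real c1:]"
    by (rule poly_eqI) (auto simp: r coeff_pCons split: nat.splits)
  ultimately have "c1 * Im z = 0" "c0 + c1 * Re z = 0"
    by (simp_all add: complex_eq_iff mult.commute)
  then have "r = 0" using z by (simp add: r)
  then show ?thesis unfolding r_def w_def by (simp add: mod_eq_0_iff_dvd)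
qed

text \<open>Induction on the degree. A nonreal root splits off a factor that is a sum of two
  squares, a real root splits off a square because it is at least double. Multiplying
  \<open>q\<close> by each of the two squares separately replaces an identity for products of sums
  of squares.\<close>

theorem nonneg_poly_is_sos:
  fixes p :: "real poly"
  assumes "\<And>x. 0 \<le> poly p x"
  shows "is_sos p"
  using assms
proof (induction "degree p" arbitrary: p rule: less_induct)
  case less
  show ?case
  proof (cases "degree p = 0")
    case True
    then obtain c where c: "p = [:c:]" using degree_eq_zeroE by blast
    then have "p = [:sqrt c:]\<^sup>2" using less.prems[of 0] by (simp add: power2_eq_square)
    then show ?thesis using is_sos_power2 by metis
  next
    case False
    then have "\<not> constant (poly (map_poly complex_of_real p))"
      by (simp add: constant_degree of_real_hom.degree_map_poly_hom)
    then obtain z where z: "poly (map_poly complex_of_real p) z = 0"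
      using fundamental_theorem_of_algebra by blast
    show ?thesis
    proof (cases "Im z = 0")
      case False
      define w where "w = [:-Re z, 1:]\<^sup>2 + [:Im z:]\<^sup>2"
      obtain q where q: "p = w * q"
        using quadratic_dvd_of_complex_root[OF z False] unfolding w_def by (auto elim: dvdE)
      have pos: "0 < poly w x" for x
        using False by (simp add: w_def add_nonneg_pos)
      have "0 \<le> poly q x" for x
        using less.prems[of x] pos[of x] by (simp add: q zero_le_mult_iff)
      moreover have "degree q < degree p"
      proof -
        have "degree w = 2" by (simp add: w_def power2_eq_square)
        moreover have "q \<noteq> 0" "w \<noteq> 0" using \<open>degree p \<noteq> 0\<close> q by auto
        ultimately show ?thesis by (simp add: q degree_mult_eq)
      qed
      ultimately have "is_sos q" using less.hyps by blast
      then have "is_sos ([:-Re z, 1:]\<^sup>2 * q + [:Im z:]\<^sup>2 * q)"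
        by (intro is_sos_add is_sos_power2_mult)
      then show ?thesis by (simp add: q w_def algebra_simps)
    next
      case True
      define a where "a = Re z"
      have "z = complex_of_real a" using True by (simp add: a_def complex_eq_iff)
      then have "poly p a = 0" using z by (metis of_real_eq_0_iff of_real_hom.poly_map_poly)
      then obtain q where q: "p = [:-a, 1:] * q" by (metis poly_eq_0_iff_dvd dvdE)
      \<comment> \<open>\<open>q\<close> is nonnegative to the right of \<open>a\<close> and
        nonpositive to the left, so its one-sided limits force \<open>poly q a = 0\<close> and
        \<open>a\<close> is a double root of \<open>p\<close>.\<close>
      have qpos: "0 \<le> poly q x" if "x > a" for x
        using less.prems[of x] that by (simp only: q poly_mult) (simp add: zero_le_mult_iff)
      have qneg: "poly q x \<le> 0" if "x < a" for x
        using less.prems[of x] that by (simp only: q poly_mult) (simp add: zero_le_mult_iff)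
      have lim: "(poly q \<longlongrightarrow> poly q a) (at a)"
        using poly_isCont isCont_def by blast
      have "0 \<le> poly q a"
      proof (rule tendsto_lowerbound)
        show "(poly q \<longlongrightarrow> poly q a) (at_right a)"
          by (rule filterlim_mono[OF lim order_refl at_le]) simp
        show "eventually (\<lambda>x. 0 \<le> poly q x) (at_right a)"
          using qpos by (simp add: eventually_at_filter)
      qed simp
      moreover have "poly q a \<le> 0"
      proof (rule tendsto_upperbound)
        show "(poly q \<longlongrightarrow> poly q a) (at_left a)"
          by (rule filterlim_mono[OF lim order_refl at_le]) simp
        show "eventually (\<lambda>x. poly q x \<le> 0) (at_left a)"
          using qneg by (simp add: eventually_at_filter)
      qed simp
      ultimately have "poly q a = 0" by simp
      then obtain r where r: "q = [:-a, 1:] * r" by (metis poly_eq_0_iff_dvd dvdE)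
      have p: "p = [:-a, 1:]\<^sup>2 * r" by (simp only: q r power2_eq_square mult.assoc)
      have "0 \<le> poly r x" if "x \<noteq> a" for x
        using less.prems[of x] that by (simp only: p poly_mult poly_power) (simp add: zero_le_mult_iff)
      then have "0 \<le> poly r x" for x by (rule poly_nonneg_punctured)
      moreover have "degree r < degree p"
      proof -
        have "r \<noteq> 0" using \<open>degree p \<noteq> 0\<close> p by auto
        then have "degree p = 2 + degree r"
          unfolding p by (subst degree_mult_eq) (auto simp: degree_power_eq)
        then show ?thesis by simp
      qed
      ultimately have "is_sos r" using less.hyps by blast
      then show ?thesis unfolding p by (rule is_sos_power2_mult)
    qed
  qed
qed

section \<open>Positive integer polynomials\<close>

text \<open>Submultiplicative, which the largest absolute coefficient is not; a determinant of
  polynomials can therefore be estimated term by term. The type is general because the sum is taken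
  of integer as well as of real polynomials.\<close>

definition poly_l1 :: "'a::linordered_idom poly \<Rightarrow> 'a" where
  "poly_l1 p = (\<Sum>i\<le>degree p. \<bar>coeff p i\<bar>)"

lemma poly_l1_0 [simp]: "poly_l1 0 = 0"
  by (simp add: poly_l1_def)

lemma poly_l1_pCons [simp]: "poly_l1 (pCons a p) = \<bar>a\<bar> + poly_l1 p"
proof (cases "p = 0")
  case False
  then show ?thesis
    by (simp add: poly_l1_def sum.atMost_Suc_shift del: sum.atMost_Suc)
qed (simp add: poly_l1_def)

lemma poly_l1_nonneg [simp]: "0 \<le> poly_l1 p"
  by (simp add: poly_l1_def sum_nonneg)

lemma abs_coeff_le_poly_l1: "\<bar>coeff p i\<bar> \<le> poly_l1 p"
proof (cases "i \<le> degree p")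
  case True
  then show ?thesis unfolding poly_l1_def by (intro member_le_sum) auto
qed (simp add: coeff_eq_0)

lemma poly_l1_add: "poly_l1 (p + q) \<le> poly_l1 p + poly_l1 q"
proof (induction p q rule: poly_induct2)
  case (pCons a p b q)
  have "\<bar>a + b\<bar> + poly_l1 (p + q) \<le> (\<bar>a\<bar> + \<bar>b\<bar>) + (poly_l1 p + poly_l1 q)"
    using pCons by (intro add_mono abs_triangle_ineq)
  then show ?case by (simp add: algebra_simps)
qed simp

lemma poly_l1_smult [simp]: "poly_l1 (Polynomial.smult a p) = \<bar>a\<bar> * poly_l1 p"
  by (induction p) (simp_all add: abs_mult distrib_left)

lemma poly_l1_minus [simp]: "poly_l1 (- p) = poly_l1 p"
  by (simp add: poly_l1_def)

lemma poly_l1_mult: "poly_l1 (p * q) \<le> poly_l1 p * poly_l1 q"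
proof (induction p)
  case (pCons a p)
  have "poly_l1 (pCons a p * q) \<le> poly_l1 (Polynomial.smult a q) + poly_l1 (pCons 0 (p * q))"
    unfolding mult_pCons_left by (rule poly_l1_add)
  also have "\<dots> \<le> \<bar>a\<bar> * poly_l1 q + poly_l1 p * poly_l1 q"
    using pCons by simp
  finally show ?case by (simp add: algebra_simps)
qed simp

lemma poly_l1_sum: "poly_l1 (sum f A) \<le> (\<Sum>i\<in>A. poly_l1 (f i))"
proof (induction A rule: infinite_finite_induct)
  case (insert x A)
  then show ?case using poly_l1_add[of "f x" "sum f A"] by simp
qed simp_all

lemma poly_l1_prod: "poly_l1 (prod f A) \<le> (\<Prod>i\<in>A. poly_l1 (f i))"
proof (induction A rule: infinite_finite_induct)
  case (insert x A)
  have "poly_l1 (prod f (insert x A)) \<le> poly_l1 (f x) * poly_l1 (prod f A)"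
    unfolding prod.insert[OF insert.hyps] by (rule poly_l1_mult)
  also have "\<dots> \<le> poly_l1 (f x) * (\<Prod>i\<in>A. poly_l1 (f i))"
    by (rule mult_left_mono[OF insert.IH]) simp
  finally show ?case using insert.hyps by simp
qed (simp_all add: poly_l1_def)

lemma poly_l1_det:
  fixes A :: "'a::linordered_idom poly mat"
  assumes A: "A \<in> carrier_mat N N"
    and B: "\<And>i j. i < N \<Longrightarrow> j < N \<Longrightarrow> poly_l1 (A $$ (i, j)) \<le> B"
  shows "poly_l1 (Determinant.det A) \<le> fact N * B ^ N"
proof -
  have term_le: "poly_l1 (of_int (sign p) * (\<Prod>i = 0..<N. A $$ (i, p i))) \<le> B ^ N"
    if "p permutes {0..<N}" for p
  proof -
    have "poly_l1 (of_int (sign p) * (\<Prod>i = 0..<N. A $$ (i, p i)))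
        = poly_l1 (\<Prod>i = 0..<N. A $$ (i, p i))"
      by (cases p rule: sign_cases) simp_all
    also have "\<dots> \<le> (\<Prod>i = 0..<N. poly_l1 (A $$ (i, p i)))"
      by (rule poly_l1_prod)
    also have "\<dots> \<le> (\<Prod>i = 0..<N. B)"
      using that B by (intro prod_mono) (auto dest: permutes_in_image)
    finally show ?thesis by simp
  qed
  have "poly_l1 (Determinant.det A)
      \<le> (\<Sum>p | p permutes {0..<N}. poly_l1 (of_int (sign p) * (\<Prod>i = 0..<N. A $$ (i, p i))))"
    unfolding det_def'[OF A] by (rule poly_l1_sum)
  also have "\<dots> \<le> (\<Sum>p | p permutes {0..<N}. B ^ N)"
    using term_le by (intro sum_mono) auto
  also have "\<dots> = fact N * B ^ N"
    by (simp add: card_permutations)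
  finally show ?thesis .
qed

section \<open>Small roots and critical values\<close>

lemma abs_poly_le_poly_l1:
  fixes p :: "'a::linordered_idom poly"
  assumes "\<bar>x\<bar> \<le> 1"
  shows "\<bar>poly p x\<bar> \<le> poly_l1 p"
proof (induction p)
  case (pCons a p)
  have "\<bar>x * poly p x\<bar> \<le> 1 * poly_l1 p"
    unfolding abs_mult by (rule mult_mono) (use assms pCons in auto)
  then show ?case using abs_triangle_ineq[of a "x * poly p x"] by simp
qed simp

lemma poly_l1_of_int_poly: "poly_l1 (of_int_poly p :: real poly) = of_int (poly_l1 p)"
  by (simp add: poly_l1_def)

text \<open>The lowest nonzero coefficient of \<open>R\<close> is at least 1 in absolute value.\<close>

lemma int_poly_root_lower_bound:
  fixes R :: "int poly" and m :: real
  assumes "R \<noteq> 0" "poly (of_int_poly R) m = 0" "0 < m" "m \<le> 1"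
  shows "1 \<le> m * of_int (poly_l1 R)"
  using assms(1,2)
proof (induction R)
  case (pCons a R)
  show ?case
  proof (cases "a = 0")
    case True
    then have "R \<noteq> 0" "poly (of_int_poly R) m = 0"
      using pCons.prems \<open>0 < m\<close> by (auto simp: of_int_hom.map_poly_pCons_hom)
    then show ?thesis using pCons.IH True by simp
  next
    case False
    have "real_of_int a = - m * poly (of_int_poly R) m"
      using pCons.prems by (simp add: of_int_hom.map_poly_pCons_hom)
    then have "\<bar>real_of_int a\<bar> = m * \<bar>poly (of_int_poly R) m\<bar>"
      using \<open>0 < m\<close> by (simp add: abs_mult)
    also have "\<dots> \<le> m * of_int (poly_l1 R)"
      using abs_poly_le_poly_l1[of m "of_int_poly R"] assms by (simp add: poly_l1_of_int_poly)
    also have "\<dots> \<le> m * of_int (poly_l1 (pCons a R))"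
      using \<open>0 < m\<close> by (intro mult_left_mono) auto
    finally have "\<bar>real_of_int a\<bar> \<le> m * of_int (poly_l1 (pCons a R))" .
    moreover have "1 \<le> \<bar>real_of_int a\<bar>"
      using False by linarith
    ultimately show ?thesis by linarith
  qed
qed simp

text \<open>A common factor would have a complex root at which \<open>p\<close> takes the value
  \<open>l\<close>. Since \<open>q\<close> has finitely many complex roots, it suffices that
  \<open>l\<close> avoids the real parts of finitely many values. This will show that the resultant
  does not vanish identically, whatever the multiplicities of the critical points.\<close>

lemma exists_coprime_level:
  fixes p q :: "real poly"
  assumes "q \<noteq> 0"
  obtains l where "degree (gcd q (p - [:l:])) = 0"
proof -
  define Z where "Z = {\<xi>. poly (map_poly complex_of_real q) \<xi> = 0}"
  have "finite Z" unfolding Z_def using assms by (intro poly_roots_finite) simp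
  then have "finite ((\<lambda>\<xi>. Re (poly (map_poly complex_of_real p) \<xi>)) ` Z)" by simp
  then obtain l where l: "l \<notin> (\<lambda>\<xi>. Re (poly (map_poly complex_of_real p) \<xi>)) ` Z"
    using ex_new_if_finite[OF infinite_UNIV_char_0] by blast
  have "degree (gcd q (p - [:l:])) = 0"
  proof (rule ccontr)
    define g where "g = gcd q (p - [:l:])"
    assume "degree (gcd q (p - [:l:])) \<noteq> 0"
    then have "\<not> constant (poly (map_poly complex_of_real g))"
      by (simp add: constant_degree g_def of_real_hom.degree_map_poly_hom)
    then obtain \<xi> where \<xi>: "poly (map_poly complex_of_real g) \<xi> = 0"
      using fundamental_theorem_of_algebra by blast
    have root: "poly (map_poly complex_of_real f) \<xi> = 0" if "g dvd f" for f
      using that \<xi> by (auto elim!: dvdE simp: of_real_poly_hom.hom_mult)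
    have "\<xi> \<in> Z" unfolding Z_def using root[of q] by (simp add: g_def)
    moreover have "poly (map_poly complex_of_real (p - [:l:])) \<xi> = 0"
      using root[of "p - [:l:]"] by (simp add: g_def)
    then have "poly (map_poly complex_of_real p) \<xi> = complex_of_real l"
      by (simp add: of_real_poly_hom.hom_minus of_real_hom.map_poly_pCons_hom)
    ultimately show False using l by (metis (no_types, lifting) Re_complex_of_real image_eqI)
  qed
  then show ?thesis by (rule that)
qed

text \<open>The resultant of \<open>p'\<close> and \<open>p - \<lambda>\<close> is an integer polynomial in \<open>\<lambda>\<close> that vanishes at the
  critical values of \<open>p\<close>.\<close>

lemma int_poly_critical_value_lower_bound:
  fixes p :: "int poly" and T :: int and z :: real
  defines "n \<equiv> degree p"
  assumes n: "1 \<le> n" and T: "\<And>i. \<bar>coeff p i\<bar> \<le> T"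
    and crit: "poly (pderiv (of_int_poly p)) z = 0"
    and m: "0 < poly (of_int_poly p) z" "poly (of_int_poly p) z \<le> 1"
  shows "1 \<le> poly (of_int_poly p) z * (fact (2 * n - 1) * (real n * of_int T + 1) ^ (2 * n - 1))"
proof -
  \<comment> \<open>Here \<open>p - \<lambda>\<close> and the derivative are polynomials over the
    ring of integer polynomials in the level; \<open>[:0, 1:]\<close> is the level itself.\<close>
  define P where "P = map_poly (\<lambda>a. [:a:]) p - [:[:0, 1:]:]"
  define Q where "Q = map_poly (\<lambda>a. [:a:]) (pderiv p)"
  define R where "R = resultant Q P"
  have cP: "coeff P i = (if i = 0 then [:coeff p 0, -1:] else [:coeff p i:])" for i
    by (auto simp: P_def coeff_map_poly coeff_pCons split: nat.splits)
  have cQ: "coeff Q i = [:coeff (pderiv p) i:]" for i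
    by (simp add: Q_def coeff_map_poly)
  have "p \<noteq> 0" using n by (auto simp: n_def)
  have "coeff p n \<noteq> 0" using \<open>p \<noteq> 0\<close> by (simp add: n_def)
  have degP: "degree P = n"
  proof (rule antisym)
    show "degree P \<le> n" by (rule degree_le) (use n in \<open>auto simp: cP n_def coeff_eq_0\<close>)
    show "n \<le> degree P" by (rule le_degree) (use n \<open>p \<noteq> 0\<close> in \<open>auto simp: cP n_def\<close>)
  qed
  have degp': "degree (pderiv p) = n - 1" by (simp add: degree_pderiv n_def)
  have "pderiv p \<noteq> 0" using n by (simp add: pderiv_eq_0_iff n_def)
  have degQ: "degree Q = n - 1"
    unfolding Q_def degp'[symmetric] by (rule degree_map_poly) simp
  have T0: "1 \<le> T" using T[of n] \<open>p \<noteq> 0\<close> 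
    by (metis abs_ge_zero dual_order.trans leading_coeff_0_iff int_one_le_iff_zero_less zero_less_abs_iff n_def)
  \<comment> \<open>Specializing the level commutes with the resultant because no degree drops: the
    level affects only the constant coefficient and \<open>1 \<le> n\<close>.\<close>
  have ev: "poly (of_int_poly R) l = resultant (pderiv (of_int_poly p)) (of_int_poly p - [:l:])"
    for l :: real
  proof -
    define h where "h r = poly (of_int_poly r) l" for r :: "int poly"
    interpret h: comm_ring_hom h
    proof
      show "h (x + y) = h x + h y" for x y by (simp only: h_def of_int_poly_hom.hom_add poly_add)
      show "h (x * y) = h x * h y" for x y by (simp only: h_def of_int_poly_hom.hom_mult poly_mult)
      show "h 1 = 1" by (simp only: h_def of_int_poly_hom.hom_one poly_1)
      show "h 0 = 0" by (simp only: h_def of_int_poly_hom.hom_zero poly_0)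
    qed
    have hP: "map_poly h P = of_int_poly p - [:l:]"
      by (rule poly_eqI) (auto simp: coeff_map_poly cP h_def of_int_hom.map_poly_pCons_hom coeff_pCons split: nat.splits)
    have hQ: "map_poly h Q = pderiv (of_int_poly p)"
      by (rule poly_eqI) (auto simp: coeff_map_poly cQ h_def of_int_hom.map_poly_pCons_hom coeff_pderiv)
    have "degree (of_int_poly p - [:l:]) = n"
    proof (rule antisym)
      show "degree (of_int_poly p - [:l:]) \<le> n"
        by (rule degree_diff_le) (simp_all add: n_def)
      show "n \<le> degree (of_int_poly p - [:l:])"
        by (rule le_degree) (use n \<open>coeff p n \<noteq> 0\<close> in \<open>auto simp: coeff_pCons split: nat.splits\<close>)
    qed
    moreover have "degree (pderiv (of_int_poly p :: real poly)) = n - 1"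
      by (simp add: degree_pderiv n_def)
    ultimately show ?thesis
      using h.resultant_map_poly[of Q P] unfolding hP hQ R_def degP degQ h_def by simp
  qed
  have nz: "pderiv (of_int_poly p :: real poly) \<noteq> 0"
    using n by (simp add: pderiv_eq_0_iff n_def)
  obtain l where "degree (gcd (pderiv (of_int_poly p)) (of_int_poly p - [:l::real:])) = 0"
    using exists_coprime_level[OF nz] by blast
  then have "poly (of_int_poly R) l \<noteq> 0" unfolding ev resultant_0_gcd by simp
  then have "R \<noteq> 0" by auto
  define m where "m = poly (of_int_poly p) z"
  \<comment> \<open>At the level \<open>m\<close> the derivative and \<open>p - m\<close> share the
    root \<open>z\<close>.\<close>
  have "poly (of_int_poly R) m = 0"
  proof -
    define g where "g = gcd (pderiv (of_int_poly p)) (of_int_poly p - [:m:])"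
    have "[:- z, 1:] dvd g"
      unfolding g_def using crit
      by (intro gcd_greatest poly_eq_0_iff_dvd[THEN iffD1]) (simp_all add: m_def)
    moreover have "g \<noteq> 0" using nz by (simp add: g_def)
    ultimately have "1 \<le> degree g" using dvd_imp_degree_le[of "[:- z, 1:]" g] by simp
    then show ?thesis unfolding ev resultant_0_gcd g_def by simp
  qed
  \<comment> \<open>The factor \<open>n\<close> comes from differentiation, the summand 1 from the
    level in the constant coefficient of \<open>P\<close>.\<close>
  have entry: "poly_l1 (coeff P i) \<le> int n * T + 1" "poly_l1 (coeff Q i) \<le> int n * T + 1" for i
  proof -
    have "T \<le> int n * T" using n T0 by simp
    then show "poly_l1 (coeff P i) \<le> int n * T + 1"
      using T[of i] by (auto simp: cP)
    have "poly_l1 (coeff Q i) = int (Suc i) * \<bar>coeff p (Suc i)\<bar>"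
      by (simp add: cQ coeff_pderiv abs_mult)
    also have "\<dots> \<le> int n * T"
    proof (cases "Suc i \<le> n")
      case True
      then show ?thesis using T[of "Suc i"] by (intro mult_mono) auto
    next
      case False
      then show ?thesis using T0 by (simp add: coeff_eq_0 n_def)
    qed
    finally show "poly_l1 (coeff Q i) \<le> int n * T + 1" by simp
  qed
  have "poly_l1 R \<le> fact (2 * n - 1) * (int n * T + 1) ^ (2 * n - 1)"
    unfolding R_def resultant_def
  proof (rule poly_l1_det)
    have N: "degree Q + degree P = 2 * n - 1" using n by (simp add: degP degQ)
    show "sylvester_mat Q P \<in> carrier_mat (2 * n - 1) (2 * n - 1)"
      using sylvester_carrier_mat[of Q P] by (simp add: N)
    show "poly_l1 (sylvester_mat Q P $$ (i, j)) \<le> int n * T + 1"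
      if "i < 2 * n - 1" "j < 2 * n - 1" for i j
      using that N entry T0 by (auto simp: sylvester_index_mat)
  qed
  then have "real_of_int (poly_l1 R) \<le> of_int (fact (2 * n - 1) * (int n * T + 1) ^ (2 * n - 1))"
    by (simp only: of_int_le_iff)
  also have "\<dots> = fact (2 * n - 1) * (real n * of_int T + 1) ^ (2 * n - 1)" by simp
  finally have "m * real_of_int (poly_l1 R) \<le> m * (fact (2 * n - 1) * (real n * of_int T + 1) ^ (2 * n - 1))"
    using assms(5) by (intro mult_left_mono) (auto simp: m_def)
  moreover have "1 \<le> m * real_of_int (poly_l1 R)"
    by (rule int_poly_root_lower_bound) (use \<open>R \<noteq> 0\<close> \<open>poly (of_int_poly R) m = 0\<close> assms(5,6) in \<open>auto simp: m_def\<close>)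
  ultimately show ?thesis by (simp add: m_def)
qed

text \<open>If the minimum over the interval is below 1, it is not attained at an integer point,
  where the value would be a positive integer. So the minimizer lies inside the interval and the
  minimum is a critical value.\<close>

lemma int_poly_pos_lower_bound:
  fixes p :: "int poly" and T :: int and z :: real
  defines "n \<equiv> degree p"
  assumes n: "1 \<le> n" and T: "\<And>i. \<bar>coeff p i\<bar> \<le> T"
    and pos: "\<And>z. \<bar>z\<bar> \<le> 1 \<Longrightarrow> 0 < poly (of_int_poly p) (z::real)"
    and z: "\<bar>z\<bar> \<le> 1"
  shows "1 \<le> poly (of_int_poly p) z * (fact (2 * n - 1) * (real n * of_int T + 1) ^ (2 * n - 1))"
proof -
  define H :: real where "H = fact (2 * n - 1) * (real n * of_int T + 1) ^ (2 * n - 1)"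
  have "0 \<le> T" using T[of 0] by linarith
  then have H: "1 \<le> H"
  proof -
    have "1 * 1 \<le> H"
      unfolding H_def using \<open>0 \<le> T\<close>
      by (intro mult_mono one_le_power fact_ge_1) auto
    then show ?thesis by simp
  qed
  have "\<exists>x\<in>{-1..1}. \<forall>y\<in>{-1..1}. poly (of_int_poly p) x \<le> poly (of_int_poly p) (y::real)"
    by (intro continuous_attains_inf) (auto intro!: continuous_intros)
  then obtain x :: real where x: "\<bar>x\<bar> \<le> 1"
    and xmin: "\<And>y. \<bar>y\<bar> \<le> 1 \<Longrightarrow> poly (of_int_poly p) x \<le> poly (of_int_poly p) y"
    by (auto simp: abs_le_iff Ball_def)
  have "1 \<le> poly (of_int_poly p) x * H"
  proof (cases "1 \<le> poly (of_int_poly p) x")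
    case True
    then show ?thesis using H mult_mono[OF True H] by simp
  next
    case False
    have int: "poly (of_int_poly p) (of_int k) = real_of_int (poly p k)" for k by simp
    have ne: "x \<noteq> of_int k" for k
    proof
      assume "x = of_int k"
      then have "poly (of_int_poly p) x = real_of_int (poly p k)" using int by simp
      then show False using pos[OF x] False by (simp add: int_one_le_iff_zero_less)
    qed
    have "\<bar>x\<bar> < 1" using x ne[of 1] ne[of "-1"] by (simp add: abs_le_iff abs_less_iff order_less_le) 
    have "poly (pderiv (of_int_poly p)) x = 0"
    proof (rule DERIV_local_min)
      show "(poly (of_int_poly p) has_real_derivative poly (pderiv (of_int_poly p)) x) (at x)"
        by (rule poly_DERIV)
      show "0 < 1 - \<bar>x\<bar>" using \<open>\<bar>x\<bar> < 1\<close> by simp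
      show "\<forall>y. \<bar>x - y\<bar> < 1 - \<bar>x\<bar> \<longrightarrow> poly (of_int_poly p) x \<le> poly (of_int_poly p) y"
        by (intro allI impI xmin) linarith
    qed
    then show ?thesis
      unfolding H_def n_def
      by (intro int_poly_critical_value_lower_bound) (use n T pos x False n_def in auto)
  qed
  also have "\<dots> \<le> poly (of_int_poly p) z * H"
    using xmin[OF z] H by (intro mult_right_mono) auto
  finally show ?thesis unfolding H_def .
qed

section \<open>Positive definite matrices\<close>

declare index_mult_mat(1) [simp del]

definition frob :: "nat \<Rightarrow> real mat \<Rightarrow> real mat \<Rightarrow> real" where
  "frob n X Y = (\<Sum>i<n. \<Sum>j<n. X $$ (i, j) * Y $$ (i, j))"

text \<open>Vectors are functions, so that \<open>coeff q\<close> can be the argument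
  directly.\<close>

definition quad :: "nat \<Rightarrow> real mat \<Rightarrow> (nat \<Rightarrow> real) \<Rightarrow> real" where
  "quad n A v = (\<Sum>i<n. \<Sum>j<n. v i * A $$ (i, j) * v j)"

definition tr :: "nat \<Rightarrow> real mat \<Rightarrow> real" where
  "tr n A = (\<Sum>i<n. A $$ (i, i))"

definition pos_def :: "nat \<Rightarrow> real mat \<Rightarrow> bool" where
  "pos_def n A \<longleftrightarrow> A \<in> carrier_mat n n \<and> transpose_mat A = A \<and>
     (\<forall>v. (\<exists>i<n. v i \<noteq> 0) \<longrightarrow> 0 < quad n A v)"

text \<open>A total inverse given by Cramer's rule: every entry is a quotient of determinants, hence
  continuous where the determinant does not vanish.\<close>

definition minv :: "real mat \<Rightarrow> real mat" where
  "minv A = (1 / Determinant.det A) \<cdot>\<^sub>m adj_mat A"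

lemma mult_mat_index:
  assumes "A \<in> carrier_mat n n" "B \<in> carrier_mat n n" "i < n" "j < n"
  shows "(A * B) $$ (i, j) = (\<Sum>k<n. A $$ (i, k) * B $$ (k, j))"
  using assms by (simp add: index_mult_mat(1) scalar_prod_def atLeast0LessThan)

lemma sum_inverse_apply:
  assumes C: "C \<in> carrier_mat n n" and D: "D \<in> carrier_mat n n" and CD: "C * D = 1\<^sub>m n" and i: "i < n"
  shows "(\<Sum>k<n. C $$ (i, k) * (\<Sum>j<n. D $$ (k, j) * v j)) = (v i :: real)"
proof -
  have "(\<Sum>k<n. C $$ (i, k) * (\<Sum>j<n. D $$ (k, j) * v j)) = (\<Sum>k<n. \<Sum>j<n. C $$ (i, k) * D $$ (k, j) * v j)"
    by (simp add: sum_distrib_left mult.assoc)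
  also have "\<dots> = (\<Sum>j<n. (C * D) $$ (i, j) * v j)"
    by (subst sum.swap) (use C D i in \<open>simp add: mult_mat_index[of _ n] sum_distrib_right\<close>)
  also have "\<dots> = (\<Sum>j<n. (if j = i then v j else 0))"
    unfolding CD using i by (intro sum.cong) auto
  finally show ?thesis using i by simp
qed

lemma minv_carrier: "A \<in> carrier_mat n n \<Longrightarrow> minv A \<in> carrier_mat n n"
  by (simp add: minv_def adj_mat(1))

lemma minv_inverse:
  assumes A: "A \<in> carrier_mat n n" and det: "Determinant.det A \<noteq> 0"
  shows "A * minv A = 1\<^sub>m n" "minv A * A = 1\<^sub>m n"
proof -
  have "(1 / Determinant.det A) \<cdot>\<^sub>m (Determinant.det A \<cdot>\<^sub>m 1\<^sub>m n) = 1\<^sub>m n"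
    using det by (intro eq_matI) auto
  then show "A * minv A = 1\<^sub>m n" "minv A * A = 1\<^sub>m n"
    using A adj_mat[OF A] by (simp_all add: minv_def mult_smult_distrib mult_smult_assoc_mat[of _ n n _ n])
qed

lemma det_nonzero_of_inverse:
  assumes "A \<in> carrier_mat n n" "B \<in> carrier_mat n n" "A * B = 1\<^sub>m n"
  shows "Determinant.det (A :: real mat) \<noteq> 0"
  using det_mult[OF assms(1,2)] assms(3) by auto

lemma minv_unique:
  assumes A: "A \<in> carrier_mat n n" and B: "B \<in> carrier_mat n n" and "A * B = 1\<^sub>m n"
  shows "minv A = B"
proof -
  have "Determinant.det A \<noteq> 0" using det_nonzero_of_inverse assms by blast
  then have "minv A * A = 1\<^sub>m n" by (rule minv_inverse(2)[OF A])
  then have "B = (minv A * A) * B" using B by simp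
  also have "\<dots> = minv A * (A * B)" by (rule assoc_mult_mat[OF minv_carrier[OF A] A B])
  finally show ?thesis using assms(3) minv_carrier[OF A] by simp
qed

section \<open>The Frobenius inner product and quadratic forms\<close>

lemma frob_commute: "frob n X Y = frob n Y X"
  by (simp add: frob_def mult.commute)

lemma frob_add_left:
  assumes "X \<in> carrier_mat n n" "Y \<in> carrier_mat n n"
  shows "frob n (X + Y) Z = frob n X Z + frob n Y Z"
  using assms by (simp add: frob_def distrib_right sum.distrib)

lemma frob_minus_left:
  assumes "X \<in> carrier_mat n n" "Y \<in> carrier_mat n n"
  shows "frob n (X - Y) Z = frob n X Z - frob n Y Z"
  using assms by (simp add: frob_def left_diff_distrib sum_subtractf)

lemma frob_smult_left:
  assumes "X \<in> carrier_mat n n"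
  shows "frob n (c \<cdot>\<^sub>m X) Z = c * frob n X Z"
  using assms by (simp add: frob_def sum_distrib_left mult.assoc)

lemma frob_mult_left:
  assumes "P \<in> carrier_mat n n" "X \<in> carrier_mat n n" "Y \<in> carrier_mat n n"
  shows "frob n (P * X) Y = frob n X (transpose_mat P * Y)"
proof -
  have "frob n (P * X) Y = (\<Sum>i<n. \<Sum>j<n. \<Sum>k<n. P $$ (i, k) * X $$ (k, j) * Y $$ (i, j))"
    using assms by (simp add: frob_def mult_mat_index sum_distrib_right)
  also have "\<dots> = (\<Sum>j<n. \<Sum>i<n. \<Sum>k<n. P $$ (i, k) * X $$ (k, j) * Y $$ (i, j))"
    by (rule sum.swap)
  also have "\<dots> = (\<Sum>j<n. \<Sum>k<n. \<Sum>i<n. P $$ (i, k) * X $$ (k, j) * Y $$ (i, j))"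
    by (intro sum.cong refl sum.swap)
  also have "\<dots> = (\<Sum>k<n. \<Sum>j<n. \<Sum>i<n. P $$ (i, k) * X $$ (k, j) * Y $$ (i, j))"
    by (rule sum.swap)
  also have "\<dots> = frob n X (transpose_mat P * Y)"
    using assms by (simp add: frob_def mult_mat_index[of _ n] sum_distrib_left mult_ac)
  finally show ?thesis .
qed

lemma frob_mult_right:
  assumes "X \<in> carrier_mat n n" "Q \<in> carrier_mat n n" "Y \<in> carrier_mat n n"
  shows "frob n (X * Q) Y = frob n X (Y * transpose_mat Q)"
proof -
  have "frob n (X * Q) Y = (\<Sum>i<n. \<Sum>j<n. \<Sum>k<n. X $$ (i, k) * Q $$ (k, j) * Y $$ (i, j))"
    using assms by (simp add: frob_def mult_mat_index sum_distrib_right)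
  also have "\<dots> = (\<Sum>i<n. \<Sum>k<n. \<Sum>j<n. X $$ (i, k) * Q $$ (k, j) * Y $$ (i, j))"
    by (intro sum.cong refl sum.swap)
  also have "\<dots> = frob n X (Y * transpose_mat Q)"
    using assms by (simp add: frob_def mult_mat_index[of _ n] sum_distrib_left mult_ac)
  finally show ?thesis .
qed

lemma frob_Cauchy_Schwarz: "(frob n X Y)\<^sup>2 \<le> frob n X X * frob n Y Y"
proof -
  have "frob n X Y = (\<Sum>(i, j)\<in>{..<n} \<times> {..<n}. X $$ (i, j) * Y $$ (i, j))" for X Y
    by (simp add: frob_def sum.cartesian_product)
  then show ?thesis
    using Cauchy_Schwarz_ineq_sum[of "\<lambda>p. X $$ p" "\<lambda>p. Y $$ p" "{..<n} \<times> {..<n}"]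
    by (simp add: power2_eq_square case_prod_beta)
qed

lemma frob_self_nonneg: "0 \<le> frob n X X"
  by (simp add: frob_def sum_nonneg)

lemma quad_frob: "quad n A v = frob n A (Matrix.mat n n (\<lambda>(i, j). v i * v j))"
  by (simp add: quad_def frob_def mult_ac)

lemma quad_add:
  assumes "A \<in> carrier_mat n n" "B \<in> carrier_mat n n"
  shows "quad n (A + B) v = quad n A v + quad n B v"
  using frob_add_left[OF assms] by (simp add: quad_frob)

lemma quad_smult:
  assumes "A \<in> carrier_mat n n"
  shows "quad n (c \<cdot>\<^sub>m A) v = c * quad n A v"
  using frob_smult_left[OF assms] by (simp add: quad_frob)

lemma quad_congruence:
  assumes C: "C \<in> carrier_mat n n" and X: "X \<in> carrier_mat n n"
  shows "quad n (transpose_mat C * X * C) q = quad n X (\<lambda>i. \<Sum>k<n. C $$ (i, k) * q k)"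
proof -
  define Q where "Q = Matrix.mat n n (\<lambda>(i, j). q i * q j)"
  have Q: "Q \<in> carrier_mat n n" by (simp add: Q_def)
  have CT: "transpose_mat C \<in> carrier_mat n n" using C by simp
  have "quad n (transpose_mat C * X * C) q = frob n (transpose_mat C * X) (Q * transpose_mat C)"
    unfolding quad_frob Q_def[symmetric] using C X Q by (intro frob_mult_right) auto
  also have "\<dots> = frob n X (C * (Q * transpose_mat C))"
    using frob_mult_left[OF CT X, of "Q * transpose_mat C"] Q CT by simp
  also have "\<dots> = quad n X (\<lambda>i. \<Sum>k<n. C $$ (i, k) * q k)"
    unfolding quad_def frob_def
  proof (intro sum.cong refl)
    fix i j assume ij: "i \<in> {..<n}" "j \<in> {..<n}"
    have "(C * (Q * transpose_mat C)) $$ (i, j) = (\<Sum>k<n. C $$ (i, k) * (\<Sum>l<n. q k * q l * C $$ (j, l)))"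
      using ij C Q by (simp add: mult_mat_index[of _ n]) (simp add: Q_def)
    also have "\<dots> = (\<Sum>k<n. C $$ (i, k) * q k) * (\<Sum>l<n. C $$ (j, l) * q l)"
      unfolding sum_product by (simp add: sum_distrib_left mult_ac)
    finally show "X $$ (i, j) * (C * (Q * transpose_mat C)) $$ (i, j) =
        (\<Sum>k<n. C $$ (i, k) * q k) * X $$ (i, j) * (\<Sum>k<n. C $$ (j, k) * q k)"
      by simp
  qed
  finally show ?thesis .
qed

lemma quad_one: "quad n (1\<^sub>m n) v = (\<Sum>i<n. (v i)\<^sup>2)"
  unfolding quad_def
proof (intro sum.cong refl)
  fix i assume "i \<in> {..<n}"
  then have "(\<Sum>j<n. v i * 1\<^sub>m n $$ (i, j) * v j) = (\<Sum>j<n. if j = i then v i * v j else 0)"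
    by (intro sum.cong) auto
  then show "(\<Sum>j<n. v i * 1\<^sub>m n $$ (i, j) * v j) = (v i)\<^sup>2"
    using \<open>i \<in> {..<n}\<close> by (simp add: power2_eq_square)
qed

lemma quad_gram:
  assumes "D \<in> carrier_mat n n"
  shows "quad n (transpose_mat D * D) v = (\<Sum>k<n. (\<Sum>i<n. D $$ (k, i) * v i)\<^sup>2)"
  using quad_congruence[OF assms, of "1\<^sub>m n" v] assms by (simp add: quad_one)

text \<open>Cauchy-Schwarz against the rank-one matrix of \<open>q\<close>: the Frobenius norm
  bounds the operator norm.\<close>

lemma quad_square_le:
  assumes "M \<in> carrier_mat n n"
  shows "(quad n M q)\<^sup>2 \<le> frob n M M * (\<Sum>i<n. (q i)\<^sup>2)\<^sup>2"
proof -
  define Q where "Q = Matrix.mat n n (\<lambda>(i, j). q i * q j)"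
  have "frob n Q Q = (\<Sum>i<n. \<Sum>j<n. (q i)\<^sup>2 * (q j)\<^sup>2)"
    by (simp add: frob_def Q_def power2_eq_square mult_ac)
  also have "\<dots> = (\<Sum>i<n. (q i)\<^sup>2)\<^sup>2"
    by (simp add: power2_eq_square sum_product)
  finally show ?thesis
    using frob_Cauchy_Schwarz[of n M Q] by (simp add: quad_frob Q_def)
qed

text \<open>Induction through the Schur complement of the last diagonal entry \<open>a\<close>,
  which inherits positivity. The matrix is a function of two indices, so that passing to a leading
  block is no operation at all.\<close>

lemma cholesky:
  fixes A :: "nat \<Rightarrow> nat \<Rightarrow> real"
  assumes "\<And>i j. i < n \<Longrightarrow> j < n \<Longrightarrow> A i j = A j i"
    and "\<And>v. \<exists>i<n. v i \<noteq> 0 \<Longrightarrow> 0 < (\<Sum>i<n. \<Sum>j<n. v i * A i j * v j)"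
  shows "\<exists>b. \<forall>i<n. \<forall>j<n. A i j = (\<Sum>k<n. b k i * b k j)"
  using assms
proof (induction n arbitrary: A)
  case (Suc n)
  define a where "a = A n n"
  have expand: "(\<Sum>i<Suc n. \<Sum>j<Suc n. v i * A i j * v j)
      = (\<Sum>i<n. \<Sum>j<n. v i * A i j * v j) + 2 * v n * (\<Sum>i<n. A i n * v i) + a * (v n)\<^sup>2" for v
  proof -
    have "(\<Sum>j<n. v n * A n j * v j) = v n * (\<Sum>i<n. A i n * v i)"
      using Suc.prems(1)[of n] by (simp add: sum_distrib_left mult_ac)
    moreover have "(\<Sum>i<n. v i * A i n * v n) = v n * (\<Sum>i<n. A i n * v i)"
      by (simp add: sum_distrib_left mult_ac)
    ultimately show ?thesis
      by (simp add: sum.distrib a_def power2_eq_square)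
  qed
  have a: "0 < a"
  proof -
    have "0 < (\<Sum>i<Suc n. \<Sum>j<Suc n. (if i = n then 1 else 0) * A i j * (if j = n then 1 else 0))"
      by (rule Suc.prems(2)) auto
    then show ?thesis unfolding expand by simp
  qed
  define A' where "A' i j = A i j - A i n * A j n / a" for i j
  have "\<exists>b. \<forall>i<n. \<forall>j<n. A' i j = (\<Sum>k<n. b k i * b k j)"
  proof (rule Suc.IH)
    show "A' i j = A' j i" if "i < n" "j < n" for i j
      using Suc.prems(1)[of i j] that by (simp add: A'_def)
    fix v :: "nat \<Rightarrow> real"
    assume v: "\<exists>i<n. v i \<noteq> 0"
    define L where "L = (\<Sum>i<n. A i n * v i)"
    \<comment> \<open>The last coordinate minimizes the form over all extensions of
      \<open>v\<close>; the minimum is the form of the Schur complement at \<open>v\<close>.\<close>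
    define w where "w i = (if i = n then - L / a else v i)" for i
    have "\<exists>i<Suc n. w i \<noteq> 0" using v by (auto simp: w_def intro: less_SucI)
    then have "0 < (\<Sum>i<Suc n. \<Sum>j<Suc n. w i * A i j * w j)" by (rule Suc.prems(2))
    also have "\<dots> = (\<Sum>i<n. \<Sum>j<n. v i * A i j * v j) - L\<^sup>2 / a"
    proof -
      have wQ: "(\<Sum>i<n. \<Sum>j<n. w i * A i j * w j) = (\<Sum>i<n. \<Sum>j<n. v i * A i j * v j)"
        and wL: "(\<Sum>i<n. A i n * w i) = L" and wn: "w n = - L / a"
        by (simp_all add: w_def L_def)
      have "x + 2 * (- L / a) * L + a * (- L / a)\<^sup>2 = x - L\<^sup>2 / a" for x
        using a by (simp add: field_simps power2_eq_square)
      then show ?thesis unfolding expand wQ wL wn by blast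
    qed
    also have "L\<^sup>2 / a = (\<Sum>i<n. \<Sum>j<n. v i * (A i n * A j n / a) * v j)"
      unfolding power2_eq_square L_def sum_product by (simp add: sum_divide_distrib mult_ac)
    finally show "0 < (\<Sum>i<n. \<Sum>j<n. v i * A' i j * v j)"
      by (simp add: A'_def algebra_simps sum_subtractf)
  qed
  then obtain b where b: "\<And>i j. i < n \<Longrightarrow> j < n \<Longrightarrow> A' i j = (\<Sum>k<n. b k i * b k j)" by blast
  define c where "c k i = (if k = n then A i n / sqrt a else if i = n then 0 else b k i)" for k i
  have "A i j = (\<Sum>k<Suc n. c k i * c k j)" if "i < Suc n" "j < Suc n" for i j
  proof (cases "i < n \<and> j < n")
    case True
    have "(\<Sum>k<Suc n. c k i * c k j) = (\<Sum>k<n. b k i * b k j) + A i n * A j n / a"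
      using True a by (simp add: c_def)
    then show ?thesis using b[of i j] True by (simp add: A'_def)
  next
    case False
    then have "i = n \<or> j = n" using that by auto
    then have "(\<Sum>k<Suc n. c k i * c k j) = A i n * A j n / a"
      using a by (auto simp: c_def)
    also have "\<dots> = A i j"
      using \<open>i = n \<or> j = n\<close> Suc.prems(1)[of n j] that a by (auto simp: a_def)
    finally show ?thesis by simp
  qed
  then show ?case by blast
qed simp

text \<open>A kernel vector of the factor \<open>D\<close> would annihilate the form, so
  \<open>D\<close> is invertible. The inverse \<open>C\<close> is part of the result because later
  estimates pass to coordinates in which \<open>A\<close> is the identity.\<close>

lemma pos_def_factor:
  assumes "pos_def n A"
  obtains C D where "C \<in> carrier_mat n n" "D \<in> carrier_mat n n" "C * D = 1\<^sub>m n" "D * C = 1\<^sub>m n"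
    "A = transpose_mat D * D"
proof -
  have A: "A \<in> carrier_mat n n" and sym: "transpose_mat A = A"
    using assms by (auto simp: pos_def_def)
  have "\<exists>b. \<forall>i<n. \<forall>j<n. A $$ (i, j) = (\<Sum>k<n. b k i * b k j)"
  proof (rule cholesky)
    show "A $$ (i, j) = A $$ (j, i)" if "i < n" "j < n" for i j
      using that A index_transpose_mat(1)[of i A j] by (simp add: sym)
    show "0 < (\<Sum>i<n. \<Sum>j<n. v i * A $$ (i, j) * v j)" if "\<exists>i<n. v i \<noteq> 0" for v
      using assms that by (auto simp: pos_def_def quad_def)
  qed
  then obtain b where b: "\<And>i j. i < n \<Longrightarrow> j < n \<Longrightarrow> A $$ (i, j) = (\<Sum>k<n. b k i * b k j)" by blast
  define D where "D = Matrix.mat n n (\<lambda>(k, i). b k i)"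
  have D: "D \<in> carrier_mat n n" by (simp add: D_def)
  have AD: "A = transpose_mat D * D"
  proof (rule eq_matI)
    fix i j assume "i < dim_row (transpose_mat D * D)" "j < dim_col (transpose_mat D * D)"
    then have ij: "i < n" "j < n" using D by auto
    have "(transpose_mat D * D) $$ (i, j) = (\<Sum>k<n. D $$ (k, i) * D $$ (k, j))"
      using D ij by (simp add: mult_mat_index[of _ n])
    then show "A $$ (i, j) = (transpose_mat D * D) $$ (i, j)"
      using ij b by (simp add: D_def)
  qed (use A D in auto)
  have "Determinant.det D \<noteq> 0"
  proof
    assume "Determinant.det D = 0"
    then obtain v where v: "v \<in> carrier_vec n" "v \<noteq> 0\<^sub>v n" "D *\<^sub>v v = 0\<^sub>v n"
      using det_0_iff_vec_prod_zero_field[OF D] by blast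
    define w where "w = vec_index v"
    have "\<exists>i<n. w i \<noteq> 0" using v(1,2) by (auto simp: w_def)
    then have "0 < quad n A w" using assms by (auto simp: pos_def_def)
    moreover have "(\<Sum>i<n. D $$ (k, i) * w i) = 0" if "k < n" for k
    proof -
      have "vec_index (D *\<^sub>v v) k = (\<Sum>i<n. D $$ (k, i) * w i)"
        using that D v(1) by (simp add: scalar_prod_def atLeast0LessThan w_def)
      then show ?thesis using v(3) that by simp
    qed
    ultimately show False unfolding AD quad_gram[OF D] by simp
  qed
  then have "D * minv D = 1\<^sub>m n" "minv D * D = 1\<^sub>m n" using minv_inverse[OF D] by auto
  then show ?thesis using that[OF minv_carrier[OF D] D] AD by blast
qed

lemma pos_def_gram:
  assumes C: "C \<in> carrier_mat n n" and D: "D \<in> carrier_mat n n" and CD: "C * D = 1\<^sub>m n"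
  shows "pos_def n (transpose_mat D * D)"
  unfolding pos_def_def
proof (intro conjI allI impI)
  show "transpose_mat D * D \<in> carrier_mat n n" using D by simp
  show "transpose_mat (transpose_mat D * D) = transpose_mat D * D"
    using D by (simp add: transpose_mult[of _ n n _ n])
  fix v :: "nat \<Rightarrow> real"
  assume "\<exists>i<n. v i \<noteq> 0"
  then obtain i where i: "i < n" "v i \<noteq> 0" by blast
  have "(\<Sum>k<n. (\<Sum>i<n. D $$ (k, i) * v i)\<^sup>2) \<noteq> 0"
  proof
    assume "(\<Sum>k<n. (\<Sum>i<n. D $$ (k, i) * v i)\<^sup>2) = 0"
    then have z: "(\<Sum>j<n. D $$ (k, j) * v j) = 0" if "k < n" for k
      using that by (simp add: sum_nonneg_eq_0_iff)
    have "v i = (\<Sum>k<n. C $$ (i, k) * (\<Sum>j<n. D $$ (k, j) * v j))"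
      by (rule sum_inverse_apply[OF C D CD i(1), symmetric])
    also have "\<dots> = 0" using z by simp
    finally show False using i by simp
  qed
  then show "0 < quad n (transpose_mat D * D) v"
    unfolding quad_gram[OF D] by (simp add: sum_nonneg order_less_le)
qed

lemma minv_gram:
  assumes C: "C \<in> carrier_mat n n" and D: "D \<in> carrier_mat n n"
    and CD: "C * D = 1\<^sub>m n" and DC: "D * C = 1\<^sub>m n"
  shows "minv (transpose_mat D * D) = C * transpose_mat C"
proof (rule minv_unique)
  have T: "transpose_mat D * transpose_mat C = 1\<^sub>m n"
    using transpose_mult[OF C D] CD by simp
  have "transpose_mat D * D * (C * transpose_mat C) = transpose_mat D * ((D * C) * transpose_mat C)"
    using C D by (simp add: assoc_mult_mat[of _ n n _ n _ n])
  then show "transpose_mat D * D * (C * transpose_mat C) = 1\<^sub>m n"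
    using C T by (simp add: DC)
qed (use C D in auto)

lemma pos_def_det_pos:
  assumes "pos_def n A"
  shows "0 < Determinant.det A"
proof -
  obtain C D where C: "C \<in> carrier_mat n n" and D: "D \<in> carrier_mat n n" and "D * C = 1\<^sub>m n"
    and A: "A = transpose_mat D * D"
    using pos_def_factor[OF assms] by metis
  then have "Determinant.det D \<noteq> 0" using det_nonzero_of_inverse by blast
  moreover have "Determinant.det A = (Determinant.det D)\<^sup>2"
    unfolding A using det_mult[of "transpose_mat D" n D] det_transpose[OF D] D
    by (simp add: power2_eq_square)
  ultimately show ?thesis by simp
qed

lemma pos_def_minv:
  assumes "pos_def n A"
  shows "pos_def n (minv A)"
proof -
  obtain C D where C: "C \<in> carrier_mat n n" and D: "D \<in> carrier_mat n n"
    and CD: "C * D = 1\<^sub>m n" "D * C = 1\<^sub>m n" and A: "A = transpose_mat D * D"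
    using pos_def_factor[OF assms] by metis
  have "transpose_mat D * transpose_mat C = 1\<^sub>m n"
    using transpose_mult[OF C D] CD by simp
  from pos_def_gram[OF _ _ this] C D show ?thesis
    unfolding A minv_gram[OF C D CD] by simp
qed

lemma pos_def_minv_inverse:
  assumes "pos_def n A"
  shows "A * minv A = 1\<^sub>m n" "minv A * A = 1\<^sub>m n"
  using assms pos_def_det_pos[OF assms] minv_inverse[of A n] by (auto simp: pos_def_def)

lemma pos_def_sym:
  assumes "pos_def n A" "i < n" "j < n"
  shows "A $$ (i, j) = A $$ (j, i)"
proof -
  have A: "A \<in> carrier_mat n n" "transpose_mat A = A" using assms(1) by (auto simp: pos_def_def)
  have "transpose_mat A $$ (j, i) = A $$ (i, j)"
    using A(1) assms(2,3) by (intro index_transpose_mat(1)) auto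
  then show ?thesis by (simp add: A(2))
qed

lemma quad_nonneg:
  assumes "pos_def n A"
  shows "0 \<le> quad n A v"
proof (cases "\<exists>i<n. v i \<noteq> 0")
  case True
  then show ?thesis using assms by (auto simp: pos_def_def less_imp_le)
next
  case False
  then show ?thesis by (simp add: quad_def)
qed

text \<open>Cauchy-Schwarz applied to \<open>v = C (D v)\<close>: the diagonal entry of the inverse
  is the squared norm of the i-th coordinate functional, dual to the norm given by
  \<open>quad n A\<close>.\<close>

lemma power2_le_minv_quad:
  assumes "pos_def n A" "i < n"
  shows "(v i)\<^sup>2 \<le> minv A $$ (i, i) * quad n A v"
proof -
  obtain C D where C: "C \<in> carrier_mat n n" and D: "D \<in> carrier_mat n n"
    and CD: "C * D = 1\<^sub>m n" "D * C = 1\<^sub>m n" and A: "A = transpose_mat D * D"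
    using pos_def_factor[OF assms(1)] by metis
  define q where "q k = (\<Sum>j<n. D $$ (k, j) * v j)" for k
  have "v i = (\<Sum>k<n. C $$ (i, k) * q k)"
    unfolding q_def by (rule sum_inverse_apply[OF C D CD(1) assms(2), symmetric])
  then have "(v i)\<^sup>2 \<le> (\<Sum>k<n. (C $$ (i, k))\<^sup>2) * (\<Sum>k<n. (q k)\<^sup>2)"
    by (simp add: Cauchy_Schwarz_ineq_sum)
  moreover have "minv A $$ (i, i) = (\<Sum>k<n. (C $$ (i, k))\<^sup>2)"
    unfolding A minv_gram[OF C D CD] using C assms(2)
    by (simp add: mult_mat_index[of _ n] power2_eq_square)
  moreover have "quad n A v = (\<Sum>k<n. (q k)\<^sup>2)"
    unfolding A quad_gram[OF D] q_def ..
  ultimately show ?thesis by simp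
qed

lemma pos_def_diag_nonneg:
  assumes "pos_def n A" "i < n"
  shows "0 \<le> A $$ (i, i)"
proof -
  have "quad n A (\<lambda>j. if j = i then 1 else 0) = (\<Sum>k<n. \<Sum>j<n. if k = i then (if j = i then A $$ (i, i) else 0) else 0)"
    unfolding quad_def by (intro sum.cong) auto
  also have "\<dots> = (\<Sum>k<n. if k = i then (\<Sum>j<n. if j = i then A $$ (i, i) else 0) else 0)"
    by (intro sum.cong) auto
  also have "\<dots> = A $$ (i, i)" using assms(2) by simp
  finally show ?thesis using quad_nonneg[OF assms(1)] by metis
qed

lemma abs_entry_le_diag:
  assumes "pos_def n A" "i < n" "j < n"
  shows "2 * \<bar>A $$ (i, j)\<bar> \<le> A $$ (i, i) + A $$ (j, j)"
proof -
  obtain D where D: "D \<in> carrier_mat n n" and A: "A = transpose_mat D * D"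
    using pos_def_factor[OF assms(1)] by metis
  have e: "A $$ (i, j) = (\<Sum>k<n. D $$ (k, i) * D $$ (k, j))" if "i < n" "j < n" for i j
    unfolding A using D that by (simp add: mult_mat_index[of _ n])
  have "2 * \<bar>A $$ (i, j)\<bar> \<le> (\<Sum>k<n. 2 * \<bar>D $$ (k, i) * D $$ (k, j)\<bar>)"
    unfolding e[OF assms(2,3)] sum_distrib_left[symmetric] by (intro mult_left_mono sum_abs) auto
  also have "\<dots> \<le> (\<Sum>k<n. D $$ (k, i) * D $$ (k, i) + D $$ (k, j) * D $$ (k, j))"
  proof (rule sum_mono)
    fix k
    show "2 * \<bar>D $$ (k, i) * D $$ (k, j)\<bar> \<le> D $$ (k, i) * D $$ (k, i) + D $$ (k, j) * D $$ (k, j)"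
      using sum_squares_bound[of "\<bar>D $$ (k, i)\<bar>" "\<bar>D $$ (k, j)\<bar>"]
      by (simp add: abs_mult power2_eq_square mult.assoc)
  qed
  finally show ?thesis using assms by (simp add: e sum.distrib)
qed

text \<open>The trace of the inverse is what \<open>trace_le_values\<close> will control, so all
  entries are estimated through the trace.\<close>

lemma sum_abs_entries_le:
  assumes "pos_def n A"
  shows "(\<Sum>i<n. \<Sum>j<n. \<bar>A $$ (i, j)\<bar>) \<le> n * tr n A"
proof -
  have "2 * (\<Sum>i<n. \<Sum>j<n. \<bar>A $$ (i, j)\<bar>) \<le> (\<Sum>i<n. \<Sum>j<n. A $$ (i, i) + A $$ (j, j))"
    unfolding sum_distrib_left using abs_entry_le_diag[OF assms] by (intro sum_mono) auto
  also have "\<dots> = 2 * (n * tr n A)"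
    by (simp add: sum.distrib tr_def sum_distrib_left)
  finally show ?thesis by simp
qed

section \<open>Perturbation of positive definite forms\<close>

lemma abs_quad_le:
  assumes E: "\<And>i j. i < n \<Longrightarrow> j < n \<Longrightarrow> \<bar>E $$ (i, j)\<bar> \<le> e"
  shows "\<bar>quad n E v\<bar> \<le> e * n * (\<Sum>i<n. (v i)\<^sup>2)"
proof -
  have "\<bar>quad n E v\<bar> \<le> (\<Sum>i<n. \<Sum>j<n. \<bar>v i * E $$ (i, j) * v j\<bar>)"
    unfolding quad_def by (intro order_trans[OF sum_abs] sum_mono sum_abs)
  also have "\<dots> \<le> (\<Sum>i<n. \<Sum>j<n. e * (\<bar>v i\<bar> * \<bar>v j\<bar>))"
  proof (intro sum_mono)
    fix i j assume "i \<in> {..<n}" "j \<in> {..<n}"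
    then have "\<bar>E $$ (i, j)\<bar> * (\<bar>v i\<bar> * \<bar>v j\<bar>) \<le> e * (\<bar>v i\<bar> * \<bar>v j\<bar>)"
      using E by (intro mult_right_mono) auto
    then show "\<bar>v i * E $$ (i, j) * v j\<bar> \<le> e * (\<bar>v i\<bar> * \<bar>v j\<bar>)"
      by (simp add: abs_mult mult_ac)
  qed
  also have "\<dots> = e * (\<Sum>i<n. \<bar>v i\<bar>)\<^sup>2"
    unfolding power2_eq_square sum_product by (simp add: sum_distrib_left)
  also have "\<dots> \<le> e * (n * (\<Sum>i<n. (v i)\<^sup>2))"
  proof (cases "n = 0")
    case False
    then have "0 \<le> e" using E[of 0 0] by auto
    moreover have "(\<Sum>i<n. \<bar>v i\<bar>)\<^sup>2 \<le> n * (\<Sum>i<n. (v i)\<^sup>2)"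
      using Cauchy_Schwarz_ineq_sum[of "\<lambda>_. 1" "\<lambda>i. \<bar>v i\<bar>" "{..<n}"] by simp
    ultimately show ?thesis by (rule mult_left_mono[rotated])
  qed simp
  finally show ?thesis by simp
qed

text \<open>Summing \<open>power2_le_minv_quad\<close> over the coordinates shows that the trace of
  the inverse bounds the reciprocal of the least eigenvalue of \<open>A\<close>.\<close>

lemma abs_quad_le_half:
  assumes A: "pos_def n A" and E: "\<And>i j. i < n \<Longrightarrow> j < n \<Longrightarrow> \<bar>E $$ (i, j)\<bar> \<le> e"
    and e: "0 \<le> e" "e * n * tr n (minv A) \<le> 1 / 2"
  shows "\<bar>quad n E v\<bar> \<le> quad n A v / 2"
proof -
  have "(\<Sum>i<n. (v i)\<^sup>2) \<le> tr n (minv A) * quad n A v"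
    unfolding tr_def sum_distrib_right using power2_le_minv_quad[OF A] by (intro sum_mono) auto
  then have "e * n * (\<Sum>i<n. (v i)\<^sup>2) \<le> e * n * (tr n (minv A) * quad n A v)"
    using e by (intro mult_left_mono) auto
  also have "\<dots> \<le> 1 / 2 * quad n A v"
    using mult_right_mono[OF e(2) quad_nonneg[OF A, of v]] by (simp add: mult.assoc)
  finally show ?thesis using abs_quad_le[of n E e v] E by simp
qed

lemma pos_def_perturb:
  assumes A: "pos_def n A" and E: "E \<in> carrier_mat n n" "transpose_mat E = E"
    and le: "\<And>v. \<bar>quad n E v\<bar> \<le> quad n A v / 2"
  shows "pos_def n (A + E)"
  unfolding pos_def_def
proof (intro conjI allI impI)
  have Ac: "A \<in> carrier_mat n n" using A by (simp add: pos_def_def)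
  show "A + E \<in> carrier_mat n n" using Ac E by simp
  show "transpose_mat (A + E) = A + E"
    using Ac E A by (simp add: transpose_add[of _ n n] pos_def_def)
  fix v :: "nat \<Rightarrow> real"
  assume "\<exists>i<n. v i \<noteq> 0"
  then have "0 < quad n A v" using A by (auto simp: pos_def_def)
  then show "0 < quad n (A + E) v"
    using le[of v] by (simp add: quad_add[OF Ac E(1)])
qed

text \<open>Inversion reverses the order of forms. For the i-th column \<open>p\<close> of
  \<open>minv B\<close> one has \<open>quad n B p = p i\<close>, so bounding the coordinate
  \<open>p i\<close> by means of \<open>A\<close> leaves \<open>p i\<close> on both sides, squared
  on the left.\<close>

lemma minv_diag_perturb:
  assumes A: "pos_def n A" and B: "pos_def n B" and le: "\<And>v. quad n A v \<le> 2 * quad n B v" and i: "i < n"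
  shows "minv B $$ (i, i) \<le> 2 * minv A $$ (i, i)"
proof -
  define G where "G = minv B"
  define p where "p j = G $$ (j, i)" for j
  have Bc: "B \<in> carrier_mat n n" and G: "G \<in> carrier_mat n n" and "pos_def n G"
    using B minv_carrier[of B n] pos_def_minv[OF B] by (auto simp: pos_def_def G_def)
  have "(\<Sum>k<n. B $$ (j, k) * p k) = (if j = i then 1 else 0)" if "j < n" for j
  proof -
    have "(B * G) $$ (j, i) = (\<Sum>k<n. B $$ (j, k) * p k)"
      using mult_mat_index[OF Bc G that i] by (simp add: p_def)
    then show ?thesis using pos_def_minv_inverse(1)[OF B] that i by (simp add: G_def)
  qed
  then have "quad n B p = (\<Sum>j<n. p j * (if j = i then 1 else 0))"
    by (simp add: quad_def sum_distrib_left mult.assoc flip: sum_distrib_left)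
  also have "\<dots> = p i" using i by (simp add: if_distrib cong: if_cong)
  finally have q: "quad n B p = p i" .
  have "(p i)\<^sup>2 \<le> minv A $$ (i, i) * quad n A p" by (rule power2_le_minv_quad[OF A i])
  also have "\<dots> \<le> minv A $$ (i, i) * (2 * quad n B p)"
    using pos_def_diag_nonneg[OF pos_def_minv[OF A] i] le by (intro mult_left_mono) auto
  finally have "p i * p i \<le> (2 * minv A $$ (i, i)) * p i" by (simp add: q power2_eq_square)
  moreover have "0 \<le> p i" using pos_def_diag_nonneg[OF \<open>pos_def n G\<close> i] by (simp add: p_def)
  moreover have "0 \<le> minv A $$ (i, i)" by (rule pos_def_diag_nonneg[OF pos_def_minv[OF A] i])
  ultimately have "p i \<le> 2 * minv A $$ (i, i)"
    by (cases "p i = 0") auto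
  then show ?thesis by (simp add: p_def G_def)
qed

section \<open>Derivatives of the barrier\<close>

lemma tr_mult_transpose:
  assumes "G \<in> carrier_mat n n" "E \<in> carrier_mat n n"
  shows "tr n (G * transpose_mat E) = frob n G E"
  using assms by (simp add: tr_def frob_def mult_mat_index[of _ n])

text \<open>Differentiate the Leibniz sum. A permutation other than the identity moves at least two
  indices, so after differentiating one factor another one that vanishes at 0 remains; only the
  diagonal product contributes.\<close>

lemma has_derivative_det_one_plus:
  assumes M: "M \<in> carrier_mat n n"
  shows "((\<lambda>s::real. Determinant.det (1\<^sub>m n + s \<cdot>\<^sub>m M)) has_real_derivative tr n M) (at 0)"
proof -
  define f where "f p i s = (if i = p i then 1 else 0) + s * M $$ (i, p i)"
    for p :: "nat \<Rightarrow> nat" and i and s :: real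
  define D where "D p = of_int (sign p) * (\<Sum>i = 0..<n. M $$ (i, p i) * (\<Prod>j\<in>{0..<n} - {i}. f p j 0))"
    for p
  have det: "Determinant.det (1\<^sub>m n + s \<cdot>\<^sub>m M)
      = (\<Sum>p | p permutes {0..<n}. of_int (sign p) * (\<Prod>i = 0..<n. f p i s))" for s
  proof -
    have "1\<^sub>m n + s \<cdot>\<^sub>m M \<in> carrier_mat n n" using M by simp
    then show ?thesis
      unfolding det_def'[OF \<open>1\<^sub>m n + s \<cdot>\<^sub>m M \<in> carrier_mat n n\<close>]
      using M by (intro sum.cong prod.cong refl arg_cong2[of _ _ _ _ "(*)"])
        (auto simp: f_def dest: permutes_in_image)
  qed
  have fder: "(f p i has_real_derivative M $$ (i, p i)) (at 0)" for p i
    unfolding f_def by (auto intro!: derivative_eq_intros)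
  have "((\<lambda>s. Determinant.det (1\<^sub>m n + s \<cdot>\<^sub>m M)) has_real_derivative
      (\<Sum>p | p permutes {0..<n}. D p)) (at 0)"
    unfolding det D_def
    by (intro DERIV_sum DERIV_cmult has_field_derivative_prod fder)
  moreover have "D p = (if p = id then tr n M else 0)" if p: "p permutes {0..<n}" for p
  proof (cases "p = id")
    case True
    then show ?thesis by (simp add: D_def f_def tr_def atLeast0LessThan)
  next
    case False
    then obtain k where k: "p k \<noteq> k" by (auto simp: fun_eq_iff)
    then have kn: "k \<in> {0..<n}" using p permutes_not_in by metis
    \<comment> \<open>Both \<open>k\<close> and \<open>p k\<close> are moved, and at most one of
      them equals \<open>i\<close>.\<close>
    have prod0: "(\<Prod>j\<in>{0..<n} - {i}. f p j 0) = 0" for i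
    proof -
      have "p (p k) \<noteq> p k" using k permutes_inj[OF p] by (auto dest: injD)
      moreover have "p k \<in> {0..<n}" using permutes_in_image[OF p] kn by simp
      ultimately have "\<exists>j\<in>{0..<n} - {i}. f p j 0 = 0"
        using k kn by (intro bexI[of _ "if k = i then p k else k"]) (auto simp: f_def)
      then show ?thesis by (intro prod_zero) auto
    qed
    show ?thesis unfolding D_def prod0 using False by simp
  qed
  then have "(\<Sum>p | p permutes {0..<n}. D p) = (\<Sum>p | p permutes {0..<n}. if p = id then tr n M else 0)"
    by (intro sum.cong) auto
  moreover have "\<dots> = tr n M"
    by (simp add: finite_permutations permutes_id)
  ultimately show ?thesis by simp
qed

text \<open>Jacobi's formula, reduced to the derivative at the identity by factoring out
  \<open>A\<close>. Symmetry of \<open>E\<close> turns the trace of \<open>minv A * E\<close> into a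
  Frobenius product.\<close>

lemma has_derivative_det_line:
  assumes A: "A \<in> carrier_mat n n" and E: "E \<in> carrier_mat n n" and det: "Determinant.det A \<noteq> 0"
    and sym: "transpose_mat E = E"
  shows "((\<lambda>s::real. Determinant.det (A + s \<cdot>\<^sub>m E)) has_real_derivative
    Determinant.det A * frob n (minv A) E) (at 0)"
proof -
  define G where "G = minv A"
  have G: "G \<in> carrier_mat n n" "A * G = 1\<^sub>m n"
    using minv_carrier[OF A] minv_inverse[OF A det] by (auto simp: G_def)
  have "A + s \<cdot>\<^sub>m E = A * (1\<^sub>m n + s \<cdot>\<^sub>m (G * E))" for s
  proof -
    have "A * (1\<^sub>m n + s \<cdot>\<^sub>m (G * E)) = A + s \<cdot>\<^sub>m (A * (G * E))"
      using A G E by (simp add: mult_add_distrib_mat[of _ n n _ n] mult_smult_distrib[of _ n n _ n])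
    also have "A * (G * E) = E" using assoc_mult_mat[OF A G(1) E] G(2) E by simp
    finally show ?thesis by simp
  qed
  then have eq: "Determinant.det (A + s \<cdot>\<^sub>m E) = Determinant.det A * Determinant.det (1\<^sub>m n + s \<cdot>\<^sub>m (G * E))" for s
    using det_mult[OF A, of "1\<^sub>m n + s \<cdot>\<^sub>m (G * E)"] G E by simp
  have "tr n (G * E) = frob n G E" using tr_mult_transpose[OF G(1) E] sym by simp
  then show ?thesis
    unfolding eq using has_derivative_det_one_plus[of "G * E" n] G E
    by (auto intro!: DERIV_cmult simp: G_def)
qed

lemma isCont_det:
  assumes M: "\<And>s. M s \<in> carrier_mat n n"
    and cont: "\<And>i j. i < n \<Longrightarrow> j < n \<Longrightarrow> isCont (\<lambda>s. M s $$ (i, j)) s0"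
  shows "isCont (\<lambda>s. Determinant.det (M s :: real mat)) s0"
  unfolding det_def'[OF M]
  by (intro continuous_intros cont) (auto dest: permutes_in_image)

lemma isCont_det_line:
  assumes A: "A \<in> carrier_mat n n" and E: "E \<in> carrier_mat n n"
  shows "isCont (\<lambda>s::real. Determinant.det (A + s \<cdot>\<^sub>m E)) s0"
proof (rule isCont_det)
  show "A + s \<cdot>\<^sub>m E \<in> carrier_mat n n" for s using A E by simp
  show "isCont (\<lambda>s. (A + s \<cdot>\<^sub>m E) $$ (i, j)) s0" if "i < n" "j < n" for i j
    using that A E by (auto intro!: continuous_intros)
qed

lemma isCont_minv_line:
  assumes A: "A \<in> carrier_mat n n" and E: "E \<in> carrier_mat n n" and det: "Determinant.det A \<noteq> 0"
    and ab: "a < n" "b < n"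
  shows "isCont (\<lambda>s::real. minv (A + s \<cdot>\<^sub>m E) $$ (a, b)) 0"
proof -
  have eq: "minv (A + s \<cdot>\<^sub>m E) $$ (a, b) = 1 / Determinant.det (A + s \<cdot>\<^sub>m E) *
      ((-1) ^ (b + a) * Determinant.det (mat_delete (A + s \<cdot>\<^sub>m E) b a))" for s
    using A E ab by (simp add: minv_def adj_mat_def Determinant.cofactor_def)
  have "isCont (\<lambda>s. Determinant.det (mat_delete (A + s \<cdot>\<^sub>m E) b a)) 0"
  proof (rule isCont_det)
    show "mat_delete (A + s \<cdot>\<^sub>m E) b a \<in> carrier_mat (n - 1) (n - 1)" for s
      using A E by (intro mat_delete_carrier) simp
    show "isCont (\<lambda>s. mat_delete (A + s \<cdot>\<^sub>m E) b a $$ (i, j)) 0" if "i < n - 1" "j < n - 1" for i j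
      using that A E by (auto simp: mat_delete_def intro!: continuous_intros)
  qed
  moreover have "A + 0 \<cdot>\<^sub>m E = A" using A E by (intro eq_matI) auto
  ultimately show ?thesis
    unfolding eq using isCont_det_line[OF A E] det by (intro continuous_intros) auto
qed

lemma has_derivative_minv_line:
  assumes A: "A \<in> carrier_mat n n" and E: "E \<in> carrier_mat n n" and det: "Determinant.det A \<noteq> 0"
    and ab: "a < n" "b < n"
  shows "((\<lambda>s::real. minv (A + s \<cdot>\<^sub>m E) $$ (a, b)) has_real_derivative
    - (minv A * E * minv A) $$ (a, b)) (at 0)"
proof -
  define G where "G = minv A"
  define Z where "Z s = minv (A + s \<cdot>\<^sub>m E)" for s
  have G: "G \<in> carrier_mat n n" "A * G = 1\<^sub>m n"
    using minv_carrier[OF A] minv_inverse[OF A det] by (auto simp: G_def)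
  have Z: "Z s \<in> carrier_mat n n" for s
    unfolding Z_def using A E by (intro minv_carrier) simp
  have A0: "A + 0 \<cdot>\<^sub>m E = A" using A E by (intro eq_matI) auto
  have Z0: "Z 0 = G" by (simp add: Z_def A0 G_def)
  have Zcont: "isCont (\<lambda>s. Z s $$ (i, j)) 0" if "i < n" "j < n" for i j
    unfolding Z_def by (rule isCont_minv_line[OF A E det that])
  have idx: "(Z s * E * G) $$ (a, b) = (\<Sum>l<n. (\<Sum>k<n. Z s $$ (a, k) * E $$ (k, l)) * G $$ (l, b))" for s
    using Z[of s] E G ab by (simp add: mult_mat_index[of _ n] del: assoc_mult_mat)
  have "isCont (\<lambda>s. (Z s * E * G) $$ (a, b)) 0"
    unfolding idx by (intro continuous_intros Zcont ab) auto
  then have lim: "((\<lambda>s. - (Z s * E * G) $$ (a, b)) \<longlongrightarrow> - (G * E * G) $$ (a, b)) (at 0)"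
    unfolding isCont_def Z0 by (intro tendsto_minus)
  have "((\<lambda>s. Determinant.det (A + s \<cdot>\<^sub>m E)) \<longlongrightarrow> Determinant.det A) (at 0)"
    using isCont_det_line[OF A E, of 0] unfolding isCont_def A0 .
  then have "eventually (\<lambda>s. Determinant.det (A + s \<cdot>\<^sub>m E) \<noteq> 0) (at 0)"
    using det by (rule tendsto_imp_eventually_ne)
  moreover have "eventually (\<lambda>s::real. s \<noteq> 0) (at 0)" by (simp add: eventually_at_filter)
  \<comment> \<open>The difference quotient is given exactly, by multiplying \<open>A + s E\<close>
    with \<open>Z s\<close> on the left and \<open>G\<close> on the right; continuity of
    \<open>Z\<close> then yields the limit.\<close>
  ultimately have "eventually (\<lambda>s. - (Z s * E * G) $$ (a, b) = (Z s $$ (a, b) - Z 0 $$ (a, b)) / (s - 0)) (at 0)"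
  proof eventually_elim
    case (elim s)
    define B where "B = A + s \<cdot>\<^sub>m E"
    have B: "B \<in> carrier_mat n n" using A E by (simp add: B_def)
    have ZB: "Z s * B = 1\<^sub>m n" using minv_inverse(2)[OF B] elim by (simp add: Z_def B_def)
    have "Z s = Z s * (A * G)" using G(2) right_mult_one_mat[OF Z[of s]] by simp
    also have "\<dots> = Z s * A * G" using Z[of s] A G by (simp add: assoc_mult_mat[of _ n n _ n _ n])
    finally have 1: "Z s = Z s * A * G" .
    have "Z s * B * G = Z s * A * G + s \<cdot>\<^sub>m (Z s * E * G)"
      unfolding B_def using Z[of s] A E G
      by (simp add: mult_add_distrib_mat[of _ n n _ n] add_mult_distrib_mat[of _ n n _ _ n]
          mult_smult_distrib[of _ n n _ n] mult_smult_assoc_mat[of _ n n _ n])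
    then have "G = Z s + s \<cdot>\<^sub>m (Z s * E * G)" using ZB 1 G by simp
    then have "G $$ (a, b) = (Z s + s \<cdot>\<^sub>m (Z s * E * G)) $$ (a, b)" by simp
    also have "\<dots> = Z s $$ (a, b) + s * (Z s * E * G) $$ (a, b)"
      using Z[of s] E G ab by simp
    finally show ?case using elim by (simp add: Z0 field_simps)
  qed
  then have "((\<lambda>s. (Z s $$ (a, b) - Z 0 $$ (a, b)) / (s - 0)) \<longlongrightarrow> - (G * E * G) $$ (a, b)) (at 0)"
    using lim by (rule Lim_transform_eventually[rotated])
  then show ?thesis unfolding has_field_derivative_iff Z_def G_def by simp
qed

text \<open>The coordinate directions of the space of Hankel matrices. As a function of
  \<open>k\<close>, \<open>frob (d + 1) M (unit_hankel d k)\<close> is the image of \<open>M\<close>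
  under the adjoint of \<open>hankel d\<close>.\<close>

abbreviation unit_hankel :: "nat \<Rightarrow> nat \<Rightarrow> real mat" where
  "unit_hankel d k \<equiv> hankel d (\<lambda>i. if i = k then 1 else 0)"

lemma hankel_carrier [simp, intro]: "hankel d x \<in> carrier_mat (Suc d) (Suc d)"
  by (simp add: hankel_def)

lemma hankel_index [simp]: "i < Suc d \<Longrightarrow> j < Suc d \<Longrightarrow> hankel d x $$ (i, j) = x (i + j)"
  by (simp add: hankel_def)

lemma transpose_hankel [simp]: "transpose_mat (hankel d x) = hankel d x"
  by (intro eq_matI) (auto simp: hankel_def add.commute)

lemma hankel_update: "hankel d (x(k := u)) = hankel d x + (u - x k) \<cdot>\<^sub>m unit_hankel d k"
  by (intro eq_matI) (auto simp: hankel_def)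

lemma hankel_add: "hankel d (\<lambda>i. x i + y i) = hankel d x + hankel d y"
  by (intro eq_matI) (auto simp: hankel_def)

lemma hankel_smult: "hankel d (\<lambda>i. c * x i) = c \<cdot>\<^sub>m hankel d x"
  by (intro eq_matI) (auto simp: hankel_def)

lemma partial_deriv_barrier:
  assumes "0 < Determinant.det (hankel d y)"
  shows "partial_deriv k (barrier d) y = - frob (d + 1) (minv (hankel d y)) (unit_hankel d k)"
proof -
  define D where "D = Determinant.det (hankel d y) * frob (d + 1) (minv (hankel d y)) (unit_hankel d k)"
  have 1: "((\<lambda>s::real. Determinant.det (hankel d y + s \<cdot>\<^sub>m unit_hankel d k)) has_real_derivative D) (at (y k - y k))"
    unfolding D_def using has_derivative_det_line[of "hankel d y" "Suc d" "unit_hankel d k"] assms by simp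
  have 2: "((\<lambda>u. u - y k) has_real_derivative 1) (at (y k))" by (auto intro!: derivative_eq_intros)
  have "((\<lambda>u. Determinant.det (hankel d (y(k := u)))) has_real_derivative D) (at (y k))"
    unfolding hankel_update using DERIV_chain2[OF 1 2] by simp
  then have "((\<lambda>u. barrier d (y(k := u))) has_real_derivative - (D / Determinant.det (hankel d y))) (at (y k))"
    unfolding barrier_def using assms by (auto intro!: derivative_eq_intros)
  then show ?thesis
    unfolding partial_deriv_def using assms by (simp add: DERIV_imp_deriv D_def)
qed

lemma hessian_barrier:
  assumes det: "0 < Determinant.det (hankel d y)" and ij: "i < 2 * d + 1" "j < 2 * d + 1"
  shows "hessian (2 * d + 1) (barrier d) y $$ (i, j) =
    frob (d + 1) (minv (hankel d y) * unit_hankel d i * minv (hankel d y)) (unit_hankel d j)"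
proof -
  define n A E G where "n = d + 1" and "A = hankel d y" and "E = unit_hankel d i" and "G = minv A"
  have A: "A \<in> carrier_mat n n" and E: "E \<in> carrier_mat n n" by (auto simp: A_def E_def n_def)
  have G: "G \<in> carrier_mat n n" unfolding G_def by (rule minv_carrier[OF A])
  have dA: "Determinant.det A \<noteq> 0" using det by (simp add: A_def)
  define F where "F s = - frob n (minv (A + s \<cdot>\<^sub>m E)) (unit_hankel d j)" for s
  have A0: "A + 0 \<cdot>\<^sub>m E = A" using A E by (intro eq_matI) auto
  have "(F has_real_derivative - (\<Sum>a<n. \<Sum>b<n. - (G * E * G) $$ (a, b) * unit_hankel d j $$ (a, b))) (at 0)"
    unfolding F_def frob_def G_def
    by (intro DERIV_minus DERIV_sum DERIV_cmult_right has_derivative_minv_line[OF A E dA]) auto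
  then have 1: "(F has_real_derivative frob n (G * E * G) (unit_hankel d j)) (at (y i - y i))"
    by (simp add: frob_def sum_negf)
  have 2: "((\<lambda>u. u - y i) has_real_derivative 1) (at (y i))" by (auto intro!: derivative_eq_intros)
  have 3: "((\<lambda>u. F (u - y i)) has_real_derivative frob n (G * E * G) (unit_hankel d j)) (at (y i))"
    using DERIV_chain2[OF 1 2] by simp
  have "isCont (\<lambda>u. Determinant.det (A + (u - y i) \<cdot>\<^sub>m E)) (y i)"
    by (rule isCont_o2[where f = "\<lambda>u. u - y i" and g = "\<lambda>s. Determinant.det (A + s \<cdot>\<^sub>m E)"])
       (intro continuous_intros isCont_det_line[OF A E])+
  then have "((\<lambda>u. Determinant.det (A + (u - y i) \<cdot>\<^sub>m E)) \<longlongrightarrow>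
      Determinant.det (A + (y i - y i) \<cdot>\<^sub>m E)) (nhds (y i))"
    unfolding isCont_def by (rule tendsto_at_iff_tendsto_nhds[THEN iffD1])
  then have "eventually (\<lambda>u. 0 < Determinant.det (A + (u - y i) \<cdot>\<^sub>m E)) (nhds (y i))"
    using det by (intro order_tendstoD(1)) (simp_all add: A0, simp add: A_def)
  \<comment> \<open>The gradient formula holds where the determinant is positive, so the inner
    derivative is replaced by \<open>F\<close> on a whole neighbourhood before differentiating
    again.\<close>
  then have "eventually (\<lambda>u. partial_deriv j (barrier d) (y(i := u)) = F (u - y i)) (nhds (y i))"
  proof eventually_elim
    case (elim u)
    then have "0 < Determinant.det (hankel d (y(i := u)))"
      by (simp add: hankel_update A_def E_def)
    from partial_deriv_barrier[OF this, of j] show ?case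
      by (simp add: F_def n_def hankel_update A_def E_def)
  qed
  then have "((\<lambda>u. partial_deriv j (barrier d) (y(i := u))) has_real_derivative
      frob n (G * E * G) (unit_hankel d j)) (at (y i))"
    using 3 by (subst DERIV_cong_ev[OF refl _ refl])
  then have "partial_deriv i (partial_deriv j (barrier d)) y = frob n (G * E * G) (unit_hankel d j)"
    unfolding partial_deriv_def[of i] by (rule DERIV_imp_deriv)
  then show ?thesis
    using ij by (simp add: hessian_def G_def E_def A_def n_def)
qed

section \<open>Perturbed normal equations\<close>

lemma frob_congruence:
  assumes C: "C \<in> carrier_mat n n" and X: "X \<in> carrier_mat n n" and U: "U \<in> carrier_mat n n"
  shows "frob n (C * transpose_mat C * X * (C * transpose_mat C)) U
    = frob n (transpose_mat C * X * C) (transpose_mat C * U * C)"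
proof -
  define T where "T = transpose_mat C"
  have T: "T \<in> carrier_mat n n" using C by (simp add: T_def)
  define W where "W = T * X * C"
  have W: "W \<in> carrier_mat n n" using C T X by (simp add: W_def)
  have "C * T * X * (C * T) = C * (W * T)"
    using C T X by (simp add: W_def assoc_mult_mat[of _ n n _ n _ n])
  then have "frob n (C * T * X * (C * T)) U = frob n (W * T) (T * U)"
    using frob_mult_left[OF C, of "W * T" U] W T U by (simp add: T_def)
  also have "\<dots> = frob n W (T * U * C)"
    using frob_mult_right[OF W T, of "T * U"] T U by (simp add: T_def)
  finally show ?thesis by (simp only: T_def W_def)
qed

text \<open>In the coordinates in which \<open>B\<close> becomes the identity, \<open>frob n (minv B * X * minv B) U\<close> is the
  Frobenius inner product of \<open>X\<close> and \<open>U\<close>.\<close>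

lemma abs_quad_le_of_normal_equation:
  assumes B: "pos_def n B" and X: "X \<in> carrier_mat n n" and U: "U \<in> carrier_mat n n"
    and eq: "frob n (minv B * U * minv B) U = frob n (minv B * X * minv B) U"
    and le: "\<And>i j. i < n \<Longrightarrow> j < n \<Longrightarrow> \<bar>X $$ (i, j)\<bar> \<le> \<xi>" and "0 \<le> \<xi>"
    and S: "(\<Sum>i<n. \<Sum>j<n. \<bar>minv B $$ (i, j)\<bar>) \<le> S"
  shows "\<bar>quad n U p\<bar> \<le> \<xi> * S * quad n B p"
proof -
  obtain C D where C: "C \<in> carrier_mat n n" and D: "D \<in> carrier_mat n n"
    and CD: "C * D = 1\<^sub>m n" "D * C = 1\<^sub>m n" and BD: "B = transpose_mat D * D"
    using pos_def_factor[OF B] by metis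
  define G where "G = minv B"
  have GC: "G = C * transpose_mat C" unfolding G_def BD by (rule minv_gram[OF C D CD])
  have G: "G \<in> carrier_mat n n" using C by (simp add: GC)
  define \<Phi> where "\<Phi> M = transpose_mat C * M * C" for M
  have \<Phi>: "\<Phi> M \<in> carrier_mat n n" if "M \<in> carrier_mat n n" for M
    using C that by (simp add: \<Phi>_def)
  have fG: "frob n (G * M * G) N = frob n (\<Phi> M) (\<Phi> N)"
    if "M \<in> carrier_mat n n" "N \<in> carrier_mat n n" for M N
    unfolding GC \<Phi>_def by (rule frob_congruence[OF C that])
  have S0: "0 \<le> S" by (rule order_trans[OF _ S]) (simp add: sum_nonneg)
  define a where "a = frob n (\<Phi> U) (\<Phi> U)"
  define b where "b = frob n (\<Phi> X) (\<Phi> X)"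
  \<comment> \<open>By \<open>eq\<close>, \<open>\<Phi> X - \<Phi> U\<close> is orthogonal to
    \<open>\<Phi> U\<close>; like a projection, \<open>\<Phi> U\<close> is no longer than
    \<open>\<Phi> X\<close>.\<close>
  have "a = frob n (\<Phi> X) (\<Phi> U)"
    unfolding a_def using eq fG[OF U U] fG[OF X U] by (simp add: G_def)
  then have "a\<^sup>2 \<le> b * a" using frob_Cauchy_Schwarz[of n "\<Phi> X" "\<Phi> U"] by (simp add: a_def b_def)
  moreover have "0 \<le> a" "0 \<le> b" by (simp_all add: a_def b_def frob_self_nonneg)
  ultimately have ab: "a \<le> b"
    by (cases "a = 0") (auto simp: power2_eq_square)
  have entry: "\<bar>(G * X * G) $$ (i, j)\<bar> \<le> \<xi> * ((\<Sum>k<n. \<bar>G $$ (i, k)\<bar>) * (\<Sum>l<n. \<bar>G $$ (l, j)\<bar>))"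
    if ij: "i < n" "j < n" for i j
  proof -
    have "(G * X * G) $$ (i, j) = (\<Sum>l<n. \<Sum>k<n. G $$ (i, k) * X $$ (k, l) * G $$ (l, j))"
      using G X ij by (simp add: mult_mat_index[of _ n] sum_distrib_right del: assoc_mult_mat)
    also have "\<bar>\<dots>\<bar> \<le> (\<Sum>l<n. \<Sum>k<n. \<bar>G $$ (i, k) * X $$ (k, l) * G $$ (l, j)\<bar>)"
      by (intro order_trans[OF sum_abs] sum_mono sum_abs)
    also have "\<dots> \<le> (\<Sum>l<n. \<Sum>k<n. \<xi> * (\<bar>G $$ (i, k)\<bar> * \<bar>G $$ (l, j)\<bar>))"
    proof (intro sum_mono)
      fix l k assume "l \<in> {..<n}" "k \<in> {..<n}"
      then have "\<bar>X $$ (k, l)\<bar> * (\<bar>G $$ (i, k)\<bar> * \<bar>G $$ (l, j)\<bar>) \<le> \<xi> * (\<bar>G $$ (i, k)\<bar> * \<bar>G $$ (l, j)\<bar>)"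
        using le by (intro mult_right_mono) auto
      then show "\<bar>G $$ (i, k) * X $$ (k, l) * G $$ (l, j)\<bar> \<le> \<xi> * (\<bar>G $$ (i, k)\<bar> * \<bar>G $$ (l, j)\<bar>)"
        by (simp add: abs_mult mult_ac)
    qed
    also have "\<dots> = (\<Sum>k<n. \<Sum>l<n. \<xi> * (\<bar>G $$ (i, k)\<bar> * \<bar>G $$ (l, j)\<bar>))"
      by (rule sum.swap)
    also have "\<dots> = \<xi> * ((\<Sum>k<n. \<bar>G $$ (i, k)\<bar>) * (\<Sum>l<n. \<bar>G $$ (l, j)\<bar>))"
      unfolding sum_product by (simp add: sum_distrib_left)
    finally show ?thesis .
  qed
  \<comment> \<open>The norm of \<open>\<Phi> X\<close> is evaluated in the original coordinates,
    where only entries of \<open>G\<close> and \<open>X\<close> occur.\<close>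
  have "b = frob n (G * X * G) X" unfolding b_def by (rule fG[OF X X, symmetric])
  also have "\<dots> \<le> (\<Sum>i<n. \<Sum>j<n. \<xi> * ((\<Sum>k<n. \<bar>G $$ (i, k)\<bar>) * (\<Sum>l<n. \<bar>G $$ (l, j)\<bar>)) * \<xi>)"
    unfolding frob_def
  proof (intro sum_mono)
    fix i j assume "i \<in> {..<n}" "j \<in> {..<n}"
    then have "\<bar>(G * X * G) $$ (i, j)\<bar> * \<bar>X $$ (i, j)\<bar>
        \<le> \<xi> * ((\<Sum>k<n. \<bar>G $$ (i, k)\<bar>) * (\<Sum>l<n. \<bar>G $$ (l, j)\<bar>)) * \<xi>"
      using entry[of i j] le[of i j] \<open>0 \<le> \<xi>\<close> by (intro mult_mono) (auto intro!: mult_nonneg_nonneg sum_nonneg)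
    then show "(G * X * G) $$ (i, j) * X $$ (i, j)
        \<le> \<xi> * ((\<Sum>k<n. \<bar>G $$ (i, k)\<bar>) * (\<Sum>l<n. \<bar>G $$ (l, j)\<bar>)) * \<xi>"
      by (metis abs_le_D1 abs_mult)
  qed
  also have "\<dots> = \<xi>\<^sup>2 * ((\<Sum>i<n. \<Sum>k<n. \<bar>G $$ (i, k)\<bar>) * (\<Sum>j<n. \<Sum>l<n. \<bar>G $$ (l, j)\<bar>))"
    unfolding sum_product[of _ "{..<n}" _ "{..<n}"]
    by (simp add: sum_product sum_distrib_left power2_eq_square mult_ac)
  also have "(\<Sum>j<n. \<Sum>l<n. \<bar>G $$ (l, j)\<bar>) = (\<Sum>i<n. \<Sum>k<n. \<bar>G $$ (i, k)\<bar>)"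
    by (rule sum.swap)
  also have "\<xi>\<^sup>2 * ((\<Sum>i<n. \<Sum>k<n. \<bar>G $$ (i, k)\<bar>) * (\<Sum>i<n. \<Sum>k<n. \<bar>G $$ (i, k)\<bar>)) \<le> \<xi>\<^sup>2 * (S * S)"
    using S S0 by (intro mult_left_mono mult_mono) (auto simp: G_def intro!: sum_nonneg)
  finally have b: "b \<le> (\<xi> * S)\<^sup>2" by (simp add: power2_eq_square mult_ac)
  define q where "q k = (\<Sum>i<n. D $$ (k, i) * p i)" for k
  have pq: "(\<Sum>k<n. C $$ (i, k) * q k) = p i" if "i < n" for i
    unfolding q_def by (rule sum_inverse_apply[OF C D CD(1) that])
  have "quad n U p = quad n (\<Phi> U) q"
    unfolding \<Phi>_def quad_congruence[OF C U] by (simp add: quad_def pq)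
  then have "(quad n U p)\<^sup>2 \<le> a * (\<Sum>i<n. (q i)\<^sup>2)\<^sup>2"
    using quad_square_le[OF \<Phi>[OF U], of q] by (simp add: a_def)
  also have "(\<Sum>i<n. (q i)\<^sup>2) = quad n B p"
    unfolding BD quad_gram[OF D] q_def ..
  also have "a * (quad n B p)\<^sup>2 \<le> (\<xi> * S)\<^sup>2 * (quad n B p)\<^sup>2"
    using ab b by (intro mult_right_mono) auto
  finally have "(quad n U p)\<^sup>2 \<le> (\<xi> * S * quad n B p)\<^sup>2" by (simp add: power_mult_distrib)
  then show ?thesis
    using \<open>0 \<le> \<xi>\<close> S0 quad_nonneg[OF B, of p] by (simp add: abs_le_square_iff[symmetric])
qed

text \<open>With \<open>B = A + E\<close>, the matrix \<open>A + E + E + E * G * E\<close> is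
  exactly \<open>B * G * B\<close>, and sandwiching it between two copies of \<open>H\<close>
  returns \<open>G\<close>. This compares the old gradient matrix \<open>G\<close> with
  \<open>H * A * H\<close> without a Taylor remainder, in the shape that the normal equation
  expects.\<close>

lemma sandwich_difference:
  fixes A E :: "real mat"
  assumes A: "pos_def n A" and E: "E \<in> carrier_mat n n" and B: "pos_def n (A + E)"
  defines "G \<equiv> minv A" and "H \<equiv> minv (A + E)"
  shows "H * (E + E + E * G * E) * H = G - H * A * H"
proof -
  define B where "B = A + E"
  have Ac: "A \<in> carrier_mat n n" using A by (simp add: pos_def_def)
  have Bc: "B \<in> carrier_mat n n" using Ac E by (simp add: B_def)
  have G: "G \<in> carrier_mat n n" "A * G = 1\<^sub>m n" "G * A = 1\<^sub>m n"
    using minv_carrier[OF Ac] pos_def_minv_inverse[OF A] by (auto simp: G_def)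
  have H: "H \<in> carrier_mat n n" "B * H = 1\<^sub>m n" "H * B = 1\<^sub>m n"
    using minv_carrier[OF Bc] pos_def_minv_inverse[OF B] by (auto simp: H_def B_def)
  have "B * G * B = A + E + E + E * G * E"
  proof -
    have "B * G = 1\<^sub>m n + E * G" using Ac E G by (simp add: B_def add_mult_distrib_mat[of _ n n _ _ n])
    then have "B * G * B = B + E * G * B"
      using Bc E G by (simp add: add_mult_distrib_mat[of _ n n _ _ n] del: assoc_mult_mat)
    also have "E * G * B = E * G * A + E * G * E"
      using Ac E G by (simp add: B_def mult_add_distrib_mat[of _ n n _ n] del: assoc_mult_mat)
    also have "E * G * A = E" using assoc_mult_mat[OF E G(1) Ac] G E by simp
    finally show ?thesis using Ac E G
      by (simp add: B_def assoc_add_mat[of _ n n])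
  qed
  then have X: "E + E + E * G * E = B * G * B - A"
    using Ac E G by (intro eq_matI) auto
  have "H * (B * G * B - A) * H = H * (B * G * B) * H - H * A * H"
  proof -
    have M: "B * G * B \<in> carrier_mat n n" using Bc G by simp
    show ?thesis
      using mult_minus_distrib_mat[OF H(1) M Ac] minus_mult_distrib_mat[of "H * (B * G * B)" n n "H * A" H n]
        H M Ac by (simp del: assoc_mult_mat)
  qed
  also have "H * (B * G * B) * H = G"
  proof -
    have "H * (B * G) = G" using assoc_mult_mat[OF H(1) Bc G(1)] H(3) G(1) by simp
    then show ?thesis using Bc G H by (simp add: assoc_mult_mat[of _ n n _ n _ n])
  qed
  finally show ?thesis unfolding X .
qed

section \<open>The dual cone\<close>

lemma openin_Euclidean_box:
  "openin (Euclidean_space n) {z \<in> topspace (Euclidean_space n). \<forall>i<n. \<bar>z i - y i\<bar> < r}"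
proof -
  have "open (\<Inter>i\<in>{..<n}. {z :: nat \<Rightarrow> real. \<bar>z i - y i\<bar> < r})"
  proof (intro open_INT ballI)
    show "open {z :: nat \<Rightarrow> real. \<bar>z i - y i\<bar> < r}" for i
      by (intro open_Collect_less continuous_intros continuous_on_product_coordinates)
  qed simp
  moreover have "{z \<in> topspace (Euclidean_space n). \<forall>i<n. \<bar>z i - y i\<bar> < r}
      = (\<Inter>i\<in>{..<n}. {z. \<bar>z i - y i\<bar> < r}) \<inter> {x. \<forall>i\<ge>n. x i = 0}"
    by (auto simp: topspace_Euclidean_space)
  ultimately show ?thesis
    unfolding Euclidean_space_def openin_subtopology
    by (auto simp: euclidean_product_topology open_openin[symmetric])
qed

lemma interior_inI:
  assumes "y \<in> topspace (Euclidean_space n)" "0 < r"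
    and "\<And>z. z \<in> topspace (Euclidean_space n) \<Longrightarrow> (\<And>i. i < n \<Longrightarrow> \<bar>z i - y i\<bar> < r) \<Longrightarrow> z \<in> S"
  shows "y \<in> interior_in n S"
  unfolding interior_of_def mem_Collect_eq
  by (rule exI[of _ "{z \<in> topspace (Euclidean_space n). \<forall>i<n. \<bar>z i - y i\<bar> < r}"])
     (use assms openin_Euclidean_box in auto)

lemma interior_in_update:
  assumes t: "t \<in> interior_in n S" and k: "k < n"
  obtains \<delta> where "0 < \<delta>" "t(k := t k - \<delta>) \<in> S"
proof -
  obtain T where T: "openin (Euclidean_space n) T" "t \<in> T" "T \<subseteq> S"
    using t by (auto simp: interior_of_def)
  then obtain U where U: "open U" "T = U \<inter> {x. \<forall>i\<ge>n. x i = 0}"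
    unfolding Euclidean_space_def openin_subtopology
    by (auto simp: euclidean_product_topology open_openin[symmetric])
  define \<phi> where "\<phi> s = t(k := t k - s)" for s
  have "continuous_on UNIV \<phi>"
  proof (rule continuous_on_coordinatewise_then_product)
    show "continuous_on UNIV (\<lambda>s. \<phi> s i)" for i
      by (cases "i = k") (auto simp: \<phi>_def intro!: continuous_intros)
  qed
  then have "open (\<phi> -` U)" using U(1) by (simp add: open_vimage)
  moreover have "0 \<in> \<phi> -` U" using T U by (simp add: \<phi>_def)
  ultimately obtain e where e: "0 < e" "ball 0 e \<subseteq> \<phi> -` U" using open_contains_ball by (metis (no_types))
  moreover have "e / 2 \<in> ball 0 e" using e by (simp add: dist_norm)
  ultimately have "\<phi> (e / 2) \<in> U" by blast
  moreover have "\<phi> (e / 2) \<in> {x. \<forall>i\<ge>n. x i = 0}" using T U k by (auto simp: \<phi>_def)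
  ultimately have "t(k := t k - e / 2) \<in> S" using T U by (auto simp: \<phi>_def)
  then show ?thesis using that[of "e / 2"] e by simp
qed

section \<open>Pairing squares with Hankel forms\<close>

lemma coeff_mult_double_sum:
  assumes "degree p \<le> a" "degree r \<le> b"
  shows "coeff (p * r) k = (\<Sum>i\<le>a. \<Sum>j\<le>b. if i + j = k then coeff p i * coeff r j else 0)"
proof -
  have "p * r = (\<Sum>i\<le>a. monom (coeff p i) i) * (\<Sum>j\<le>b. monom (coeff r j) j)"
    using assms by (simp add: poly_as_sum_of_monoms')
  also have "\<dots> = (\<Sum>i\<le>a. \<Sum>j\<le>b. monom (coeff p i * coeff r j) (i + j))"
    by (simp add: sum_product mult_monom)
  finally show ?thesis by (simp add: coeff_sum)
qed

lemma inner_prod_square: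
  assumes q: "degree q \<le> d"
  shows "inner_prod (2 * d + 1) (coeff (q\<^sup>2)) z = quad (Suc d) (hankel d z) (coeff q)"
proof -
  have "inner_prod (2 * d + 1) (coeff (q\<^sup>2)) z
      = (\<Sum>k<2 * d + 1. \<Sum>i\<le>d. \<Sum>j\<le>d. (if i + j = k then coeff q i * coeff q j * z k else 0))"
    by (simp add: inner_prod_def power2_eq_square coeff_mult_double_sum[OF q q] sum_distrib_right mult_delta_left
        del: sum.lessThan_Suc)
  also have "\<dots> = (\<Sum>i\<le>d. \<Sum>k<2 * d + 1. \<Sum>j\<le>d. (if i + j = k then coeff q i * coeff q j * z k else 0))"
    by (rule sum.swap)
  also have "\<dots> = (\<Sum>i\<le>d. \<Sum>j\<le>d. \<Sum>k<2 * d + 1. (if i + j = k then coeff q i * coeff q j * z k else 0))"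
    by (intro sum.cong refl sum.swap)
  also have "\<dots> = (\<Sum>i\<le>d. \<Sum>j\<le>d. coeff q i * coeff q j * z (i + j))"
    by (intro sum.cong refl) (simp add: sum.delta' del: sum.lessThan_Suc)
  also have "\<dots> = quad (Suc d) (hankel d z) (coeff q)"
    unfolding quad_def lessThan_Suc_atMost by (intro sum.cong refl) (simp add: mult_ac)
  finally show ?thesis .
qed

lemma coeff_sum_list_map: "coeff (\<Sum>x\<leftarrow>xs. f x) k = (\<Sum>x\<leftarrow>xs. coeff (f x) k)"
  by (induction xs) auto

lemma coeff_power2_top:
  fixes q :: "real poly"
  assumes "degree q \<le> m"
  shows "coeff (q\<^sup>2) (2 * m) = (coeff q m)\<^sup>2"
proof (cases "degree q = m")
  case True
  then show ?thesis using coeff_mult_degree_sum[of q q] by (simp add: power2_eq_square mult_2)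
next
  case False
  then have "degree q < m" using assms by simp
  moreover have "degree (q\<^sup>2) \<le> 2 * degree q" using degree_power_le[of q 2] by simp
  ultimately show ?thesis by (simp add: coeff_eq_0)
qed

lemma sum_list_power2_pos:
  fixes f :: "'a \<Rightarrow> real"
  assumes "x \<in> set xs" "f x \<noteq> 0"
  shows "0 < (\<Sum>x\<leftarrow>xs. (f x)\<^sup>2)"
  using assms
proof (induction xs)
  case (Cons y ys)
  have "0 \<le> (\<Sum>x\<leftarrow>ys. (f x)\<^sup>2)" by (intro sum_list_nonneg) auto
  then show ?case using Cons by (cases "x = y") (auto intro: add_pos_nonneg add_nonneg_pos)
qed simp

text \<open>The coefficients at the highest degree among the summands enter as squares and cannot
  cancel. The definition of \<open>is_sos\<close> leaves these degrees open, whereas the Hankel form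
  sees only \<open>d + 1\<close> coefficients.\<close>

lemma sos_degree_le:
  fixes qs :: "real poly list"
  assumes deg: "degree (\<Sum>q\<leftarrow>qs. q\<^sup>2) \<le> 2 * d" and q: "q \<in> set qs"
  shows "degree q \<le> d"
proof (rule ccontr)
  assume "\<not> degree q \<le> d"
  define m where "m = Max (degree ` set qs)"
  have le: "degree r \<le> m" if "r \<in> set qs" for r
    unfolding m_def using that by (intro Max_ge) auto
  have "m \<in> degree ` set qs" unfolding m_def using q by (intro Max_in) auto
  then obtain r where r: "r \<in> set qs" "degree r = m" by auto
  have "d < m" using le[OF q] \<open>\<not> degree q \<le> d\<close> by simp
  then have "coeff r m \<noteq> 0" using r by (metis leading_coeff_0_iff degree_0 not_less0)
  then have "0 < (\<Sum>q\<leftarrow>qs. (coeff q m)\<^sup>2)" using r by (intro sum_list_power2_pos) auto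
  also have "\<dots> = coeff (\<Sum>q\<leftarrow>qs. q\<^sup>2) (2 * m)"
    unfolding coeff_sum_list_map
    by (intro arg_cong[of _ _ sum_list] map_cong refl coeff_power2_top[symmetric] le)
  also have "\<dots> = 0" using deg \<open>d < m\<close> by (intro coeff_eq_0) simp
  finally show False by simp
qed

lemma inner_prod_sos:
  assumes "degree (\<Sum>q\<leftarrow>qs. q\<^sup>2) \<le> 2 * d"
  shows "inner_prod (2 * d + 1) (coeff (\<Sum>q\<leftarrow>qs. q\<^sup>2)) z = (\<Sum>q\<leftarrow>qs. quad (Suc d) (hankel d z) (coeff q))"
proof -
  have "inner_prod n (coeff (\<Sum>q\<leftarrow>qs. f q)) z = (\<Sum>q\<leftarrow>qs. inner_prod n (coeff (f q)) z)" for n and f :: "real poly \<Rightarrow> real poly"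
    by (induction qs) (simp_all add: inner_prod_def distrib_right sum.distrib)
  then have "inner_prod (2 * d + 1) (coeff (\<Sum>q\<leftarrow>qs. q\<^sup>2)) z
      = (\<Sum>q\<leftarrow>qs. inner_prod (2 * d + 1) (coeff (q\<^sup>2)) z)" .
  also have "map (\<lambda>q. inner_prod (2 * d + 1) (coeff (q\<^sup>2)) z) qs
      = map (\<lambda>q. quad (Suc d) (hankel d z) (coeff q)) qs"
    by (intro map_cong refl inner_prod_square sos_degree_le[OF assms])
  finally show ?thesis .
qed

lemma sos_dual_iff:
  "z \<in> sos_dual d \<longleftrightarrow>
    z \<in> topspace (Euclidean_space (2 * d + 1)) \<and> (\<forall>v. 0 \<le> quad (Suc d) (hankel d z) v)"
  (is "_ \<longleftrightarrow> ?T \<and> ?Q")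
proof
  assume z: "z \<in> sos_dual d"
  have "0 \<le> quad (Suc d) (hankel d z) v" for v
  proof -
    define q where "q = (\<Sum>i\<le>d. monom (v i) i)"
    have q: "degree q \<le> d" unfolding q_def by (intro degree_sum_le) (auto intro: order_trans[OF degree_monom_le])
    have cq: "coeff q i = v i" if "i < Suc d" for i
      using that by (auto simp: q_def coeff_sum)
    have "degree (q\<^sup>2) \<le> 2 * d" using degree_power_le[of q 2] q by simp
    moreover have "is_sos (q\<^sup>2)" unfolding is_sos_def by (rule exI[of _ "[q]"]) simp
    ultimately have "coeff (q\<^sup>2) \<in> sos_cone d" unfolding sos_cone_def by blast
    then have "0 \<le> inner_prod (2 * d + 1) (coeff (q\<^sup>2)) z"
      using z by (simp add: dual_cone_def)
    then show ?thesis by (simp add: inner_prod_square[OF q, simplified] quad_def cq)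
  qed
  then show "?T \<and> ?Q" using z by (simp add: dual_cone_def)
next
  assume z: "?T \<and> ?Q"
  have "0 \<le> inner_prod (2 * d + 1) x z" if x: "x \<in> sos_cone d" for x
  proof -
    obtain qs where "x = coeff (\<Sum>q\<leftarrow>qs. q\<^sup>2)" "degree (\<Sum>q\<leftarrow>qs. q\<^sup>2) \<le> 2 * d"
      using x by (auto simp: sos_cone_def is_sos_def)
    then show ?thesis using z by (auto simp: inner_prod_sos[simplified] intro!: sum_list_nonneg)
  qed
  then show "z \<in> sos_dual d" using z by (simp add: dual_cone_def)
qed

text \<open>The top or the constant coefficient can be lowered a little without leaving the cone.
  What remains has a nonnegative top coefficient, respectively nonnegative values, so the original
  ones are strictly positive.\<close>

lemma interior_sos_cone_pos:
  assumes t: "t \<in> interior_in (2 * d + 1) (sos_cone d)"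
  obtains P where "t = coeff P" "degree P = 2 * d" "0 < coeff P (2 * d)" "\<And>x. 0 < poly P x"
proof -
  have "t \<in> sos_cone d" using t interior_of_subset by (rule subsetD[rotated])
  then obtain P where P: "t = coeff P" "degree P \<le> 2 * d" by (auto simp: sos_cone_def)
  have cone: "\<exists>qs. x = coeff (\<Sum>q\<leftarrow>qs. q\<^sup>2) \<and> degree (\<Sum>q\<leftarrow>qs. q\<^sup>2) \<le> 2 * d" if "x \<in> sos_cone d" for x
    using that by (auto simp: sos_cone_def is_sos_def)
  have "0 < coeff P (2 * d)"
  proof -
    obtain \<delta> where \<delta>: "0 < \<delta>" "t(2 * d := t (2 * d) - \<delta>) \<in> sos_cone d"
      using interior_in_update[OF t, of "2 * d"] by auto
    obtain qs where qs: "t(2 * d := t (2 * d) - \<delta>) = coeff (\<Sum>q\<leftarrow>qs. q\<^sup>2)" "degree (\<Sum>q\<leftarrow>qs. q\<^sup>2) \<le> 2 * d"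
      using cone[OF \<delta>(2)] by blast
    have "t (2 * d) - \<delta> = (\<Sum>q\<leftarrow>qs. coeff (q\<^sup>2) (2 * d))"
      using fun_cong[OF qs(1), of "2 * d"] by (simp add: coeff_sum_list_map)
    also have "\<dots> \<ge> 0"
      using sos_degree_le[OF qs(2)] by (intro sum_list_nonneg) (auto simp: coeff_power2_top)
    finally show ?thesis using \<delta> P by simp
  qed
  moreover have "0 < poly P x" for x
  proof -
    obtain \<delta> where \<delta>: "0 < \<delta>" "t(0 := t 0 - \<delta>) \<in> sos_cone d"
      using interior_in_update[OF t, of 0] by auto
    obtain qs where qs: "t(0 := t 0 - \<delta>) = coeff (\<Sum>q\<leftarrow>qs. q\<^sup>2)"
      using cone[OF \<delta>(2)] by blast
    have "(\<Sum>q\<leftarrow>qs. q\<^sup>2) = P - [:\<delta>:]"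
      by (rule poly_eqI) (simp add: qs[symmetric] P(1) coeff_pCons split: nat.splits)
    then have "poly P x - \<delta> = poly (\<Sum>q\<leftarrow>qs. q\<^sup>2) x" by simp
    also have "\<dots> = (\<Sum>q\<leftarrow>qs. (poly q x)\<^sup>2)" by (induction qs) auto
    also have "\<dots> \<ge> 0" by (intro sum_list_nonneg) auto
    finally show ?thesis using \<delta> by simp
  qed
  moreover have "degree P = 2 * d" using P(2) \<open>0 < coeff P (2 * d)\<close> le_degree[of P "2 * d"] by simp
  ultimately show ?thesis using that P(1) by blast
qed

lemma pos_def_hankel_neighbourhood:
  assumes "pos_def (Suc d) (hankel d y)"
  obtains r where "0 < r" "\<And>z. (\<And>i. i < 2 * d + 1 \<Longrightarrow> \<bar>z i - y i\<bar> < r) \<Longrightarrow> pos_def (Suc d) (hankel d z)"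
proof -
  define T where "T = tr (Suc d) (minv (hankel d y))"
  have T: "0 \<le> T"
    unfolding T_def tr_def by (intro sum_nonneg pos_def_diag_nonneg[OF pos_def_minv[OF assms]]) auto
  define a where "a = real (Suc d) * T"
  have a: "0 \<le> a" using T by (simp add: a_def)
  \<comment> \<open>Adding 1 keeps the denominator positive even if \<open>a = 0\<close>.\<close>
  define r where "r = 1 / (2 * (a + 1))"
  have r: "0 < r" using a by (simp add: r_def)
  have "r * real (Suc d) * T = r * a" by (simp add: a_def)
  also have "\<dots> \<le> 1 / 2" using a by (simp add: r_def field_simps)
  finally have rT: "r * real (Suc d) * T \<le> 1 / 2" .
  have "pos_def (Suc d) (hankel d z)" if z: "\<And>i. i < 2 * d + 1 \<Longrightarrow> \<bar>z i - y i\<bar> < r" for z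
  proof -
    define E where "E = hankel d (\<lambda>i. z i - y i)"
    have "hankel d z = hankel d y + E" using hankel_add[of d y "\<lambda>i. z i - y i"] by (simp add: E_def)
    moreover have "pos_def (Suc d) (hankel d y + E)"
    proof (rule pos_def_perturb[OF assms])
      show "\<bar>quad (Suc d) E v\<bar> \<le> quad (Suc d) (hankel d y) v / 2" for v
      proof (rule abs_quad_le_half[OF assms])
        show "\<bar>E $$ (i, j)\<bar> \<le> r" if "i < Suc d" "j < Suc d" for i j
          using z[of "i + j"] that by (simp add: E_def less_imp_le)
      qed (use r rT in \<open>auto simp: T_def\<close>)
    qed (auto simp: E_def)
    ultimately show ?thesis by simp
  qed
  then show ?thesis using that r by blast
qed

lemma pos_def_interior_sos_dual:
  assumes "y \<in> topspace (Euclidean_space (2 * d + 1))" "pos_def (Suc d) (hankel d y)"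
  shows "y \<in> interior_in (2 * d + 1) (sos_dual d)"
proof -
  obtain r where "0 < r" and r: "\<And>z. (\<And>i. i < 2 * d + 1 \<Longrightarrow> \<bar>z i - y i\<bar> < r) \<Longrightarrow> pos_def (Suc d) (hankel d z)"
    using pos_def_hankel_neighbourhood[OF assms(2)] by blast
  show ?thesis
    using assms(1) \<open>0 < r\<close>
    by (rule interior_inI) (use r quad_nonneg in \<open>auto simp: sos_dual_iff[simplified]\<close>)
qed

section \<open>Gradient certificates\<close>

text \<open>If the form vanishes at \<open>v\<close>, its nonnegativity along the line through
  \<open>v\<close> in the direction \<open>A v\<close> forces \<open>A v = 0\<close>, so
  \<open>A\<close> is singular.\<close>

lemma psd_det_pos_def:
  assumes A: "A \<in> carrier_mat n n" and sym: "transpose_mat A = A"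
    and psd: "\<And>v. 0 \<le> quad n A v" and det: "Determinant.det A \<noteq> 0"
  shows "pos_def n A"
  unfolding pos_def_def
proof (intro conjI allI impI A sym)
  fix v :: "nat \<Rightarrow> real"
  assume v: "\<exists>i<n. v i \<noteq> 0"
  define w where "w i = (\<Sum>j<n. A $$ (i, j) * v j)" for i
  have symA: "A $$ (i, j) = A $$ (j, i)" if "i < n" "j < n" for i j
    using that A index_transpose_mat(1)[of i A j] by (simp add: sym)
  have expand: "quad n A (\<lambda>i. v i + s * w i) = quad n A v + 2 * s * (\<Sum>i<n. (w i)\<^sup>2) + s\<^sup>2 * quad n A w" for s
  proof -
    have 1: "(\<Sum>i<n. \<Sum>j<n. w i * A $$ (i, j) * v j) = (\<Sum>i<n. (w i)\<^sup>2)"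
      by (simp add: w_def power2_eq_square sum_distrib_left mult.assoc)
    have "(\<Sum>i<n. \<Sum>j<n. v i * A $$ (i, j) * w j) = (\<Sum>j<n. \<Sum>i<n. v i * A $$ (i, j) * w j)"
      by (rule sum.swap)
    also have "\<dots> = (\<Sum>i<n. \<Sum>j<n. w i * A $$ (i, j) * v j)"
      using symA by (intro sum.cong refl) (simp add: mult_ac)
    finally have 2: "(\<Sum>i<n. \<Sum>j<n. v i * A $$ (i, j) * w j) = (\<Sum>i<n. (w i)\<^sup>2)" using 1 by simp
    have "quad n A (\<lambda>i. v i + s * w i) = quad n A v + s * (\<Sum>i<n. \<Sum>j<n. w i * A $$ (i, j) * v j)
        + s * (\<Sum>i<n. \<Sum>j<n. v i * A $$ (i, j) * w j) + s\<^sup>2 * quad n A w"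
      unfolding quad_def sum_distrib_left sum.distrib[symmetric]
      by (intro sum.cong refl) (simp add: algebra_simps power2_eq_square)
    then show ?thesis unfolding 1 2 by simp
  qed
  show "0 < quad n A v"
  proof (rule ccontr)
    assume "\<not> 0 < quad n A v"
    then have q0: "quad n A v = 0" using psd[of v] by simp
    define c where "c = (\<Sum>i<n. (w i)\<^sup>2)"
    define Q where "Q = quad n A w"
    have Q: "0 \<le> Q" by (simp add: Q_def psd)
    have c: "0 \<le> c" by (simp add: c_def sum_nonneg)
    \<comment> \<open>For this step length the form at \<open>v - e w\<close> equals
      \<open>- (e\<^sup>2 * (Q + 2))\<close>.\<close>
    define e where "e = c / (Q + 1)"
    have ce: "c = e * (Q + 1)" using Q by (simp add: e_def)
    have "0 \<le> 2 * (- e) * c + (- e)\<^sup>2 * Q"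
      using psd[of "\<lambda>i. v i + (- e) * w i"] unfolding expand q0 c_def[symmetric] Q_def[symmetric] by simp
    also have "\<dots> = - (e\<^sup>2 * (Q + 2))"
      by (simp add: ce algebra_simps power2_eq_square)
    finally have "e\<^sup>2 * (Q + 2) \<le> 0" by simp
    then have "e = 0" using Q by (auto simp: mult_le_0_iff)
    then have "c = 0" by (simp add: ce)
    then have w0: "w i = 0" if "i < n" for i
      using that by (simp add: c_def sum_nonneg_eq_0_iff)
    define x where "x = Matrix.vec n v"
    have "x \<in> carrier_vec n" by (simp add: x_def)
    moreover have "x \<noteq> 0\<^sub>v n"
    proof
      assume "x = 0\<^sub>v n"
      then have "vec_index x i = 0" if "i < n" for i using that by simp
      then show False using v by (auto simp: x_def)
    qed
    moreover have "A *\<^sub>v x = 0\<^sub>v n"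
    proof (rule eq_vecI)
      fix i assume "i < dim_vec (0\<^sub>v n :: real Matrix.vec)"
      then have i: "i < n" by simp
      have "vec_index (A *\<^sub>v x) i = w i"
        using i A by (simp add: x_def w_def scalar_prod_def atLeast0LessThan)
      then show "vec_index (A *\<^sub>v x) i = vec_index (0\<^sub>v n) i" using w0[OF i] i by simp
    qed (use A in simp)
    ultimately have "Determinant.det A = 0" using det_0_iff_vec_prod_zero_field[OF A] by blast
    then show False using det by simp
  qed
qed

lemma continuous_on_det_hankel: "continuous_on UNIV (\<lambda>x. Determinant.det (hankel d x))"
  unfolding det_def'[OF hankel_carrier]
proof (intro continuous_on_sum continuous_on_mult continuous_on_const continuous_on_prod)
  fix p i assume "p \<in> {p. p permutes {0..<Suc d}}" "i \<in> {0..<Suc d}"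
  then have "i < Suc d" "p i < Suc d" using permutes_in_image[of p "{0..<Suc d}" i] by auto
  then show "continuous_on UNIV (\<lambda>x. hankel d x $$ (i, p i))" by simp
qed

lemma continuous_on_quad_hankel: "continuous_on UNIV (\<lambda>x. quad (Suc d) (hankel d x) v)"
proof -
  have "quad (Suc d) (hankel d x) v = (\<Sum>i<Suc d. \<Sum>j<Suc d. v i * x (i + j) * v j)" for x
    unfolding quad_def by (intro sum.cong refl) simp
  then show ?thesis by (simp only:) (intro continuous_intros continuous_on_product_coordinates)
qed

text \<open>These are the moments of the counting measure on \<open>0, \<dots>, d\<close>, and a
  nonzero polynomial of degree at most \<open>d\<close> cannot vanish at \<open>d + 1\<close>
  points. The point guarantees that the maximal determinant is positive.\<close>

lemma pos_def_hankel_points: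
  "pos_def (Suc d) (hankel d (\<lambda>i. if i < 2 * d + 1 then (\<Sum>k\<le>d. real k ^ i) else 0))"
  (is "pos_def _ (hankel d ?x)")
  unfolding pos_def_def
proof (intro conjI allI impI hankel_carrier transpose_hankel)
  fix v :: "nat \<Rightarrow> real"
  assume "\<exists>i<Suc d. v i \<noteq> 0"
  then obtain i where i: "i \<le> d" "v i \<noteq> 0" by (auto simp: less_Suc_eq_le)
  define p where "p = (\<Sum>i\<le>d. monom (v i) i)"
  have pv: "poly p x = (\<Sum>i\<le>d. v i * x ^ i)" for x by (simp add: p_def poly_sum poly_monom)
  have "quad (Suc d) (hankel d ?x) v = (\<Sum>i\<le>d. \<Sum>j\<le>d. \<Sum>k\<le>d. (v i * real k ^ i) * (v j * real k ^ j))"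
    unfolding quad_def lessThan_Suc_atMost
    by (intro sum.cong refl) (simp add: sum_distrib_left sum_distrib_right power_add mult_ac)
  also have "\<dots> = (\<Sum>i\<le>d. \<Sum>k\<le>d. \<Sum>j\<le>d. (v i * real k ^ i) * (v j * real k ^ j))"
    by (intro sum.cong refl sum.swap)
  also have "\<dots> = (\<Sum>k\<le>d. \<Sum>i\<le>d. \<Sum>j\<le>d. (v i * real k ^ i) * (v j * real k ^ j))"
    by (rule sum.swap)
  also have "\<dots> = (\<Sum>k\<le>d. (poly p (real k))\<^sup>2)"
    by (simp add: pv power2_eq_square sum_product)
  finally have eq: "quad (Suc d) (hankel d ?x) v = (\<Sum>k\<le>d. (poly p (real k))\<^sup>2)" .
  have "(\<Sum>k\<le>d. (poly p (real k))\<^sup>2) \<noteq> 0"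
  proof
    assume "(\<Sum>k\<le>d. (poly p (real k))\<^sup>2) = 0"
    then have z: "poly p (real k) = 0" if "k \<le> d" for k
      using that by (simp add: sum_nonneg_eq_0_iff)
    have "degree p \<le> d" unfolding p_def by (intro degree_sum_le) (auto intro: order_trans[OF degree_monom_le])
    moreover have "card (real ` {..d}) = Suc d" by (subst card_image) (auto simp: inj_on_def)
    ultimately have "p = 0"
      using z by (intro poly_eqI_degree[of "real ` {..d}"]) auto
    moreover have "coeff p i = v i" using i by (simp add: p_def coeff_sum)
    ultimately show False using i by simp
  qed
  then show "0 < quad (Suc d) (hankel d ?x) v"
    unfolding eq by (simp add: sum_nonneg order_less_le)
qed

text \<open>Tychonoff's theorem, as the ambient space has infinitely many coordinates.\<close>

lemma compact_box: "compact {x :: nat \<Rightarrow> real. \<forall>i. \<bar>x i\<bar> \<le> b}"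
proof -
  have "{x :: nat \<Rightarrow> real. \<forall>i. \<bar>x i\<bar> \<le> b} = PiE UNIV (\<lambda>i. {-b..b})"
    by (auto simp: PiE_def abs_le_iff extensional_def Pi_def) (metis minus_le_iff)+
  moreover have "compactin (product_topology (\<lambda>i. euclidean) UNIV) (PiE UNIV (\<lambda>i :: nat. {-b..b}))"
    unfolding compactin_PiE by simp
  ultimately show ?thesis by (simp add: euclidean_product_topology)
qed

text \<open>The gradient certificate maximizes \<open>det \<circ> hankel\<close> on a compact slice of the dual cone. Comparing with
  all points of the cone through homogeneity avoids a Lagrange multiplier.\<close>

lemma gradient_certificate:
  assumes M: "0 < M"
    and bound: "\<And>x k. x \<in> sos_dual d \<Longrightarrow> k < 2 * d + 1 \<Longrightarrow> \<bar>x k\<bar> \<le> M * inner_prod (2 * d + 1) t x"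
  obtains x where "x \<in> topspace (Euclidean_space (2 * d + 1))" "pos_def (Suc d) (hankel d x)"
    "inner_prod (2 * d + 1) t x = real (Suc d)"
    "\<And>k. k < 2 * d + 1 \<Longrightarrow> t k = frob (Suc d) (minv (hankel d x)) (unit_hankel d k)"
proof -
  define m n where "m = 2 * d + 1" and "n = Suc d"
  define SD where "SD = sos_dual d"
  define F where "F x = Determinant.det (hankel d x)" for x
  define L where "L x = inner_prod m t x" for x
  \<comment> \<open>For a gradient certificate the pairing of \<open>t\<close> with \<open>x\<close>
    is the trace of the identity, so at the level \<open>n\<close> the multiplier is 1.\<close>
  define K where "K = {x \<in> SD. L x = real n}"
  have n0: "0 < real n" by (simp add: n_def)
  have bnd: "\<bar>x k\<bar> \<le> M * L x" if "x \<in> SD" "k < m" for x k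
    using bound that unfolding m_def L_def SD_def by blast
  have dual: "x \<in> SD \<longleftrightarrow> (\<forall>i\<ge>m. x i = 0) \<and> (\<forall>v. 0 \<le> quad n (hankel d x) v)" for x
    unfolding SD_def sos_dual_iff m_def n_def topspace_Euclidean_space by blast
  have Lpos: "0 < L x" if x: "x \<in> SD" "pos_def n (hankel d x)" for x
  proof -
    have "\<exists>k<m. x k \<noteq> 0"
    proof (rule ccontr)
      assume "\<not> (\<exists>k<m. x k \<noteq> 0)"
      then have "quad n (hankel d x) (\<lambda>_. 1) = 0" by (auto simp: quad_def n_def m_def intro!: sum.neutral)
      moreover have "0 < quad n (hankel d x) (\<lambda>_. 1)"
        using x(2) by (auto simp: pos_def_def n_def)
      ultimately show False by simp
    qed
    then obtain k where "k < m" "x k \<noteq> 0" by blast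
    then have "0 < M * L x" using bnd[OF x(1), of k] by linarith
    then show ?thesis using M by (simp add: zero_less_mult_iff)
  qed
  have scale: "(\<lambda>i. real n / L x * x i) \<in> K" "F (\<lambda>i. real n / L x * x i) = (real n / L x) ^ n * F x"
    if x: "x \<in> SD" "0 < L x" for x
  proof -
    define c where "c = real n / L x"
    have c: "0 < c" using x n0 by (simp add: c_def)
    have "quad n (hankel d (\<lambda>i. c * x i)) v = c * quad n (hankel d x) v" for v
      unfolding hankel_smult n_def by (rule quad_smult) simp
    then have "(\<lambda>i. c * x i) \<in> SD" using x(1) c by (simp add: dual)
    moreover have "L (\<lambda>i. c * x i) = c * L x"
      by (simp add: L_def inner_prod_def sum_distrib_left mult_ac)
    then have "L (\<lambda>i. c * x i) = real n" using x(2) by (simp add: c_def)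
    ultimately show "(\<lambda>i. real n / L x * x i) \<in> K" by (simp add: K_def c_def)
    show "F (\<lambda>i. real n / L x * x i) = (real n / L x) ^ n * F x"
      unfolding F_def hankel_smult det_smult by (simp add: hankel_def n_def)
  qed
  have "compact K"
  proof -
    have L: "continuous_on UNIV L"
      unfolding L_def inner_prod_def by (intro continuous_intros continuous_on_product_coordinates)
    have eq: "K = {x. \<forall>i. \<bar>x i\<bar> \<le> M * real n} \<inter>
        ((\<Inter>i\<in>{m..}. {x. x i = 0}) \<inter> {x. \<forall>v. 0 \<le> quad n (hankel d x) v} \<inter> {x. L x = real n})"
    proof -
      have "\<bar>x i\<bar> \<le> M * real n" if "x \<in> K" for x i
        using that bnd[of x i] M n0 by (cases "i < m") (auto simp: K_def dual)
      then show ?thesis by (auto simp: K_def dual)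
    qed
    have "closed (\<Inter>i\<in>{m..}. {x :: nat \<Rightarrow> real. x i = 0})"
      by (intro closed_INT ballI closed_Collect_eq continuous_intros continuous_on_product_coordinates)
    moreover have "closed {x. \<forall>v. 0 \<le> quad n (hankel d x) v}"
      unfolding n_def by (intro closed_Collect_all closed_Collect_le continuous_intros continuous_on_quad_hankel)
    moreover have "closed {x. L x = real n}"
      by (intro closed_Collect_eq continuous_intros L)
    ultimately show ?thesis
      unfolding eq by (intro compact_Int_closed compact_box closed_Int)
  qed
  define p0 where "p0 = (\<lambda>i. if i < 2 * d + 1 then (\<Sum>k\<le>d. real k ^ i) else 0)"
  have p0: "pos_def n (hankel d p0)" unfolding n_def p0_def by (rule pos_def_hankel_points)
  have p0d: "p0 \<in> SD" using quad_nonneg[OF p0] by (simp add: dual) (simp add: p0_def m_def)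
  have "K \<noteq> {}" using scale(1)[OF p0d Lpos[OF p0d p0]] by blast
  have "continuous_on K F"
    unfolding F_def by (rule continuous_on_subset[OF continuous_on_det_hankel]) simp
  then obtain x where x: "x \<in> K" and max: "\<And>z. z \<in> K \<Longrightarrow> F z \<le> F x"
    using continuous_attains_sup[OF \<open>compact K\<close> \<open>K \<noteq> {}\<close>] by blast
  have xd: "x \<in> SD" and Lx: "L x = real n" using x by (auto simp: K_def)
  \<comment> \<open>The determinant is homogeneous of degree \<open>n\<close>, so maximality on the
    slice becomes an inequality between homogeneous functions, with equality at
    \<open>x\<close>.\<close>
  have maxh: "real n ^ n * F z \<le> F x * L z ^ n" if z: "z \<in> SD" "0 < L z" for z
  proof -
    have "(real n / L z) ^ n * F z \<le> F x" using max[OF scale(1)[OF z]] scale(2)[OF z] by simp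
    then show ?thesis using z by (simp add: power_divide field_simps)
  qed
  have "0 < F x"
  proof -
    have "0 < F p0" unfolding F_def by (rule pos_def_det_pos[OF p0])
    then have "0 < real n ^ n * F p0" using n0 by simp
    also have "\<dots> \<le> F x * L p0 ^ n" by (rule maxh[OF p0d Lpos[OF p0d p0]])
    finally show ?thesis using Lpos[OF p0d p0] by (simp add: zero_less_mult_iff)
  qed
  have pd: "pos_def n (hankel d x)"
    unfolding n_def
    by (rule psd_det_pos_def) (use xd \<open>0 < F x\<close> in \<open>auto simp: dual F_def n_def\<close>)
  obtain r where r: "0 < r"
    "\<And>z. (\<And>i. i < 2 * d + 1 \<Longrightarrow> \<bar>z i - x i\<bar> < r) \<Longrightarrow> pos_def (Suc d) (hankel d z)"
    using pos_def_hankel_neighbourhood pd unfolding n_def by metis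
  have grad: "t k = frob n (minv (hankel d x)) (unit_hankel d k)" if k: "k < m" for k
  proof -
    define E where "E = unit_hankel d k"
    \<comment> \<open>The defect of that inequality along the k-th coordinate direction: 0 at 0 and
      nonnegative nearby, so its derivative vanishes.\<close>
    define g where "g s = F x * (real n + s * t k) ^ n - real n ^ n * Determinant.det (hankel d x + s \<cdot>\<^sub>m E)" for s
    have det: "((\<lambda>s. Determinant.det (hankel d x + s \<cdot>\<^sub>m E)) has_real_derivative
        F x * frob n (minv (hankel d x)) E) (at 0)"
      unfolding F_def n_def
      by (rule has_derivative_det_line) (use \<open>0 < F x\<close> in \<open>auto simp: E_def F_def\<close>)
    have "(g has_real_derivative F x * (real n * real n ^ (n - 1) * t k)
        - real n ^ n * (F x * frob n (minv (hankel d x)) E)) (at 0)"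
      unfolding g_def by (auto intro!: derivative_eq_intros det)
    moreover have "g 0 \<le> g s" if s: "\<bar>0 - s\<bar> < r" for s
    proof -
      define z where "z = x(k := x k + s)"
      have hz: "hankel d z = hankel d x + s \<cdot>\<^sub>m E" by (simp add: z_def hankel_update E_def)
      have pz: "pos_def n (hankel d z)"
        unfolding n_def by (rule r(2)) (use s r(1) in \<open>auto simp: z_def\<close>)
      have zd: "z \<in> SD"
        using xd k quad_nonneg[OF pz] by (auto simp: dual z_def)
      have "L z = (\<Sum>i<m. t i * x i + (if i = k then s * t k else 0))"
        unfolding L_def inner_prod_def by (intro sum.cong) (auto simp: z_def algebra_simps)
      then have "L z = real n + s * t k" using k Lx by (simp add: sum.distrib L_def inner_prod_def)
      then have "0 \<le> g s"
        using maxh[OF zd Lpos[OF zd pz]] by (simp add: g_def hz[symmetric] F_def)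
      moreover have "hankel d x + 0 \<cdot>\<^sub>m E = hankel d x" by (intro eq_matI) (auto simp: E_def hankel_def)
      then have "g 0 = 0" by (simp add: g_def F_def)
      ultimately show ?thesis by simp
    qed
    ultimately have "F x * (real n * real n ^ (n - 1) * t k)
        - real n ^ n * (F x * frob n (minv (hankel d x)) E) = 0"
      using DERIV_local_min \<open>0 < r\<close> by blast
    moreover have "real n * real n ^ (n - 1) = real n ^ n" by (simp add: n_def)
    ultimately have "F x * (real n ^ n * t k) - real n ^ n * (F x * frob n (minv (hankel d x)) E) = 0"
      by (simp only:)
    then have "F x * real n ^ n * (t k - frob n (minv (hankel d x)) E) = 0"
      by (simp only: right_diff_distrib mult_ac)
    then show ?thesis using \<open>0 < F x\<close> n0 by (simp add: E_def)
  qed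
  show ?thesis
    by (rule that[of x])
       (use xd pd Lx grad in \<open>auto simp: dual L_def m_def n_def topspace_Euclidean_space\<close>)
qed

section \<open>The trace of a Gram matrix\<close>

text \<open>Lagrange interpolation at \<open>0, \<dots>, d\<close>. Distinct integer nodes differ by
  at least 1, so each linear factor of a basis polynomial has coefficients of absolute sum at most
  \<open>d + 1\<close>.\<close>

lemma coeff_of_values:
  obtains l :: "nat \<Rightarrow> nat \<Rightarrow> real" where
    "\<And>j a. j \<le> d \<Longrightarrow> \<bar>l j a\<bar> \<le> real (d + 1) ^ (d + 1)"
    "\<And>p :: real poly. \<And>a. degree p \<le> d \<Longrightarrow> coeff p a = (\<Sum>j\<le>d. l j a * poly p (real j))"
proof -
  define f where "f j i = (let c = 1 / (real j - real i) in [:- real i * c, c:])" for j i :: nat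
  define L where "L j = (\<Prod>i\<in>{..d} - {j}. f j i)" for j
  have fval: "poly (f j i) x = (x - real i) / (real j - real i)" for j i x
    by (simp add: f_def Let_def diff_divide_distrib)
  have deg: "degree (L j) \<le> d" if "j \<le> d" for j
  proof -
    have "degree (L j) \<le> (\<Sum>i\<in>{..d} - {j}. degree (f j i))"
      unfolding L_def using degree_prod_sum_le[of "{..d} - {j}" "f j"] by (simp add: o_def)
    also have "\<dots> \<le> (\<Sum>i\<in>{..d} - {j}. 1)"
      by (intro sum_mono) (simp add: f_def Let_def)
    also have "\<dots> = d" using that by simp
    finally show ?thesis .
  qed
  have val: "poly (L j) (real k) = (if j = k then 1 else 0)" if "j \<le> d" "k \<le> d" for j k
  proof (cases "j = k")
    case True
    then show ?thesis by (simp add: L_def poly_prod fval)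
  next
    case False
    then have "(\<Prod>i\<in>{..d} - {j}. poly (f j i) (real k)) = 0"
      using that by (intro prod_zero) (auto simp: fval intro!: bexI[of _ k])
    then show ?thesis using False by (simp add: L_def poly_prod)
  qed
  have bound: "poly_l1 (L j) \<le> real (d + 1) ^ (d + 1)" if "j \<le> d" for j
  proof -
    have "poly_l1 (L j) \<le> (\<Prod>i\<in>{..d} - {j}. poly_l1 (f j i))"
      unfolding L_def by (rule poly_l1_prod)
    also have "\<dots> \<le> (\<Prod>i\<in>{..d} - {j}. real (d + 1))"
    proof (intro prod_mono conjI poly_l1_nonneg)
      fix i assume i: "i \<in> {..d} - {j}"
      then have "1 \<le> \<bar>real j - real i\<bar>" by auto
      then have "\<bar>1 / (real j - real i)\<bar> \<le> 1" by (simp add: divide_le_eq_1)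
      moreover have "poly_l1 (f j i) = (real i + 1) * \<bar>1 / (real j - real i)\<bar>"
        by (simp add: f_def Let_def abs_mult add_divide_distrib)
      ultimately have "poly_l1 (f j i) \<le> (real i + 1) * 1"
        by (simp only:) (intro mult_left_mono, auto)
      then show "poly_l1 (f j i) \<le> real (d + 1)" using i by simp
    qed
    also have "\<dots> = real (d + 1) ^ d" using that by simp
    also have "\<dots> \<le> real (d + 1) ^ (d + 1)" by (intro power_increasing) auto
    finally show ?thesis .
  qed
  have interp: "p = (\<Sum>j\<le>d. Polynomial.smult (poly p (real j)) (L j))" if "degree p \<le> d" for p :: "real poly"
  proof (rule poly_eqI_degree)
    show "poly p x = poly (\<Sum>j\<le>d. Polynomial.smult (poly p (real j)) (L j)) x" if x: "x \<in> real ` {..d}" for x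
    proof -
      obtain k where k: "x = real k" "k \<le> d" using x by auto
      have "(\<Sum>j\<le>d. poly p (real j) * poly (L j) (real k)) = (\<Sum>j\<le>d. if j = k then poly p (real j) else 0)"
        using k by (intro sum.cong) (auto simp: val)
      then show ?thesis using k by (simp add: poly_sum)
    qed
    have "card (real ` {..d}) = d + 1" by (subst card_image) (auto simp: inj_on_def)
    moreover have "degree (\<Sum>j\<le>d. Polynomial.smult (poly p (real j)) (L j)) \<le> d"
      using deg by (intro degree_sum_le) (auto intro: order_trans[OF degree_smult_le])
    ultimately show "degree p < card (real ` {..d})"
      "degree (\<Sum>j\<le>d. Polynomial.smult (poly p (real j)) (L j)) < card (real ` {..d})"
      using that by auto
  qed
  show ?thesis
  proof (rule that[of "\<lambda>j a. coeff (L j) a"])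
    show "\<bar>coeff (L j) a\<bar> \<le> real (d + 1) ^ (d + 1)" if "j \<le> d" for j a
      using abs_coeff_le_poly_l1 bound[OF that] by (rule order_trans)
    show "coeff p a = (\<Sum>j\<le>d. coeff (L j) a * poly p (real j))" if "degree p \<le> d" for p a
      by (subst interp[OF that]) (simp add: coeff_sum mult.commute)
  qed
qed

text \<open>The rows of the factor \<open>D\<close> are coefficient vectors of polynomials; the
  trace is the sum of their squared coefficients, and \<open>quad\<close> at a vector of powers is
  the sum of their squared values. Interpolation links the two. The exponent is
  \<open>2 * (d + 1)\<close> from the squared interpolation constant, plus 1 for Cauchy-Schwarz over
  the nodes and 1 for the sum over the columns.\<close>

lemma trace_le_values:
  assumes G: "pos_def (Suc d) G"
  shows "tr (Suc d) G \<le> real (d + 1) ^ (2 * d + 4) * (\<Sum>j\<le>d. quad (Suc d) G (\<lambda>i. real j ^ i))"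
proof -
  obtain D where D: "D \<in> carrier_mat (Suc d) (Suc d)" and GD: "G = transpose_mat D * D"
    using pos_def_factor[OF G] by metis
  obtain l :: "nat \<Rightarrow> nat \<Rightarrow> real" where
    l: "\<And>j a. j \<le> d \<Longrightarrow> \<bar>l j a\<bar> \<le> real (d + 1) ^ (d + 1)"
    and lp: "\<And>p :: real poly. \<And>a. degree p \<le> d \<Longrightarrow> coeff p a = (\<Sum>j\<le>d. l j a * poly p (real j))"
    using coeff_of_values[of d] by metis
  define M where "M = real (d + 1) ^ (d + 1)"
  define p where "p k = (\<Sum>i\<le>d. monom (D $$ (k, i)) i)" for k
  have degp: "degree (p k) \<le> d" for k
    unfolding p_def by (intro degree_sum_le) (auto intro: order_trans[OF degree_monom_le])
  have cp: "coeff (p k) i = D $$ (k, i)" if "i \<le> d" for k i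
    using that by (auto simp: p_def coeff_sum)
  have pv: "poly (p k) x = (\<Sum>i<Suc d. D $$ (k, i) * x ^ i)" for k x
    by (simp add: p_def poly_sum poly_monom lessThan_Suc_atMost)
  have entry: "(D $$ (k, a))\<^sup>2 \<le> real (d + 1) * M\<^sup>2 * (\<Sum>j\<le>d. (poly (p k) (real j))\<^sup>2)" if "a \<le> d" for k a
  proof -
    have "(D $$ (k, a))\<^sup>2 = (\<Sum>j\<le>d. l j a * poly (p k) (real j))\<^sup>2"
      using lp[OF degp, of k a] cp[OF that, of k] by simp
    also have "\<dots> \<le> (\<Sum>j\<le>d. (l j a)\<^sup>2) * (\<Sum>j\<le>d. (poly (p k) (real j))\<^sup>2)"
      by (rule Cauchy_Schwarz_ineq_sum)
    also have "\<dots> \<le> (\<Sum>j\<le>d. M\<^sup>2) * (\<Sum>j\<le>d. (poly (p k) (real j))\<^sup>2)"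
    proof (intro mult_right_mono sum_mono sum_nonneg)
      fix j assume "j \<in> {..d}"
      then have "\<bar>l j a\<bar>\<^sup>2 \<le> M\<^sup>2" using l[of j a] unfolding M_def by (intro power_mono) auto
      then show "(l j a)\<^sup>2 \<le> M\<^sup>2" by simp
    qed simp
    also have "(\<Sum>j\<le>d. M\<^sup>2) = real (d + 1) * M\<^sup>2" by simp
    finally show ?thesis .
  qed
  have "tr (Suc d) G = (\<Sum>a\<le>d. \<Sum>k<Suc d. (D $$ (k, a))\<^sup>2)"
    unfolding tr_def GD lessThan_Suc_atMost[symmetric] using D
    by (intro sum.cong refl) (simp add: mult_mat_index[of _ "Suc d"] power2_eq_square del: sum.lessThan_Suc)
  also have "\<dots> \<le> (\<Sum>a\<le>d. \<Sum>k<Suc d. real (d + 1) * M\<^sup>2 * (\<Sum>j\<le>d. (poly (p k) (real j))\<^sup>2))"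
    by (intro sum_mono entry) simp
  also have "\<dots> = real (d + 1) * (real (d + 1) * M\<^sup>2 * (\<Sum>k<Suc d. \<Sum>j\<le>d. (poly (p k) (real j))\<^sup>2))"
    by (simp add: sum_distrib_left del: sum.lessThan_Suc)
  also have "(\<Sum>k<Suc d. \<Sum>j\<le>d. (poly (p k) (real j))\<^sup>2) = (\<Sum>j\<le>d. \<Sum>k<Suc d. (poly (p k) (real j))\<^sup>2)"
    by (rule sum.swap)
  also have "\<dots> = (\<Sum>j\<le>d. quad (Suc d) G (\<lambda>i. real j ^ i))"
    unfolding GD quad_gram[OF D] pv ..
  also have "real (d + 1) * (real (d + 1) * M\<^sup>2 * (\<Sum>j\<le>d. quad (Suc d) G (\<lambda>i. real j ^ i)))
      = real (d + 1) ^ (2 * d + 4) * (\<Sum>j\<le>d. quad (Suc d) G (\<lambda>i. real j ^ i))"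
  proof -
    have "real (d + 1) ^ (2 * d + 4) = real (d + 1) ^ (1 + 1 + (d + 1) * 2)"
      by (rule arg_cong[where f = "\<lambda>k. real (d + 1) ^ k"]) simp
    also have "\<dots> = real (d + 1) * (real (d + 1) * M\<^sup>2)"
      unfolding M_def power_add power_mult by (simp add: mult.assoc)
    finally show ?thesis by (simp only: mult.assoc)
  qed
  finally show ?thesis .
qed

section \<open>Certificates near a gradient certificate\<close>

lemma frob_sandwich:
  assumes G: "G \<in> carrier_mat n n" "transpose_mat G = G" and X: "X \<in> carrier_mat n n" and Y: "Y \<in> carrier_mat n n"
  shows "frob n (G * X * G) Y = frob n (G * Y * G) X"
proof -
  have "frob n (G * X * G) Y = frob n (G * X) (Y * G)"
    using frob_mult_right[of "G * X" n G Y] G X Y by simp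
  also have "\<dots> = frob n X (G * (Y * G))"
    using frob_mult_left[OF G(1) X, of "Y * G"] G Y by simp
  also have "G * (Y * G) = G * Y * G" using G Y by simp
  finally show ?thesis by (simp add: frob_commute)
qed

lemma frob_hankel:
  "frob (Suc d) M (hankel d w) = (\<Sum>k<2 * d + 1. w k * frob (Suc d) M (unit_hankel d k))"
proof -
  have "(\<Sum>k<2 * d + 1. w k * frob (Suc d) M (unit_hankel d k))
      = (\<Sum>k<2 * d + 1. \<Sum>i<Suc d. \<Sum>j<Suc d. if i + j = k then M $$ (i, j) * w k else 0)"
    unfolding frob_def sum_distrib_left by (intro sum.cong refl) auto
  also have "\<dots> = (\<Sum>i<Suc d. \<Sum>k<2 * d + 1. \<Sum>j<Suc d. if i + j = k then M $$ (i, j) * w k else 0)"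
    by (rule sum.swap)
  also have "\<dots> = (\<Sum>i<Suc d. \<Sum>j<Suc d. \<Sum>k<2 * d + 1. if i + j = k then M $$ (i, j) * w k else 0)"
    by (intro sum.cong refl sum.swap)
  also have "\<dots> = frob (Suc d) M (hankel d w)"
    unfolding frob_def by (intro sum.cong refl) (simp add: sum.delta' del: sum.lessThan_Suc)
  finally show ?thesis by simp
qed

text \<open>Polarization at two unit vectors whose indices add up to \<open>k\<close>; the choice
  \<open>min k d\<close> keeps both indices at most \<open>d\<close>.\<close>

lemma hankel_entry_zero_of_quad_zero:
  assumes zero: "\<And>v. quad (Suc d) (hankel d u) v = 0" and k: "k < 2 * d + 1"
  shows "u k = 0"
proof -
  define a where "a = min k d"
  define b where "b = k - a"
  have ab: "a < Suc d" "b < Suc d" "a + b = k" using k by (auto simp: a_def b_def)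
  define D where "D c i = (if i = c then 1 else 0 :: real)" for c i :: nat
  define q where "q c e = (\<Sum>i<Suc d. \<Sum>j<Suc d. D c i * u (i + j) * D e j)" for c e
  have q: "q c e = u (c + e)" if "c < Suc d" "e < Suc d" for c e
  proof -
    have "q c e = (\<Sum>i<Suc d. \<Sum>j<Suc d. if i = c then (if j = e then u (c + e) else 0) else 0)"
      unfolding q_def by (intro sum.cong refl) (auto simp: D_def)
    also have "\<dots> = (\<Sum>i<Suc d. if i = c then (\<Sum>j<Suc d. if j = e then u (c + e) else 0) else 0)"
      by (intro sum.cong refl) auto
    finally show ?thesis using that by (simp del: sum.lessThan_Suc)
  qed
  have quad_q: "quad (Suc d) (hankel d u) (\<lambda>i. D c i + D e i) = q c c + q c e + q e c + q e e" for c e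
    unfolding quad_def q_def sum.distrib[symmetric]
    by (intro sum.cong refl) (simp add: algebra_simps)
  have q_sum: "q c c + q c e + q e c + q e e = 0" for c e
    unfolding quad_q[symmetric] by (rule zero)
  have "q a a = 0" "q b b = 0" using q_sum[of a a] q_sum[of b b] by auto
  moreover have "q a b = u k" "q b a = u k" using q[of a b] q[of b a] ab by (auto simp: add.commute)
  ultimately show ?thesis using q_sum[of a b] by simp
qed

text \<open>Let \<open>w\<close> be the inverse Hessian at \<open>y\<close> applied to
  \<open>t\<close>. For \<open>y = x\<close> it is \<open>c * x\<close>. In general
  \<open>w / c - x\<close> solves a normal equation whose right-hand side is the small matrix of
  \<open>sandwich_difference\<close>, so its Hankel form is dominated by that of \<open>x\<close>
  and \<open>w\<close> stays in the dual cone.\<close>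

lemma dual_certificate_near_gradient_certificate:
  assumes pd: "pos_def (Suc d) (hankel d x)" and c: "0 < c" and t: "t \<in> sos_cone d"
    and grad: "\<And>k. k < 2 * d + 1 \<Longrightarrow> t k = c * frob (Suc d) (minv (hankel d x)) (unit_hankel d k)"
    and y: "y \<in> topspace (Euclidean_space (2 * d + 1))"
    and near: "\<And>k. k < 2 * d + 1 \<Longrightarrow> \<bar>y k - x k\<bar> \<le> 1 / 2"
    and small: "real (Suc d) * tr (Suc d) (minv (hankel d x)) \<le> 1 / 8"
  shows "dual_certificate d y t"
proof -
  define n m where "n = Suc d" and "m = 2 * d + 1"
  define A E B where "A = hankel d x" and "E = hankel d (\<lambda>i. y i - x i)" and "B = hankel d y"
  define G H where "G = minv A" and "H = minv B"
  have car: "A \<in> carrier_mat n n" "E \<in> carrier_mat n n" "B \<in> carrier_mat n n"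
    by (auto simp: A_def E_def B_def n_def)
  have G: "G \<in> carrier_mat n n" and H: "H \<in> carrier_mat n n"
    unfolding G_def H_def using car by (auto intro: minv_carrier)
  have BE: "B = A + E" unfolding A_def E_def B_def using hankel_add[of d x "\<lambda>i. y i - x i"] by simp
  have pA: "pos_def n A" using pd by (simp add: A_def n_def)
  have E_le: "\<bar>E $$ (i, j)\<bar> \<le> 1 / 2" if "i < n" "j < n" for i j
    using near[of "i + j"] that by (simp add: E_def n_def)
  have small': "real n * tr n G \<le> 1 / 8" using small by (simp add: n_def G_def A_def)
  have qE: "\<bar>quad n E v\<bar> \<le> quad n A v / 2" for v
    by (rule abs_quad_le_half[OF pA, of _ "1 / 2"]) (use E_le small' in \<open>auto simp: G_def\<close>)
  have pB: "pos_def n B"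
    unfolding BE by (rule pos_def_perturb[OF pA car(2) _ qE]) (simp add: E_def)
  have qB: "quad n B v = quad n A v + quad n E v" for v unfolding BE by (rule quad_add[OF car(1,2)])
  have Hsym: "transpose_mat H = H"
    using pos_def_minv[OF pB] by (simp add: pos_def_def H_def)
  have interior: "y \<in> interior_in (2 * d + 1) (sos_dual d)"
    using y pB by (intro pos_def_interior_sos_dual) (auto simp: n_def B_def)
  have S: "(\<Sum>i<n. \<Sum>j<n. \<bar>H $$ (i, j)\<bar>) \<le> 1 / 4"
  proof -
    have "tr n H \<le> (\<Sum>i<n. 2 * G $$ (i, i))"
      unfolding tr_def
    proof (intro sum_mono)
      fix i assume "i \<in> {..<n}"
      moreover have "quad n A v \<le> 2 * quad n B v" for v using qE[of v] qB[of v] by linarith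
      ultimately show "H $$ (i, i) \<le> 2 * G $$ (i, i)"
        unfolding H_def G_def by (intro minv_diag_perturb[OF pA pB]) auto
    qed
    then have "tr n H \<le> 2 * tr n G" by (simp add: tr_def sum_distrib_left)
    then have "real n * tr n H \<le> real n * (2 * tr n G)" by (intro mult_left_mono) auto
    then show ?thesis using sum_abs_entries_le[OF pos_def_minv[OF pB]] small' by (simp add: H_def)
  qed
  define X where "X = E + E + E * G * E"
  have X: "X \<in> carrier_mat n n" using car G by (simp add: X_def)
  \<comment> \<open>Twice 1/2 from \<open>E\<close> and 1/8 from the quadratic term leave a margin
    below 2.\<close>
  have X_le: "\<bar>X $$ (i, j)\<bar> \<le> 2" if ij: "i < n" "j < n" for i j
  proof -
    have "\<bar>(E * G * E) $$ (i, j)\<bar> = \<bar>\<Sum>l<n. \<Sum>k<n. E $$ (i, k) * G $$ (k, l) * E $$ (l, j)\<bar>"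
      using car G ij by (simp add: mult_mat_index[of _ n] sum_distrib_right del: assoc_mult_mat)
    also have "\<dots> \<le> (\<Sum>l<n. \<Sum>k<n. \<bar>E $$ (i, k) * G $$ (k, l) * E $$ (l, j)\<bar>)"
      by (intro order_trans[OF sum_abs] sum_mono sum_abs)
    also have "\<dots> \<le> (\<Sum>l<n. \<Sum>k<n. \<bar>G $$ (k, l)\<bar>)"
    proof (intro sum_mono)
      fix l k assume "l \<in> {..<n}" "k \<in> {..<n}"
      then have "\<bar>E $$ (i, k)\<bar> * \<bar>G $$ (k, l)\<bar> * \<bar>E $$ (l, j)\<bar> \<le> 1 * \<bar>G $$ (k, l)\<bar> * 1"
        using E_le[of i k] E_le[of l j] ij by (intro mult_mono) auto
      then show "\<bar>E $$ (i, k) * G $$ (k, l) * E $$ (l, j)\<bar> \<le> \<bar>G $$ (k, l)\<bar>" by (simp add: abs_mult)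
    qed
    also have "\<dots> = (\<Sum>k<n. \<Sum>l<n. \<bar>G $$ (k, l)\<bar>)" by (rule sum.swap)
    also have "\<dots> \<le> 1 / 8" using sum_abs_entries_le[OF pos_def_minv[OF pA]] small' by (simp add: G_def)
    finally have "\<bar>(E * G * E) $$ (i, j)\<bar> \<le> 1 / 8" .
    moreover have "X $$ (i, j) = E $$ (i, j) + E $$ (i, j) + (E * G * E) $$ (i, j)"
      using car G ij by (simp add: X_def)
    ultimately show ?thesis using E_le[OF ij] by linarith
  qed
  define Hs where "Hs = hessian m (barrier d) y"
  have Hs: "Hs \<in> carrier_mat m m" by (simp add: Hs_def hessian_def)
  have Hs_ij: "Hs $$ (i, j) = frob n (H * unit_hankel d i * H) (unit_hankel d j)" if "i < m" "j < m" for i j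
    using hessian_barrier[of d y i j] pos_def_det_pos[OF pB] that
    by (simp add: Hs_def H_def B_def n_def m_def)
  have unit_car: "unit_hankel d i \<in> carrier_mat n n" for i by (simp add: n_def)
  have Hs_row: "(\<Sum>j<m. Hs $$ (i, j) * w j) = frob n (H * hankel d w * H) (unit_hankel d i)" if "i < m" for i w
  proof -
    have "(\<Sum>j<m. Hs $$ (i, j) * w j) = frob n (H * unit_hankel d i * H) (hankel d w)"
      unfolding n_def frob_hankel[of d _ w] m_def[symmetric]
      using that by (intro sum.cong refl) (simp add: Hs_ij n_def)
    also have "\<dots> = frob n (H * hankel d w * H) (unit_hankel d i)"
      by (rule frob_sandwich[OF H Hsym unit_car]) (simp add: n_def)
    finally show ?thesis .
  qed
  \<comment> \<open>A kernel vector solves the normal equation with right-hand side 0, so its Hankel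
    form vanishes identically.\<close>
  have "Determinant.det Hs \<noteq> 0"
  proof
    assume "Determinant.det Hs = 0"
    then obtain v where v: "v \<in> carrier_vec m" "v \<noteq> 0\<^sub>v m" "Hs *\<^sub>v v = 0\<^sub>v m"
      using det_0_iff_vec_prod_zero_field[OF Hs] by blast
    define w where "w = vec_index v"
    have U: "hankel d w \<in> carrier_mat n n" by (simp add: n_def)
    have "(\<Sum>j<m. Hs $$ (i, j) * w j) = 0" if "i < m" for i
    proof -
      have "vec_index (Hs *\<^sub>v v) i = (\<Sum>j<m. Hs $$ (i, j) * w j)"
        using that Hs v(1) by (simp add: scalar_prod_def atLeast0LessThan w_def)
      then show ?thesis using v(3) that by simp
    qed
    then have "frob n (H * hankel d w * H) (unit_hankel d i) = 0" if "i < m" for i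
      using Hs_row that by simp
    then have "frob n (H * hankel d w * H) (hankel d w) = 0"
      unfolding n_def frob_hankel[of d _ w] m_def[symmetric] by simp
    moreover have "frob n (H * 0\<^sub>m n n * H) (hankel d w) = 0"
      using H by (simp add: frob_def)
    ultimately have "\<bar>quad n (hankel d w) p\<bar> \<le> 0 * (1 / 4) * quad n B p" for p
      using S by (intro abs_quad_le_of_normal_equation[OF pB zero_carrier_mat U]) (auto simp: H_def)
    then have "w k = 0" if "k < m" for k
      using hankel_entry_zero_of_quad_zero[of d w k] that by (simp add: n_def m_def)
    then have "v = 0\<^sub>v m" using v(1) by (intro eq_vecI) (auto simp: w_def)
    then show False using v(2) by simp
  qed
  then have "Hs \<in> Units (ring_mat TYPE(real) m ())" by (rule det_non_zero_imp_unit[OF Hs])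
  then obtain Hinv where inv: "mat_inverse Hs = Some Hinv"
    using mat_inverse(1)[OF Hs, of "()"] by (cases "mat_inverse Hs") auto
  have Hinv: "Hs * Hinv = 1\<^sub>m m" "Hinv \<in> carrier_mat m m" using mat_inverse(2)[OF Hs inv] by auto
  define w where "w = mat_apply m Hinv t"
  have wsys: "(\<Sum>j<m. Hs $$ (i, j) * w j) = t i" if "i < m" for i
  proof -
    define \<tau> where "\<tau> = Matrix.vec m t"
    have \<tau>: "\<tau> \<in> carrier_vec m" by (simp add: \<tau>_def)
    have "(\<Sum>j<m. Hs $$ (i, j) * w j) = vec_index (Hs *\<^sub>v (Hinv *\<^sub>v \<tau>)) i"
      using that Hs Hinv(2) \<tau> by (simp add: scalar_prod_def atLeast0LessThan w_def mat_apply_def \<tau>_def)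
    also have "Hs *\<^sub>v (Hinv *\<^sub>v \<tau>) = \<tau>"
      using assoc_mult_mat_vec[OF Hs Hinv(2) \<tau>] Hinv(1) \<tau> by simp
    finally show ?thesis using that by (simp add: \<tau>_def)
  qed
  define W where "W = hankel d w"
  have W: "W \<in> carrier_mat n n" by (simp add: W_def n_def)
  have grad_eq: "frob n (H * W * H) (hankel d u) = c * frob n G (hankel d u)" for u
  proof -
    have "frob n (H * W * H) (unit_hankel d k) = c * frob n G (unit_hankel d k)" if "k < m" for k
      using Hs_row[OF that, of w] wsys[OF that] grad[of k] that
      by (simp add: W_def n_def m_def G_def A_def)
    then show ?thesis
      unfolding n_def frob_hankel[of d _ u] m_def[symmetric]
      by (simp add: sum_distrib_left mult.left_commute)
  qed
  \<comment> \<open>The rescaled deviation from the exact solution \<open>c * x\<close>, written as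
    a sum of multiples so that \<open>hankel_add\<close> and \<open>hankel_smult\<close>
    apply.\<close>
  define u where "u i = (1 / c) * w i + (- 1) * x i" for i
  define U where "U = hankel d u"
  have U: "U \<in> carrier_mat n n" by (simp add: U_def n_def)
  have UW: "U = (1 / c) \<cdot>\<^sub>m W + (- 1) \<cdot>\<^sub>m A"
    unfolding U_def u_def hankel_add hankel_smult W_def A_def ..
  have "frob n (H * U * H) U = (1 / c) * frob n W (H * U * H) + (- 1) * frob n A (H * U * H)"
  proof -
    have "frob n U (H * U * H) = (1 / c) * frob n W (H * U * H) + (- 1) * frob n A (H * U * H)"
      by (subst (1) UW) (use W car in \<open>simp add: frob_add_left frob_smult_left\<close>)
    then show ?thesis by (simp add: frob_commute)
  qed
  also have "frob n W (H * U * H) = frob n (H * W * H) U"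
    using frob_sandwich[OF H Hsym U W] by (simp add: frob_commute)
  also have "\<dots> = c * frob n G U" unfolding U_def by (rule grad_eq)
  also have "frob n A (H * U * H) = frob n (H * A * H) U"
    using frob_sandwich[OF H Hsym U car(1)] by (simp add: frob_commute)
  finally have "frob n (H * U * H) U = frob n (G - H * A * H) U"
    using c G H car by (simp add: frob_minus_left)
  also have "G - H * A * H = H * X * H"
    using sandwich_difference[OF pA car(2)] pB unfolding BE G_def H_def X_def by simp
  finally have normal: "frob n (minv B * U * minv B) U = frob n (minv B * X * minv B) U"
    by (simp add: H_def)
  \<comment> \<open>The constants meet here: 2 for the entries of \<open>X\<close>, 1/4 for those of
    \<open>H\<close>, and \<open>quad n B p\<close> is at most 3/2 of \<open>quad n A p\<close>,
    which makes 3/4 in total.\<close>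
  have "0 \<le> quad n W p" for p
  proof -
    have "\<bar>quad n U p\<bar> \<le> 2 * (1 / 4) * quad n B p"
      by (rule abs_quad_le_of_normal_equation[OF pB X U normal]) (use X_le S in \<open>auto simp: H_def\<close>)
    then have "\<bar>quad n U p\<bar> \<le> quad n A p"
      using qB[of p] qE[of p] quad_nonneg[OF pA, of p] by linarith
    moreover have "quad n U p = (1 / c) * quad n W p - quad n A p"
      unfolding UW using W car by (simp add: quad_add quad_smult)
    ultimately have "0 \<le> (1 / c) * quad n W p" by linarith
    then show ?thesis using c by (simp add: zero_le_divide_iff)
  qed
  moreover have "w \<in> topspace (Euclidean_space m)"
    by (simp add: w_def mat_apply_def topspace_Euclidean_space)
  ultimately have "w \<in> sos_dual d"
    unfolding sos_dual_iff by (simp add: W_def n_def m_def)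
  then show ?thesis
    unfolding dual_certificate_def
    using interior t inv by (auto simp: Hs_def m_def w_def)
qed

section \<open>Size of the integer certificate\<close>

lemma reflect_of_int_poly: "of_int_poly (reflect_poly p) = (reflect_poly (of_int_poly p) :: real poly)"
  by (rule poly_eqI) (simp add: coeff_reflect_poly)

text \<open>For \<open>z\<close> in the unit interval the left-hand side is at most 1. Outside, the
  bound is applied to the reversed polynomial at \<open>inverse z\<close>: reversal preserves the
  degree and the coefficient bound, and \<open>z ^ n\<close> is positive because \<open>n\<close> is
  even.\<close>

lemma int_poly_pos_power_lower_bound:
  fixes p :: "int poly" and T :: int and z :: real
  defines "n \<equiv> degree p"
  assumes n: "1 \<le> n" "even n" and T: "\<And>i. \<bar>coeff p i\<bar> \<le> T"
    and pos: "\<And>z :: real. 0 < poly (of_int_poly p) z" and k: "k \<le> n"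
  shows "\<bar>z\<bar> ^ k \<le> fact (2 * n - 1) * (real n * of_int T + 1) ^ (2 * n - 1) * poly (of_int_poly p) z"
proof -
  define H :: real where "H = fact (2 * n - 1) * (real n * of_int T + 1) ^ (2 * n - 1)"
  have H0: "0 \<le> H" using T[of 0] by (simp add: H_def)
  show ?thesis
  proof (cases "\<bar>z\<bar> \<le> 1")
    case True
    have "\<bar>z\<bar> ^ k \<le> 1" using True by (simp add: power_le_one)
    also have "1 \<le> poly (of_int_poly p) z * H"
      unfolding H_def n_def
      by (rule int_poly_pos_lower_bound) (use n T pos True in \<open>auto simp: n_def\<close>)
    finally show ?thesis by (simp add: H_def mult_ac)
  next
    case False
    then have z: "1 < \<bar>z\<bar>" "z \<noteq> 0" by auto
    define q where "q = reflect_poly p"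
    have p0: "coeff p 0 \<noteq> 0"
    proof
      assume "coeff p 0 = 0"
      then have "poly (of_int_poly p) (0::real) = 0" by (simp add: poly_0_coeff_0)
      then show False using pos[of 0] by simp
    qed
    have degq: "degree q = n" unfolding q_def n_def using p0 by (rule degree_reflect_poly_eq)
    have qT: "\<bar>coeff q i\<bar> \<le> T" for i
      using order_trans[OF abs_ge_zero T[of 0]] T by (simp add: q_def coeff_reflect_poly)
    have qval: "poly (of_int_poly q) w = w ^ n * poly (of_int_poly p) (inverse w)" if "w \<noteq> 0" for w :: real
      using that by (simp add: q_def reflect_of_int_poly poly_reflect_poly_nz n_def)
    \<comment> \<open>The leading coefficient is the value of the reversed polynomial at 0, the one
      point that \<open>qval\<close> does not cover.\<close>
    have lc: "0 < coeff p n"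
    proof (rule ccontr)
      assume "\<not> 0 < coeff p n"
      then have "coeff p n < 0" using p0 by (metis leading_coeff_0_iff coeff_0 linorder_neqE n_def)
      then have "0 < lead_coeff (- of_int_poly p :: real poly)" by (simp add: n_def)
      from poly_pinfty_gt_lc[OF this] obtain b :: real where "\<And>x. b \<le> x \<Longrightarrow> 0 < poly (- of_int_poly p) x"
        by (metis \<open>0 < lead_coeff (- of_int_poly p)\<close> less_le_trans)
      from this[of b] pos[of b] show False by simp
    qed
    have qpos: "0 < poly (of_int_poly q) w" if "\<bar>w\<bar> \<le> 1" for w :: real
    proof (cases "w = 0")
      case True
      have "poly (of_int_poly q) (0::real) = of_int (coeff q 0)" by (simp add: poly_0_coeff_0)
      then show ?thesis using True lc by (simp add: q_def n_def)
    next
      case False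
      then show ?thesis using qval pos n(2) by (simp add: zero_less_power_eq)
    qed
    have "1 \<le> poly (of_int_poly q) (inverse z) * H"
      unfolding H_def degq[symmetric]
      by (rule int_poly_pos_lower_bound) (use n degq qT qpos z in \<open>auto simp: inverse_le_1_iff\<close>)
    also have "poly (of_int_poly q) (inverse z) = inverse (z ^ n) * poly (of_int_poly p) z"
      using qval[of "inverse z"] z by (simp add: power_inverse)
    finally have "z ^ n \<le> poly (of_int_poly p) z * H"
      using z n(2) by (simp add: field_simps zero_less_power_eq)
    moreover have "\<bar>z\<bar> ^ k \<le> \<bar>z\<bar> ^ n" using z k by (intro power_increasing) auto
    moreover have "\<bar>z\<bar> ^ n = z ^ n" using n(2) by (simp add: power_even_abs)
    ultimately show ?thesis by (simp add: H_def mult_ac)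
  qed
qed

lemma abs_dual_coordinate_le:
  assumes P: "degree P = 2 * d" and low: "\<And>z k. k \<le> 2 * d \<Longrightarrow> \<bar>z\<bar> ^ k \<le> H * poly P z"
    and x: "x \<in> sos_dual d" and k: "k < 2 * d + 1"
  shows "\<bar>x k\<bar> \<le> H * inner_prod (2 * d + 1) (coeff P) x"
proof -
  have "0 \<le> H * inner_prod (2 * d + 1) (coeff P) x + s * x k" if s: "\<bar>s\<bar> = 1" for s
  proof -
    define Q where "Q = Polynomial.smult H P + monom s k"
    have "0 \<le> poly Q z" for z
    proof -
      have "\<bar>s * z ^ k\<bar> \<le> H * poly P z" using low[of k z] k s by (simp add: abs_mult power_abs)
      then show ?thesis by (simp add: Q_def poly_monom abs_le_iff)
    qed
    then have "is_sos Q" by (rule nonneg_poly_is_sos)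
    moreover have "degree Q \<le> 2 * d"
      unfolding Q_def using P k
      by (intro degree_add_le) (auto intro: order_trans[OF degree_smult_le] order_trans[OF degree_monom_le])
    ultimately have "coeff Q \<in> sos_cone d" by (auto simp: sos_cone_def)
    then have "0 \<le> inner_prod (2 * d + 1) (coeff Q) x" using x by (auto simp: dual_cone_def)
    also have "inner_prod (2 * d + 1) (coeff Q) x
        = (\<Sum>i<2 * d + 1. H * (coeff P i * x i) + (if i = k then s * x k else 0))"
      unfolding inner_prod_def by (intro sum.cong refl) (auto simp: Q_def algebra_simps)
    also have "\<dots> = H * inner_prod (2 * d + 1) (coeff P) x + s * x k"
      using k by (simp add: sum.distrib inner_prod_def sum_distrib_left del: sum.lessThan_Suc)
    finally show ?thesis .
  qed
  from this[of 1] this[of "-1"] show ?thesis by (simp add: abs_le_iff)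
qed

lemma minv_smult:
  assumes A: "pos_def n A" and c: "0 < c"
  shows "pos_def n (c \<cdot>\<^sub>m A)" "minv (c \<cdot>\<^sub>m A) = (1 / c) \<cdot>\<^sub>m minv A"
proof -
  have Ac: "A \<in> carrier_mat n n" "transpose_mat A = A" using A by (auto simp: pos_def_def)
  show "pos_def n (c \<cdot>\<^sub>m A)"
    unfolding pos_def_def
  proof (intro conjI allI impI)
    show "transpose_mat (c \<cdot>\<^sub>m A) = c \<cdot>\<^sub>m A"
      using Ac by (intro eq_matI) (auto simp: pos_def_sym[OF A])
    fix v :: "nat \<Rightarrow> real"
    assume "\<exists>i<n. v i \<noteq> 0"
    then have "0 < quad n A v" using A by (auto simp: pos_def_def)
    then show "0 < quad n (c \<cdot>\<^sub>m A) v" using c by (simp add: quad_smult[OF Ac(1)])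
  qed (use Ac in simp)
  have G: "minv A \<in> carrier_mat n n" by (rule minv_carrier[OF Ac(1)])
  show "minv (c \<cdot>\<^sub>m A) = (1 / c) \<cdot>\<^sub>m minv A"
  proof (rule minv_unique)
    have "(c \<cdot>\<^sub>m A) * ((1 / c) \<cdot>\<^sub>m minv A) = c \<cdot>\<^sub>m (A * ((1 / c) \<cdot>\<^sub>m minv A))"
      by (rule mult_smult_assoc_mat[of _ n n _ n]) (use Ac G in auto)
    also have "A * ((1 / c) \<cdot>\<^sub>m minv A) = (1 / c) \<cdot>\<^sub>m (A * minv A)"
      by (rule mult_smult_distrib[OF Ac(1) G])
    also have "c \<cdot>\<^sub>m \<dots> = 1\<^sub>m n"
      unfolding pos_def_minv_inverse[OF A] using c by (intro eq_matI) auto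
    finally show "(c \<cdot>\<^sub>m A) * ((1 / c) \<cdot>\<^sub>m minv A) = 1\<^sub>m n" .
  qed (use Ac G in auto)
qed

text \<open>In other words, \<open>G\<close> is a Gram matrix of the polynomial whose coefficients
  are its image under the adjoint of \<open>hankel d\<close>; for a gradient certificate this
  polynomial is \<open>t\<close>.\<close>

lemma quad_powers:
  "quad (Suc d) G (\<lambda>i. z ^ i) = (\<Sum>k<2 * d + 1. z ^ k * frob (Suc d) G (unit_hankel d k))"
proof -
  have "quad (Suc d) G (\<lambda>i. z ^ i) = frob (Suc d) G (hankel d (\<lambda>i. z ^ i))"
    unfolding quad_def frob_def by (intro sum.cong refl) (simp add: power_add)
  also have "\<dots> = (\<Sum>k<2 * d + 1. z ^ k * frob (Suc d) G (unit_hankel d k))"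
    by (rule frob_hankel)
  finally show ?thesis .
qed

lemma max_norm_ge: "i < n \<Longrightarrow> \<bar>x i\<bar> \<le> max_norm n x"
  unfolding max_norm_def by (intro Max_ge) auto

lemma max_norm_le:
  assumes "0 < n" "\<And>i. i < n \<Longrightarrow> \<bar>x i\<bar> \<le> b"
  shows "max_norm n x \<le> b"
  unfolding max_norm_def using assms by (subst Max_le_iff) auto

text \<open>Every factor is at most a power of \<open>8 d T\<close> with exponent linear in \<open>d\<close>.\<close>

lemma certificate_size_bound:
  fixes T \<theta> :: real and d :: nat
  assumes d: "1 \<le> d" and T: "1 \<le> T" and \<theta>: "0 \<le> \<theta>" "\<theta> \<le> T"
  defines "R \<equiv> real (d + 1) ^ (2 * d + 4) * (real (d + 1) * (real (2 * d + 1) * (T * real d ^ (2 * d))))"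
    and "H \<equiv> fact (2 * (2 * d) - 1) * (real (2 * d) * \<theta> + 1) ^ (2 * (2 * d) - 1)"
  shows "8 * real (d + 1) * R * (H * real (d + 1)) + 1 \<le> (8 * real d * T) ^ (23 * d)"
proof -
  define q where "q = 8 * real d * T"
  have rd: "1 \<le> real d" using d by simp
  define s where "s = real d * T"
  have q: "q = 8 * s" by (simp add: q_def s_def)
  have ds: "real d \<le> s" using mult_left_mono[OF T, of "real d"] by (simp add: s_def)
  have Ts: "T \<le> s" using mult_right_mono[OF rd, of T] T by (simp add: s_def)
  have q8: "8 \<le> q" using ds rd by (simp add: q)
  have q1: "1 \<le> q" "0 \<le> q" using q8 by auto
  have b1: "real (d + 1) \<le> q" using ds rd by (simp add: q)
  have b2: "real (2 * d + 1) \<le> q" using ds rd by (simp add: q)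
  have b3: "T \<le> q" using Ts T by (simp add: q)
  have b4: "real d \<le> q" using ds rd by (simp add: q)
  have "R \<le> q ^ (2 * d + 4) * (q * (q * (q * q ^ (2 * d))))"
    unfolding R_def using b1 b2 b3 b4 q1 T
    by (intro mult_mono power_mono mult_nonneg_nonneg) auto
  also have "\<dots> = q ^ ((2 * d + 4) + (1 + (1 + (1 + 2 * d))))"
    by (simp only: power_add power_one_right)
  also have "(2 * d + 4) + (1 + (1 + (1 + 2 * d))) = 4 * d + 7" by simp
  finally have R: "R \<le> q ^ (4 * d + 7)" .
  define e where "e = 2 * (2 * d) - 1"
  have "fact e \<le> real e ^ e" using fact_le_power[of e] by simp
  also have "\<dots> \<le> q ^ e"
    using ds rd by (intro power_mono) (auto simp: e_def q of_nat_diff)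
  finally have f: "fact e \<le> q ^ e" .
  \<comment> \<open>In the application \<theta> is the floor of \<open>T\<close>, because the bound
    on the integer coefficients has to be an integer.\<close>
  have "real (2 * d) * \<theta> \<le> real (2 * d) * T" using \<theta> by (intro mult_left_mono) auto
  also have "\<dots> = 2 * s" by (simp add: s_def)
  finally have "real (2 * d) * \<theta> + 1 \<le> q" using ds rd unfolding q by linarith
  then have "(real (2 * d) * \<theta> + 1) ^ e \<le> q ^ e" using \<theta> by (intro power_mono) auto
  then have "H \<le> q ^ e * q ^ e"
    unfolding H_def e_def[symmetric] using f q1 \<theta> by (intro mult_mono) auto
  also have "\<dots> = q ^ (2 * e)" by (simp add: power_add[symmetric] mult_2)
  also have "\<dots> \<le> q ^ (8 * d)" using q1 by (intro power_increasing) (auto simp: e_def)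
  finally have H: "H \<le> q ^ (8 * d)" .
  have H0: "0 \<le> H" using \<theta> by (simp add: H_def)
  have R0: "0 \<le> R" using T by (simp add: R_def)
  have "8 * real (d + 1) * R * (H * real (d + 1)) \<le> q * q * q ^ (4 * d + 7) * (q ^ (8 * d) * q)"
    using q8 q1 b1 R H H0 R0 by (intro mult_mono mult_nonneg_nonneg) auto
  also have "\<dots> = q ^ ((1 + 1 + (4 * d + 7)) + (8 * d + 1))"
    by (simp only: power_add power_one_right)
  also have "(1 + 1 + (4 * d + 7)) + (8 * d + 1) = 12 * d + 10" by simp
  also have "q ^ (12 * d + 10) + 1 \<le> q * q ^ (12 * d + 10)"
  proof -
    have "1 \<le> q ^ (12 * d + 10)" using q1 by simp
    then have "q ^ (12 * d + 10) + 1 \<le> 8 * q ^ (12 * d + 10)" by simp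
    also have "\<dots> \<le> q * q ^ (12 * d + 10)" using q8 q1 by (intro mult_right_mono) auto
    finally show ?thesis .
  qed
  also have "\<dots> = q ^ Suc (12 * d + 10)" by (rule power_Suc[symmetric])
  \<comment> \<open>The summand 1 for rounding has cost one more factor \<open>q\<close>; since
    \<open>1 \<le> d\<close>, the resulting exponent \<open>12 * d + 11\<close> is at most
    \<open>23 * d\<close>.\<close>
  also have "\<dots> \<le> q ^ (23 * d)" using q1 d by (intro power_increasing) auto
  finally show ?thesis by (simp add: q_def)
qed

text \<open>The logarithm of the bound is \<open>23 * d * (3 + log 2 d + log 2 T)\<close>. By
  \<open>d \<le> 1 + d * log 2 d\<close> the part \<open>69 * d\<close> is absorbed, and
  \<open>92 = 69 + 23\<close>.\<close>

lemma log_certificate_bound: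
  fixes T :: real and d :: nat
  assumes d: "1 \<le> d" and T: "1 \<le> T" and z: "0 \<le> z" "z \<le> (8 * real d * T) ^ (23 * d)"
  shows "log 2 z \<le> 92 * (1 + log 2 T * real d + real d * log 2 (real d))"
proof -
  define q where "q = 8 * real d * T"
  have q: "0 < q" using d T by (simp add: q_def)
  have lT: "0 \<le> log 2 T" and ld: "0 \<le> log 2 (real d)" using d T by simp_all
  have "log 2 q = 3 + log 2 (real d) + log 2 T"
  proof -
    have "log 2 q = log 2 8 + log 2 (real d) + log 2 T"
      unfolding q_def using d T by (simp add: log_mult)
    also have "log 2 8 = (3::real)" using log_pow_cancel[of 2 3] by simp
    finally show ?thesis .
  qed
  then have lq: "log 2 (q ^ (23 * d)) = 23 * real d * (3 + log 2 (real d) + log 2 T)"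
    using q by (simp add: log_nat_power)
  have nonneg: "0 \<le> log 2 (q ^ (23 * d))" unfolding lq using lT ld by simp
  have "log 2 z \<le> log 2 (q ^ (23 * d))"
  proof (cases "z = 0")
    \<comment> \<open>Here \<open>log 2 0\<close> takes its default value 0.\<close>
    case True
    then show ?thesis using nonneg by (simp add: log_def)
  next
    case False
    then show ?thesis using z by (simp add: q_def)
  qed
  moreover have "real d \<le> 1 + real d * log 2 (real d)"
  proof (cases "d = 1")
    case False
    then have "1 \<le> log 2 (real d)" using d by (simp add: le_log_iff)
    then have "real d * 1 \<le> real d * log 2 (real d)" by (intro mult_left_mono) auto
    then show ?thesis by simp
  qed simp
  moreover have "0 \<le> log 2 T * real d" using lT by simp
  ultimately show ?thesis unfolding lq by (simp add: algebra_simps)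
qed

theorem corollary3p2:
  shows "\<exists>C::real. C > 0 \<and>
    (\<forall>d::nat. \<forall>t::nat \<Rightarrow> real.
      d \<ge> 1 \<and> t \<in> interior_in (2 * d + 1) (sos_cone d) \<and> integer_vector (2 * d + 1) t \<longrightarrow>
      (let \<tau> = log 2 (max_norm (2 * d + 1) t) in
       \<exists>y. y \<in> interior_in (2 * d + 1) (sos_dual d) \<and> integer_vector (2 * d + 1) y \<and>
           dual_certificate d y t \<and>
           log 2 (max_norm (2 * d + 1) y) \<le> C * (1 + \<tau> * real d + real d * log 2 (real d))))"
proof (rule exI[of _ 92], intro conjI allI impI)
  fix d :: nat and t :: "nat \<Rightarrow> real"
  assume "d \<ge> 1 \<and> t \<in> interior_in (2 * d + 1) (sos_cone d) \<and> integer_vector (2 * d + 1) t"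
  then have d: "1 \<le> d" and t: "t \<in> interior_in (2 * d + 1) (sos_cone d)" and int: "integer_vector (2 * d + 1) t"
    by auto
  define T where "T = max_norm (2 * d + 1) t"
  have tcone: "t \<in> sos_cone d" using t interior_of_subset by (rule subsetD[rotated])
  obtain P where P: "t = coeff P" "degree P = 2 * d" "0 < coeff P (2 * d)" "\<And>x. 0 < poly P x"
    using interior_sos_cone_pos[OF t] by blast
  have Tge: "\<bar>t i\<bar> \<le> T" if "i < 2 * d + 1" for i unfolding T_def by (rule max_norm_ge[OF that])
  have tint: "t i = of_int \<lfloor>t i\<rfloor>" if "i < 2 * d + 1" for i
    using int that by (auto simp: integer_vector_def elim: Ints_cases)
  \<comment> \<open>The top coefficient is a positive integer.\<close>
  have "1 \<le> T"
  proof -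
    have i: "t (2 * d) = of_int \<lfloor>t (2 * d)\<rfloor>" by (rule tint) simp
    moreover have "0 < t (2 * d)" using P(1,3) by simp
    ultimately have "0 < \<lfloor>t (2 * d)\<rfloor>" by linarith
    then have "1 \<le> t (2 * d)" using i by linarith
    then show ?thesis using Tge[of "2 * d"] by simp
  qed
  \<comment> \<open>Taking floors changes nothing, as all coefficients are integers; it only moves
    \<open>P\<close> to the type of integer polynomials.\<close>
  define p where "p = map_poly floor P"
  have cp: "coeff p i = \<lfloor>t i\<rfloor>" for i by (simp add: p_def coeff_map_poly P(1))
  have pP: "of_int_poly p = P"
  proof (rule poly_eqI)
    fix i
    show "coeff (of_int_poly p) i = coeff P i"
      using tint[of i] P(1,2) by (cases "i < 2 * d + 1") (auto simp: cp coeff_eq_0)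
  qed
  have degp: "degree p = 2 * d" using P(2) unfolding pP[symmetric] by simp
  have pT: "\<bar>coeff p i\<bar> \<le> \<lfloor>T\<rfloor>" for i
  proof (cases "i < 2 * d + 1")
    case True
    then have "of_int \<bar>\<lfloor>t i\<rfloor>\<bar> \<le> T" using Tge[OF True] tint[OF True] by simp
    then show ?thesis by (simp add: cp le_floor_iff)
  next
    case False
    then show ?thesis using \<open>1 \<le> T\<close> degp by (simp add: coeff_eq_0)
  qed
  define H where "H = fact (2 * (2 * d) - 1) * (real (2 * d) * of_int \<lfloor>T\<rfloor> + 1) ^ (2 * (2 * d) - 1)"
  have H0: "0 < H" using \<open>1 \<le> T\<close> by (simp add: H_def add_nonneg_pos)
  \<comment> \<open>Used twice: for the compactness of the slice and for the coordinates of the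
    maximizer.\<close>
  have low: "\<bar>z\<bar> ^ k \<le> H * poly P z" if "k \<le> 2 * d" for z k
    using int_poly_pos_power_lower_bound[of p "\<lfloor>T\<rfloor>" k z] d pT P(4) that
    unfolding degp pP H_def by simp
  obtain x where x: "x \<in> topspace (Euclidean_space (2 * d + 1))" "pos_def (Suc d) (hankel d x)"
    "inner_prod (2 * d + 1) t x = real (Suc d)"
    "\<And>k. k < 2 * d + 1 \<Longrightarrow> t k = frob (Suc d) (minv (hankel d x)) (unit_hankel d k)"
    using gradient_certificate[OF H0 abs_dual_coordinate_le[OF P(2) low, folded P(1)]] by blast
  have xd: "x \<in> sos_dual d" unfolding sos_dual_iff using x(1) quad_nonneg[OF x(2)] by blast
  have x_le: "\<bar>x k\<bar> \<le> H * real (d + 1)" if "k < 2 * d + 1" for k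
    using abs_dual_coordinate_le[OF P(2) low xd that] x(3) unfolding P(1)[symmetric] by simp
  define G where "G = minv (hankel d x)"
  \<comment> \<open>The factor \<open>real (2 * d + 1) * (T * real d ^ (2 * d))\<close> bounds a
    value of \<open>t\<close> at a node, \<open>d + 1\<close> counts the nodes, and the power comes
    from \<open>trace_le_values\<close>.\<close>
  define R where "R = real (d + 1) ^ (2 * d + 4) * (real (d + 1) * (real (2 * d + 1) * (T * real d ^ (2 * d))))"
  have R0: "0 < R" using \<open>1 \<le> T\<close> d by (simp add: R_def)
  have trG: "tr (Suc d) G \<le> R"
  proof -
    have "quad (Suc d) G (\<lambda>i. real j ^ i) \<le> real (2 * d + 1) * (T * real d ^ (2 * d))" if "j \<le> d" for j
    proof -
      have "quad (Suc d) G (\<lambda>i. real j ^ i) \<le> (\<Sum>k<2 * d + 1. T * real d ^ (2 * d))"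
        unfolding quad_powers
      proof (rule sum_mono)
        fix k assume "k \<in> {..<2 * d + 1}"
        then have k: "k < 2 * d + 1" by simp
        have "real j ^ k \<le> real d ^ k" using that by (intro power_mono) auto
        also have "\<dots> \<le> real d ^ (2 * d)" using k d by (intro power_increasing) auto
        finally have "real j ^ k * \<bar>t k\<bar> \<le> real d ^ (2 * d) * T"
          using Tge[OF k] by (intro mult_mono) auto
        moreover have "real j ^ k * t k \<le> real j ^ k * \<bar>t k\<bar>" by (intro mult_left_mono) auto
        ultimately show "real j ^ k * frob (Suc d) G (unit_hankel d k) \<le> T * real d ^ (2 * d)"
          unfolding G_def x(4)[OF k, symmetric] by (simp add: mult.commute)
      qed
      then show ?thesis by simp
    qed
    then have "(\<Sum>j\<le>d. quad (Suc d) G (\<lambda>i. real j ^ i)) \<le> (\<Sum>j\<le>d. real (2 * d + 1) * (T * real d ^ (2 * d)))"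
      by (intro sum_mono) auto
    also have "\<dots> = real (d + 1) * (real (2 * d + 1) * (T * real d ^ (2 * d)))" by simp
    finally have "real (d + 1) ^ (2 * d + 4) * (\<Sum>j\<le>d. quad (Suc d) G (\<lambda>i. real j ^ i)) \<le> R"
      unfolding R_def by (intro mult_left_mono) auto
    then show ?thesis
      using trace_le_values[OF pos_def_minv[OF x(2)]] unfolding G_def[symmetric] by linarith
  qed
  \<comment> \<open>Scaling by \<open>N\<close> divides the inverse by \<open>N\<close>, which
    brings \<open>d + 1\<close> times its trace down to 1/8.\<close>
  define N where "N = 8 * real (d + 1) * R"
  have N0: "0 < N" using R0 by (simp add: N_def)
  define x' where "x' k = N * x k" for k
  have hx': "hankel d x' = N \<cdot>\<^sub>m hankel d x" unfolding x'_def by (rule hankel_smult)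
  have G: "G \<in> carrier_mat (Suc d) (Suc d)" unfolding G_def by (rule minv_carrier) simp
  have Gx': "minv (hankel d x') = (1 / N) \<cdot>\<^sub>m G"
    unfolding hx' G_def by (rule minv_smult(2)[OF x(2) N0])
  \<comment> \<open>Rounding fixes 0, so \<open>y\<close> still vanishes from index
    \<open>2 * d + 1\<close> on.\<close>
  define y where "y k = real_of_int (round (x' k))" for k
  have ytop: "y \<in> topspace (Euclidean_space (2 * d + 1))"
    using x(1) by (simp add: topspace_Euclidean_space y_def x'_def)
  have near: "\<bar>y k - x' k\<bar> \<le> 1 / 2" for k unfolding y_def by (rule of_int_round_abs_le)
  have cert: "dual_certificate d y t"
  proof (rule dual_certificate_near_gradient_certificate[OF _ N0 tcone _ ytop near])
    show "pos_def (Suc d) (hankel d x')" unfolding hx' by (rule minv_smult(1)[OF x(2) N0])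
    show "t k = N * frob (Suc d) (minv (hankel d x')) (unit_hankel d k)" if "k < 2 * d + 1" for k
      unfolding Gx' frob_smult_left[OF G] using x(4)[OF that] N0 by (simp add: G_def)
    have "tr (Suc d) (minv (hankel d x')) = tr (Suc d) G / N"
      unfolding Gx' tr_def using G by (simp add: sum_divide_distrib del: sum.lessThan_Suc)
    also have "\<dots> \<le> R / N" using trG N0 by (intro divide_right_mono) auto
    also have "\<dots> = 1 / (8 * real (Suc d))" using R0 by (simp add: N_def)
    finally have "real (Suc d) * tr (Suc d) (minv (hankel d x')) \<le> real (Suc d) * (1 / (8 * real (Suc d)))"
      by (intro mult_left_mono) auto
    also have "\<dots> = 1 / 8" by (simp del: of_nat_Suc)
    finally show "real (Suc d) * tr (Suc d) (minv (hankel d x')) \<le> 1 / 8" .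
  qed
  have "max_norm (2 * d + 1) y \<le> N * (H * real (d + 1)) + 1"
  proof (rule max_norm_le)
    fix k assume k: "k < 2 * d + 1"
    have "\<bar>x' k\<bar> \<le> N * (H * real (d + 1))"
      using mult_left_mono[OF x_le[OF k], of N] N0 by (simp add: x'_def abs_mult)
    then show "\<bar>y k\<bar> \<le> N * (H * real (d + 1)) + 1" using near[of k] by linarith
  qed simp
  also have "\<dots> \<le> (8 * real d * T) ^ (23 * d)"
    unfolding N_def R_def H_def
    by (rule certificate_size_bound[OF d \<open>1 \<le> T\<close>]) (use \<open>1 \<le> T\<close> in auto)
  finally have size: "max_norm (2 * d + 1) y \<le> (8 * real d * T) ^ (23 * d)" .
  have "0 \<le> max_norm (2 * d + 1) y" using max_norm_ge[of 0 "2 * d + 1" y] by simp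
  from log_certificate_bound[OF d \<open>1 \<le> T\<close> this size] cert ytop
  show "let \<tau> = log 2 (max_norm (2 * d + 1) t) in
       \<exists>y. y \<in> interior_in (2 * d + 1) (sos_dual d) \<and> integer_vector (2 * d + 1) y \<and>
           dual_certificate d y t \<and>
           log 2 (max_norm (2 * d + 1) y) \<le> 92 * (1 + \<tau> * real d + real d * log 2 (real d))"
    unfolding Let_def T_def
    by (intro exI[of _ y]) (auto simp: dual_certificate_def integer_vector_def y_def)
qed simp

end
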